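(* Let $\mathcal{C}$ be a model category. Then there is a model structure on $\mathrm{Arr}\,\mathcal{C}$, called the injective model structure, with the following properties. (1) A map $\alpha$ in $\mathrm{Arr}\,\mathcal{C}$ is a weak equivalence (resp. cofibration) if and only if $\mathrm{Ev}_0\alpha$ and $\mathrm{Ev}_1\alpha$ are weak equivalences (resp. cofibrations) in $\mathcal{C}$. (2) A map $\alpha\colon f\to g$ is a (trivial) fibration if and only if the maps $\mathrm{Ev}_1\alpha$ and $$\mathrm{Ev}_0 f\xrightarrow{(f,\mathrm{Ev}_0\alpha)}\mathrm{Ev}_1 f\times_{\mathrm{Ev}_1 g}\mathrm{Ev}_0 g$$ are (trivial) fibrations in $\mathcal{C}$. In particular, if $\alpha$ is a fibration in $\mathrm{Arr}\,\mathcal{C}$, then both $\mathrm{Ev}_0\alpha$ and $\mathrm{Ev}_1\alpha$ are fibrations in $\mathcal{C}$. (3) The functors $L_0,L_1\colon\mathcal{C}\to\mathrm{Arr}\,\mathcal{C}$ are left Quillen functors, as are $\mathrm{Ev}_0$ and $\mathrm{Ev}_1$. (4) If $\mathcal{C}$ is a symmetric monoidal model category, the tensor product monoidal structure and the injective model structure on $\mathrm{Arr}\,\mathcal{C}$ make $\mathrm{Arr}\,\mathcal{C}$ into a symmetric monoidal model category.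
   Context: Model categories and symmetric monoidal model categories are in the sense of Hovey's book "Model Categories": model categories are bicomplete; a symmetric monoidal model category is a closed symmetric monoidal category with a model structure satisfying the pushout product axiom and the unit axiom (if $QS\to S$ is a cofibrant replacement of the unit $S$, then $QS\otimes A\to A$ is a weak equivalence for all cofibrant $A$). $\mathrm{Arr}\,\mathcal{C}$ is the category whose objects are morphisms of $\mathcal{C}$ and whose morphisms are commutative squares. $\mathrm{Ev}_0,\mathrm{Ev}_1\colon\mathrm{Arr}\,\mathcal{C}\to\mathcal{C}$ send $f\colon X_0\to X_1$ to $X_0$ and $X_1$ respectively. Their left adjoints are $L_0(X)=(1_X\colon X\to X)$ and $L_1(X)=(0\to X)$, with $0$ initial; their right adjoints are $U_0(X)=(X\to * )$ and $U_1(X)=1_X$, with $*$ terminal. The tensor product monoidal structure on $\mathrm{Arr}\,\mathcal{C}$ has product $f\otimes g\colon X_0\otimes Y_0\to X_1\otimes Y_1$ for $f\colon X_0\to X_1$, $g\colon Y_0\to Y_1$, and unit $1_S$. *)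

theory Defs
  imports "HOL-Library.Infinite_Typeclass"
begin

section \<open>Categories and functors\<close>

text \<open>
  Equations between morphisms and the category axioms are always relativised to the carriers
  \<open>Obj\<close> and \<open>Mor\<close>; the values of the (total) operations outside of them are irrelevant.
  Composition is written in the usual order: \<open>g \<cdot>\<^bsub>C\<^esub> f\<close> is \<open>g\<close> after \<open>f\<close>.
\<close>

record ('o, 'a) category =
  Obj :: "'o set"
  Mor :: "'a set"
  Dom :: "'a \<Rightarrow> 'o"
  Cod :: "'a \<Rightarrow> 'o"
  Ident :: "'o \<Rightarrow> 'a"
  Comp :: "'a \<Rightarrow> 'a \<Rightarrow> 'a" (infixr "\<cdot>\<index>" 65)

definition Hom :: "('o, 'a) category \<Rightarrow> 'o \<Rightarrow> 'o \<Rightarrow> 'a set" where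
  "Hom C X Y = {f \<in> Mor C. Dom C f = X \<and> Cod C f = Y}"

locale category =
  fixes C :: "('o, 'a) category"
  assumes Dom_Obj: "f \<in> Mor C \<Longrightarrow> Dom C f \<in> Obj C"
    and Cod_Obj: "f \<in> Mor C \<Longrightarrow> Cod C f \<in> Obj C"
    and Ident_Hom: "X \<in> Obj C \<Longrightarrow> Ident C X \<in> Hom C X X"
    and Comp_Hom: "\<lbrakk>f \<in> Hom C X Y; g \<in> Hom C Y Z\<rbrakk> \<Longrightarrow> g \<cdot>\<^bsub>C\<^esub> f \<in> Hom C X Z"
    and Comp_Ident: "f \<in> Hom C X Y \<Longrightarrow> f \<cdot>\<^bsub>C\<^esub> Ident C X = f"
    and Ident_Comp: "f \<in> Hom C X Y \<Longrightarrow> Ident C Y \<cdot>\<^bsub>C\<^esub> f = f"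
    and Comp_assoc: "\<lbrakk>f \<in> Hom C W X; g \<in> Hom C X Y; h \<in> Hom C Y Z\<rbrakk>
      \<Longrightarrow> (h \<cdot>\<^bsub>C\<^esub> g) \<cdot>\<^bsub>C\<^esub> f = h \<cdot>\<^bsub>C\<^esub> (g \<cdot>\<^bsub>C\<^esub> f)"

definition opp :: "('o, 'a) category \<Rightarrow> ('o, 'a) category" where
  "opp C = \<lparr>Obj = Obj C, Mor = Mor C, Dom = Cod C, Cod = Dom C, Ident = Ident C,
            Comp = (\<lambda>g f. f \<cdot>\<^bsub>C\<^esub> g)\<rparr>"

definition prod_cat ::
  "('o, 'a) category \<Rightarrow> ('p, 'b) category \<Rightarrow> ('o \<times> 'p, 'a \<times> 'b) category" where
  "prod_cat C D =
    \<lparr>Obj = Obj C \<times> Obj D, Mor = Mor C \<times> Mor D,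
     Dom = (\<lambda>(f, g). (Dom C f, Dom D g)), Cod = (\<lambda>(f, g). (Cod C f, Cod D g)),
     Ident = (\<lambda>(X, Y). (Ident C X, Ident D Y)),
     Comp = (\<lambda>(f', g') (f, g). (f' \<cdot>\<^bsub>C\<^esub> f, g' \<cdot>\<^bsub>D\<^esub> g))\<rparr>"

definition iso :: "('o, 'a) category \<Rightarrow> 'a \<Rightarrow> bool" where
  "iso C f \<longleftrightarrow> f \<in> Mor C \<and>
    (\<exists>g \<in> Hom C (Cod C f) (Dom C f).
      g \<cdot>\<^bsub>C\<^esub> f = Ident C (Dom C f) \<and> f \<cdot>\<^bsub>C\<^esub> g = Ident C (Cod C f))"

record ('o, 'a, 'p, 'b) cfunctor =
  FObj :: "'o \<Rightarrow> 'p"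
  FMor :: "'a \<Rightarrow> 'b"

locale is_functor = C: category C + D: category D
  for C :: "('o, 'a) category" and D :: "('p, 'b) category" +
  fixes F :: "('o, 'a, 'p, 'b) cfunctor"
  assumes FObj_Obj: "X \<in> Obj C \<Longrightarrow> FObj F X \<in> Obj D"
    and FMor_Hom: "f \<in> Hom C X Y \<Longrightarrow> FMor F f \<in> Hom D (FObj F X) (FObj F Y)"
    and FMor_Ident: "X \<in> Obj C \<Longrightarrow> FMor F (Ident C X) = Ident D (FObj F X)"
    and FMor_Comp: "\<lbrakk>f \<in> Hom C X Y; g \<in> Hom C Y Z\<rbrakk>
      \<Longrightarrow> FMor F (g \<cdot>\<^bsub>C\<^esub> f) = FMor F g \<cdot>\<^bsub>D\<^esub> FMor F f"

definition left_adjoint ::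
  "('o, 'a) category \<Rightarrow> ('p, 'b) category \<Rightarrow> ('o, 'a, 'p, 'b) cfunctor \<Rightarrow> bool" where
  "left_adjoint C D F \<longleftrightarrow> is_functor C D F \<and>
    (\<exists>(G :: ('p, 'b, 'o, 'a) cfunctor) (\<phi> :: 'o \<Rightarrow> 'p \<Rightarrow> 'b \<Rightarrow> 'a). is_functor D C G \<and>
      (\<forall>X \<in> Obj C. \<forall>Y \<in> Obj D. bij_betw (\<phi> X Y) (Hom D (FObj F X) Y) (Hom C X (FObj G Y))) \<and>
      (\<forall>X' X Y Y' a b f.
        a \<in> Hom C X' X \<and> b \<in> Hom D Y Y' \<and> f \<in> Hom D (FObj F X) Y \<longrightarrow>
        \<phi> X' Y' (b \<cdot>\<^bsub>D\<^esub> f \<cdot>\<^bsub>D\<^esub> FMor F a) = FMor G b \<cdot>\<^bsub>C\<^esub> \<phi> X Y f \<cdot>\<^bsub>C\<^esub> a))"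


section \<open>Limits and colimits\<close>

definition is_cone :: "('i, 'm) category \<Rightarrow> ('o, 'a) category \<Rightarrow>
    ('i, 'm, 'o, 'a) cfunctor \<Rightarrow> 'o \<Rightarrow> ('i \<Rightarrow> 'a) \<Rightarrow> bool" where
  "is_cone J C F L p \<longleftrightarrow> L \<in> Obj C \<and>
    (\<forall>j \<in> Obj J. p j \<in> Hom C L (FObj F j)) \<and>
    (\<forall>m \<in> Mor J. FMor F m \<cdot>\<^bsub>C\<^esub> p (Dom J m) = p (Cod J m))"

definition is_limit :: "('i, 'm) category \<Rightarrow> ('o, 'a) category \<Rightarrow>
    ('i, 'm, 'o, 'a) cfunctor \<Rightarrow> 'o \<Rightarrow> ('i \<Rightarrow> 'a) \<Rightarrow> bool" where
  "is_limit J C F L p \<longleftrightarrow> is_cone J C F L p \<and>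
    (\<forall>L' p'. is_cone J C F L' p' \<longrightarrow>
      (\<exists>!h. h \<in> Hom C L' L \<and> (\<forall>j \<in> Obj J. p j \<cdot>\<^bsub>C\<^esub> h = p' j)))"

definition is_colimit :: "('i, 'm) category \<Rightarrow> ('o, 'a) category \<Rightarrow>
    ('i, 'm, 'o, 'a) cfunctor \<Rightarrow> 'o \<Rightarrow> ('i \<Rightarrow> 'a) \<Rightarrow> bool" where
  "is_colimit J C F L i \<longleftrightarrow> is_limit (opp J) (opp C) F L i"

text \<open>
  HOL has no type of all sets, so smallness is relative to an arbitrary infinite type \<open>'u\<close>
  playing the role of the universe: a small category is one whose objects and morphisms are
  elements of \<open>'u\<close> (up to isomorphism: one with at most as many morphisms as \<open>'u\<close> has elements).
  Results are stated for every such \<open>'u\<close>.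
\<close>

definition bicomplete :: "'u::infinite itself \<Rightarrow> ('o, 'a) category \<Rightarrow> bool" where
  "bicomplete U C \<longleftrightarrow> category C \<and>
    (\<forall>(J :: ('u, 'u) category) F. is_functor J C F \<longrightarrow>
      (\<exists>L p. is_limit J C F L p) \<and> (\<exists>L i. is_colimit J C F L i))"

definition initial :: "('o, 'a) category \<Rightarrow> 'o \<Rightarrow> bool" where
  "initial C Z \<longleftrightarrow> Z \<in> Obj C \<and> (\<forall>X \<in> Obj C. \<exists>!f. f \<in> Hom C Z X)"

definition is_pullback ::
  "('o, 'a) category \<Rightarrow> 'a \<Rightarrow> 'a \<Rightarrow> 'o \<Rightarrow> 'a \<Rightarrow> 'a \<Rightarrow> bool" where
  "is_pullback C f g P p q \<longleftrightarrow>
    f \<in> Mor C \<and> g \<in> Mor C \<and> Cod C f = Cod C g \<and>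
    p \<in> Hom C P (Dom C f) \<and> q \<in> Hom C P (Dom C g) \<and> f \<cdot>\<^bsub>C\<^esub> p = g \<cdot>\<^bsub>C\<^esub> q \<and>
    (\<forall>W a b. a \<in> Hom C W (Dom C f) \<and> b \<in> Hom C W (Dom C g) \<and> f \<cdot>\<^bsub>C\<^esub> a = g \<cdot>\<^bsub>C\<^esub> b \<longrightarrow>
      (\<exists>!h. h \<in> Hom C W P \<and> p \<cdot>\<^bsub>C\<^esub> h = a \<and> q \<cdot>\<^bsub>C\<^esub> h = b))"

definition is_pushout ::
  "('o, 'a) category \<Rightarrow> 'a \<Rightarrow> 'a \<Rightarrow> 'o \<Rightarrow> 'a \<Rightarrow> 'a \<Rightarrow> bool" where
  "is_pushout C f g P i j \<longleftrightarrow> is_pullback (opp C) f g P i j"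


section \<open>The arrow category\<close>

text \<open>
  The square \<open>(f, g, u, v)\<close> is the morphism from \<open>f\<close> to \<open>g\<close> with components \<open>u\<close> on domains and
  \<open>v\<close> on codomains.
\<close>

type_synonym 'a square = "'a \<times> 'a \<times> 'a \<times> 'a"

definition Arr :: "('o, 'a) category \<Rightarrow> ('a, 'a square) category" where
  "Arr C =
    \<lparr>Obj = Mor C,
     Mor = {(f, g, u, v). f \<in> Mor C \<and> g \<in> Mor C \<and>
       u \<in> Hom C (Dom C f) (Dom C g) \<and> v \<in> Hom C (Cod C f) (Cod C g) \<and>
       v \<cdot>\<^bsub>C\<^esub> f = g \<cdot>\<^bsub>C\<^esub> u},
     Dom = (\<lambda>(f, g, u, v). f),
     Cod = (\<lambda>(f, g, u, v). g),
     Ident = (\<lambda>f. (f, f, Ident C (Dom C f), Ident C (Cod C f))),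
     Comp = (\<lambda>(g', h, u', v') (f, g, u, v). (f, h, u' \<cdot>\<^bsub>C\<^esub> u, v' \<cdot>\<^bsub>C\<^esub> v))\<rparr>"

definition Ev0 :: "('o, 'a) category \<Rightarrow> ('a, 'a square, 'o, 'a) cfunctor" where
  "Ev0 C = \<lparr>FObj = Dom C, FMor = (\<lambda>(f, g, u, v). u)\<rparr>"

definition Ev1 :: "('o, 'a) category \<Rightarrow> ('a, 'a square, 'o, 'a) cfunctor" where
  "Ev1 C = \<lparr>FObj = Cod C, FMor = (\<lambda>(f, g, u, v). v)\<rparr>"

definition L0 :: "('o, 'a) category \<Rightarrow> ('o, 'a, 'a, 'a square) cfunctor" where
  "L0 C = \<lparr>FObj = Ident C, FMor = (\<lambda>u. (Ident C (Dom C u), Ident C (Cod C u), u, u))\<rparr>"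

definition from_initial :: "('o, 'a) category \<Rightarrow> 'o \<Rightarrow> 'o \<Rightarrow> 'a" where
  "from_initial C Z X = (THE f. f \<in> Hom C Z X)"

text \<open>The functor \<open>L1\<close> depends on the choice of an initial object \<open>Z\<close>.\<close>

definition L1 :: "('o, 'a) category \<Rightarrow> 'o \<Rightarrow> ('o, 'a, 'a, 'a square) cfunctor" where
  "L1 C Z = \<lparr>FObj = from_initial C Z,
    FMor = (\<lambda>u. (from_initial C Z (Dom C u), from_initial C Z (Cod C u), Ident C Z, u))\<rparr>"


section \<open>Model categories\<close>

text \<open>A subcategory is represented by its set of morphisms.\<close>

definition subcategory :: "('o, 'a) category \<Rightarrow> 'a set \<Rightarrow> bool" where
  "subcategory C S \<longleftrightarrow> S \<subseteq> Mor C \<and>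
    (\<forall>f \<in> S. Ident C (Dom C f) \<in> S \<and> Ident C (Cod C f) \<in> S) \<and>
    (\<forall>f \<in> S. \<forall>g \<in> S. Cod C f = Dom C g \<longrightarrow> g \<cdot>\<^bsub>C\<^esub> f \<in> S)"

definition is_retract :: "('o, 'a) category \<Rightarrow> 'a \<Rightarrow> 'a \<Rightarrow> bool" where
  "is_retract C f g \<longleftrightarrow> f \<in> Mor C \<and> g \<in> Mor C \<and>
    (\<exists>\<sigma> \<in> Hom (Arr C) f g. \<exists>\<tau> \<in> Hom (Arr C) g f. \<tau> \<cdot>\<^bsub>Arr C\<^esub> \<sigma> = Ident (Arr C) f)"

definition has_lifting :: "('o, 'a) category \<Rightarrow> 'a \<Rightarrow> 'a \<Rightarrow> bool" where
  "has_lifting C i p \<longleftrightarrow>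
    (\<forall>u v. (i, p, u, v) \<in> Mor (Arr C) \<longrightarrow>
      (\<exists>h \<in> Hom C (Cod C i) (Dom C p). h \<cdot>\<^bsub>C\<^esub> i = u \<and> p \<cdot>\<^bsub>C\<^esub> h = v))"

text \<open>
  Hovey's functorial factorizations, with the condition from the errata to his book: the domain
  of \<open>\<alpha>\<close>, the codomain of \<open>\<beta>\<close> and the common middle object are matched not only on objects but as
  functors, that is, \<open>Ev0 \<circ> \<alpha> = Ev0\<close>, \<open>Ev1 \<circ> \<beta> = Ev1\<close> and \<open>Ev1 \<circ> \<alpha> = Ev0 \<circ> \<beta>\<close>.
\<close>

definition functorial_factorization :: "('o, 'a) category \<Rightarrow>
    ('a, 'a square, 'a, 'a square) cfunctor \<Rightarrow> ('a, 'a square, 'a, 'a square) cfunctor \<Rightarrow> bool" where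
  "functorial_factorization C \<alpha> \<beta> \<longleftrightarrow>
    is_functor (Arr C) (Arr C) \<alpha> \<and> is_functor (Arr C) (Arr C) \<beta> \<and>
    (\<forall>f \<in> Mor C. Dom C (FObj \<alpha> f) = Dom C f \<and> Cod C (FObj \<beta> f) = Cod C f \<and>
      Cod C (FObj \<alpha> f) = Dom C (FObj \<beta> f) \<and> f = FObj \<beta> f \<cdot>\<^bsub>C\<^esub> FObj \<alpha> f) \<and>
    (\<forall>\<sigma> \<in> Mor (Arr C).
      FMor (Ev0 C) (FMor \<alpha> \<sigma>) = FMor (Ev0 C) \<sigma> \<and>
      FMor (Ev1 C) (FMor \<beta> \<sigma>) = FMor (Ev1 C) \<sigma> \<and>
      FMor (Ev1 C) (FMor \<alpha> \<sigma>) = FMor (Ev0 C) (FMor \<beta> \<sigma>))"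

text \<open>The factorizations are part of the structure.\<close>

record 'a model_structure =
  weq :: "'a set"
  cof :: "'a set"
  fib :: "'a set"
  fact_cof :: "('a, 'a square, 'a, 'a square) cfunctor"
  fact_tfib :: "('a, 'a square, 'a, 'a square) cfunctor"
  fact_tcof :: "('a, 'a square, 'a, 'a square) cfunctor"
  fact_fib :: "('a, 'a square, 'a, 'a square) cfunctor"

definition tcof :: "'a model_structure \<Rightarrow> 'a set" where
  "tcof M = cof M \<inter> weq M"

definition tfib :: "'a model_structure \<Rightarrow> 'a set" where
  "tfib M = fib M \<inter> weq M"

locale model_structure = category C
  for C :: "('o, 'a) category" +
  fixes M :: "'a model_structure"
  assumes weq_subcategory: "subcategory C (weq M)"
    and cof_subcategory: "subcategory C (cof M)"
    and fib_subcategory: "subcategory C (fib M)"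
    and factorization_cof_tfib: "functorial_factorization C (fact_cof M) (fact_tfib M)"
    and factorization_tcof_fib: "functorial_factorization C (fact_tcof M) (fact_fib M)"
    and two_out_of_three:
      "\<lbrakk>f \<in> Hom C X Y; g \<in> Hom C Y Z; f \<in> weq M; g \<in> weq M\<rbrakk> \<Longrightarrow> g \<cdot>\<^bsub>C\<^esub> f \<in> weq M"
      "\<lbrakk>f \<in> Hom C X Y; g \<in> Hom C Y Z; f \<in> weq M; g \<cdot>\<^bsub>C\<^esub> f \<in> weq M\<rbrakk> \<Longrightarrow> g \<in> weq M"
      "\<lbrakk>f \<in> Hom C X Y; g \<in> Hom C Y Z; g \<in> weq M; g \<cdot>\<^bsub>C\<^esub> f \<in> weq M\<rbrakk> \<Longrightarrow> f \<in> weq M"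
    and retract_weq: "\<lbrakk>is_retract C f g; g \<in> weq M\<rbrakk> \<Longrightarrow> f \<in> weq M"
    and retract_cof: "\<lbrakk>is_retract C f g; g \<in> cof M\<rbrakk> \<Longrightarrow> f \<in> cof M"
    and retract_fib: "\<lbrakk>is_retract C f g; g \<in> fib M\<rbrakk> \<Longrightarrow> f \<in> fib M"
    and lifting_tcof_fib: "\<lbrakk>i \<in> tcof M; p \<in> fib M\<rbrakk> \<Longrightarrow> has_lifting C i p"
    and lifting_cof_tfib: "\<lbrakk>i \<in> cof M; p \<in> tfib M\<rbrakk> \<Longrightarrow> has_lifting C i p"
    and fact_cof: "f \<in> Mor C \<Longrightarrow> FObj (fact_cof M) f \<in> cof M"
    and fact_tfib: "f \<in> Mor C \<Longrightarrow> FObj (fact_tfib M) f \<in> tfib M"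
    and fact_tcof: "f \<in> Mor C \<Longrightarrow> FObj (fact_tcof M) f \<in> tcof M"
    and fact_fib: "f \<in> Mor C \<Longrightarrow> FObj (fact_fib M) f \<in> fib M"

definition model_category ::
  "'u::infinite itself \<Rightarrow> ('o, 'a) category \<Rightarrow> 'a model_structure \<Rightarrow> bool" where
  "model_category U C M \<longleftrightarrow> bicomplete U C \<and> model_structure C M"

definition left_Quillen :: "('o, 'a) category \<Rightarrow> 'a model_structure \<Rightarrow>
    ('p, 'b) category \<Rightarrow> 'b model_structure \<Rightarrow> ('o, 'a, 'p, 'b) cfunctor \<Rightarrow> bool" where
  "left_Quillen C M D N F \<longleftrightarrow> left_adjoint C D F \<and>
    (\<forall>f \<in> cof M. FMor F f \<in> cof N) \<and> (\<forall>f \<in> tcof M. FMor F f \<in> tcof N)"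

definition cofibrant :: "('o, 'a) category \<Rightarrow> 'a model_structure \<Rightarrow> 'o \<Rightarrow> bool" where
  "cofibrant C M X \<longleftrightarrow> X \<in> Obj C \<and> (\<exists>Z f. initial C Z \<and> f \<in> Hom C Z X \<and> f \<in> cof M)"

text \<open>
  As in Hovey's book, \<open>q : Q \<rightarrow> X\<close> comes from factoring \<open>0 \<rightarrow> X\<close> into a cofibration followed by a
  trivial fibration.
\<close>

definition cofibrant_replacement ::
  "('o, 'a) category \<Rightarrow> 'a model_structure \<Rightarrow> 'o \<Rightarrow> 'o \<Rightarrow> 'a \<Rightarrow> bool" where
  "cofibrant_replacement C M X Q q \<longleftrightarrow> cofibrant C M Q \<and> q \<in> Hom C Q X \<and> q \<in> tfib M"


section \<open>Symmetric monoidal model categories\<close>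

record ('o, 'a) monoidal =
  tensor :: "('o \<times> 'o, 'a \<times> 'a, 'o, 'a) cfunctor"
  tunit :: 'o
  assoc :: "'o \<Rightarrow> 'o \<Rightarrow> 'o \<Rightarrow> 'a"
  lunit :: "'o \<Rightarrow> 'a"
  runit :: "'o \<Rightarrow> 'a"
  braid :: "'o \<Rightarrow> 'o \<Rightarrow> 'a"

abbreviation tensor_obj :: "('o, 'a) monoidal \<Rightarrow> 'o \<Rightarrow> 'o \<Rightarrow> 'o" (infixr "\<odot>\<index>" 70) where
  "X \<odot>\<^bsub>T\<^esub> Y \<equiv> FObj (tensor T) (X, Y)"

abbreviation tensor_mor :: "('o, 'a) monoidal \<Rightarrow> 'a \<Rightarrow> 'a \<Rightarrow> 'a" (infixr "\<otimes>\<index>" 70) where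
  "f \<otimes>\<^bsub>T\<^esub> g \<equiv> FMor (tensor T) (f, g)"

locale symmetric_monoidal =
  C: category C + tensor: is_functor "prod_cat C C" C "tensor T"
  for C :: "('o, 'a) category" and T :: "('o, 'a) monoidal" +
  assumes tunit_Obj: "tunit T \<in> Obj C"
    and assoc_Hom: "\<lbrakk>X \<in> Obj C; Y \<in> Obj C; Z \<in> Obj C\<rbrakk>
      \<Longrightarrow> assoc T X Y Z \<in> Hom C ((X \<odot>\<^bsub>T\<^esub> Y) \<odot>\<^bsub>T\<^esub> Z) (X \<odot>\<^bsub>T\<^esub> (Y \<odot>\<^bsub>T\<^esub> Z))"
    and assoc_iso: "\<lbrakk>X \<in> Obj C; Y \<in> Obj C; Z \<in> Obj C\<rbrakk> \<Longrightarrow> iso C (assoc T X Y Z)"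
    and assoc_natural: "\<lbrakk>f \<in> Hom C X X'; g \<in> Hom C Y Y'; h \<in> Hom C Z Z'\<rbrakk>
      \<Longrightarrow> assoc T X' Y' Z' \<cdot>\<^bsub>C\<^esub> ((f \<otimes>\<^bsub>T\<^esub> g) \<otimes>\<^bsub>T\<^esub> h) = (f \<otimes>\<^bsub>T\<^esub> (g \<otimes>\<^bsub>T\<^esub> h)) \<cdot>\<^bsub>C\<^esub> assoc T X Y Z"
    and lunit_Hom: "X \<in> Obj C \<Longrightarrow> lunit T X \<in> Hom C (tunit T \<odot>\<^bsub>T\<^esub> X) X"
    and lunit_iso: "X \<in> Obj C \<Longrightarrow> iso C (lunit T X)"
    and lunit_natural: "f \<in> Hom C X Y
      \<Longrightarrow> lunit T Y \<cdot>\<^bsub>C\<^esub> (Ident C (tunit T) \<otimes>\<^bsub>T\<^esub> f) = f \<cdot>\<^bsub>C\<^esub> lunit T X"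
    and runit_Hom: "X \<in> Obj C \<Longrightarrow> runit T X \<in> Hom C (X \<odot>\<^bsub>T\<^esub> tunit T) X"
    and runit_iso: "X \<in> Obj C \<Longrightarrow> iso C (runit T X)"
    and runit_natural: "f \<in> Hom C X Y
      \<Longrightarrow> runit T Y \<cdot>\<^bsub>C\<^esub> (f \<otimes>\<^bsub>T\<^esub> Ident C (tunit T)) = f \<cdot>\<^bsub>C\<^esub> runit T X"
    and pentagon: "\<lbrakk>W \<in> Obj C; X \<in> Obj C; Y \<in> Obj C; Z \<in> Obj C\<rbrakk>
      \<Longrightarrow> assoc T W X (Y \<odot>\<^bsub>T\<^esub> Z) \<cdot>\<^bsub>C\<^esub> assoc T (W \<odot>\<^bsub>T\<^esub> X) Y Z
        = (Ident C W \<otimes>\<^bsub>T\<^esub> assoc T X Y Z) \<cdot>\<^bsub>C\<^esub> assoc T W (X \<odot>\<^bsub>T\<^esub> Y) Z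
            \<cdot>\<^bsub>C\<^esub> (assoc T W X Y \<otimes>\<^bsub>T\<^esub> Ident C Z)"
    and triangle: "\<lbrakk>X \<in> Obj C; Y \<in> Obj C\<rbrakk>
      \<Longrightarrow> (Ident C X \<otimes>\<^bsub>T\<^esub> lunit T Y) \<cdot>\<^bsub>C\<^esub> assoc T X (tunit T) Y = runit T X \<otimes>\<^bsub>T\<^esub> Ident C Y"
    and lunit_runit: "lunit T (tunit T) = runit T (tunit T)"
    and braid_Hom: "\<lbrakk>X \<in> Obj C; Y \<in> Obj C\<rbrakk> \<Longrightarrow> braid T X Y \<in> Hom C (X \<odot>\<^bsub>T\<^esub> Y) (Y \<odot>\<^bsub>T\<^esub> X)"
    and braid_natural: "\<lbrakk>f \<in> Hom C X X'; g \<in> Hom C Y Y'\<rbrakk>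
      \<Longrightarrow> braid T X' Y' \<cdot>\<^bsub>C\<^esub> (f \<otimes>\<^bsub>T\<^esub> g) = (g \<otimes>\<^bsub>T\<^esub> f) \<cdot>\<^bsub>C\<^esub> braid T X Y"
    and braid_symmetric: "\<lbrakk>X \<in> Obj C; Y \<in> Obj C\<rbrakk>
      \<Longrightarrow> braid T Y X \<cdot>\<^bsub>C\<^esub> braid T X Y = Ident C (X \<odot>\<^bsub>T\<^esub> Y)"
    and braid_unit: "X \<in> Obj C \<Longrightarrow> lunit T X \<cdot>\<^bsub>C\<^esub> braid T X (tunit T) = runit T X"
    and hexagon: "\<lbrakk>X \<in> Obj C; Y \<in> Obj C; Z \<in> Obj C\<rbrakk>
      \<Longrightarrow> assoc T Y Z X \<cdot>\<^bsub>C\<^esub> braid T X (Y \<odot>\<^bsub>T\<^esub> Z) \<cdot>\<^bsub>C\<^esub> assoc T X Y Z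
        = (Ident C Y \<otimes>\<^bsub>T\<^esub> braid T X Z) \<cdot>\<^bsub>C\<^esub> assoc T Y X Z \<cdot>\<^bsub>C\<^esub> (braid T X Y \<otimes>\<^bsub>T\<^esub> Ident C Z)"

text \<open>
  Closedness: an internal hom bifunctor \<open>H\<close>, contravariant in its first argument, with bijections
  \<open>Hom (X \<otimes> Y, Z) \<cong> Hom (X, H (Y, Z))\<close> natural in all three variables.
\<close>

definition closed_symmetric_monoidal ::
  "('o, 'a) category \<Rightarrow> ('o, 'a) monoidal \<Rightarrow> bool" where
  "closed_symmetric_monoidal C T \<longleftrightarrow> symmetric_monoidal C T \<and>
    (\<exists>(H :: ('o \<times> 'o, 'a \<times> 'a, 'o, 'a) cfunctor) (\<phi> :: 'o \<Rightarrow> 'o \<Rightarrow> 'o \<Rightarrow> 'a \<Rightarrow> 'a).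
      is_functor (prod_cat (opp C) C) C H \<and>
      (\<forall>X \<in> Obj C. \<forall>Y \<in> Obj C. \<forall>Z \<in> Obj C.
        bij_betw (\<phi> X Y Z) (Hom C (X \<odot>\<^bsub>T\<^esub> Y) Z) (Hom C X (FObj H (Y, Z)))) \<and>
      (\<forall>X' X Y' Y Z Z' a b c f.
        a \<in> Hom C X' X \<and> b \<in> Hom C Y' Y \<and> c \<in> Hom C Z Z' \<and> f \<in> Hom C (X \<odot>\<^bsub>T\<^esub> Y) Z \<longrightarrow>
        \<phi> X' Y' Z' (c \<cdot>\<^bsub>C\<^esub> f \<cdot>\<^bsub>C\<^esub> (a \<otimes>\<^bsub>T\<^esub> b)) = FMor H (b, c) \<cdot>\<^bsub>C\<^esub> \<phi> X Y Z f \<cdot>\<^bsub>C\<^esub> a))"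

text \<open>
  For \<open>f : U \<rightarrow> V\<close> and \<open>g : W \<rightarrow> X\<close>, the map \<open>h\<close> is a pushout product \<open>f \<box> g\<close>, that is, the
  induced map from a pushout of \<open>V \<otimes> W \<leftarrow> U \<otimes> W \<rightarrow> U \<otimes> X\<close> to \<open>V \<otimes> X\<close>.
\<close>

definition is_pushout_product ::
  "('o, 'a) category \<Rightarrow> ('o, 'a) monoidal \<Rightarrow> 'a \<Rightarrow> 'a \<Rightarrow> 'a \<Rightarrow> bool" where
  "is_pushout_product C T f g h \<longleftrightarrow>
    (\<exists>P i j. is_pushout C (f \<otimes>\<^bsub>T\<^esub> Ident C (Dom C g)) (Ident C (Dom C f) \<otimes>\<^bsub>T\<^esub> g) P i j \<and>
      h \<in> Hom C P (Cod C f \<odot>\<^bsub>T\<^esub> Cod C g) \<and>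
      h \<cdot>\<^bsub>C\<^esub> i = Ident C (Cod C f) \<otimes>\<^bsub>T\<^esub> g \<and>
      h \<cdot>\<^bsub>C\<^esub> j = f \<otimes>\<^bsub>T\<^esub> Ident C (Cod C g))"

definition pushout_product_axiom ::
  "('o, 'a) category \<Rightarrow> 'a model_structure \<Rightarrow> ('o, 'a) monoidal \<Rightarrow> bool" where
  "pushout_product_axiom C M T \<longleftrightarrow>
    (\<forall>f \<in> cof M. \<forall>g \<in> cof M. \<forall>h. is_pushout_product C T f g h \<longrightarrow>
      h \<in> cof M \<and> (f \<in> weq M \<or> g \<in> weq M \<longrightarrow> h \<in> weq M))"

definition unit_axiom ::
  "('o, 'a) category \<Rightarrow> 'a model_structure \<Rightarrow> ('o, 'a) monoidal \<Rightarrow> bool" where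
  "unit_axiom C M T \<longleftrightarrow>
    (\<forall>Q q A. cofibrant_replacement C M (tunit T) Q q \<and> cofibrant C M A \<longrightarrow>
      lunit T A \<cdot>\<^bsub>C\<^esub> (q \<otimes>\<^bsub>T\<^esub> Ident C A) \<in> weq M)"

definition symmetric_monoidal_model_category :: "'u::infinite itself \<Rightarrow>
    ('o, 'a) category \<Rightarrow> 'a model_structure \<Rightarrow> ('o, 'a) monoidal \<Rightarrow> bool" where
  "symmetric_monoidal_model_category U C M T \<longleftrightarrow>
    model_category U C M \<and> closed_symmetric_monoidal C T \<and>
    pushout_product_axiom C M T \<and> unit_axiom C M T"

text \<open>
  The tensor product monoidal structure on the arrow category; the structure isomorphisms are
  those of \<open>C\<close> at the domains and at the codomains.
\<close>

definition Arr_tensor ::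
  "('o, 'a) category \<Rightarrow> ('o, 'a) monoidal \<Rightarrow> ('a, 'a square) monoidal" where
  "Arr_tensor C T =
    \<lparr>tensor =
       \<lparr>FObj = (\<lambda>(f, g). f \<otimes>\<^bsub>T\<^esub> g),
        FMor = (\<lambda>((f, g, u, v), (f', g', u', v')).
          (f \<otimes>\<^bsub>T\<^esub> f', g \<otimes>\<^bsub>T\<^esub> g', u \<otimes>\<^bsub>T\<^esub> u', v \<otimes>\<^bsub>T\<^esub> v'))\<rparr>,
     tunit = Ident C (tunit T),
     assoc = (\<lambda>f g h. ((f \<otimes>\<^bsub>T\<^esub> g) \<otimes>\<^bsub>T\<^esub> h, f \<otimes>\<^bsub>T\<^esub> (g \<otimes>\<^bsub>T\<^esub> h),
       assoc T (Dom C f) (Dom C g) (Dom C h), assoc T (Cod C f) (Cod C g) (Cod C h))),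
     lunit = (\<lambda>f. (Ident C (tunit T) \<otimes>\<^bsub>T\<^esub> f, f, lunit T (Dom C f), lunit T (Cod C f))),
     runit = (\<lambda>f. (f \<otimes>\<^bsub>T\<^esub> Ident C (tunit T), f, runit T (Dom C f), runit T (Cod C f))),
     braid = (\<lambda>f g. (f \<otimes>\<^bsub>T\<^esub> g, g \<otimes>\<^bsub>T\<^esub> f,
       braid T (Dom C f) (Dom C g), braid T (Cod C f) (Cod C g)))\<rparr>"

end

theory Submission
  imports Defs
begin

text \<open>
  The main point is a description of the fibrations that is independent of chosen pullbacks: a
  fibration in \<open>Arr C\<close> is a square with the right lifting property against all squares whose two
  components are trivial cofibrations.

  A lifting problem between squares is solved in two stages. First one lifts on codomains; the lifts on
  domains that are compatible with this choice are then exactly the solutions of a lifting problem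
  against the corner map, the map from \<open>Ev0 f\<close> to the pullback \<open>Ev1 f \<times>\<^bsub>Ev1 g\<^esub> Ev0 g\<close>
  (\<open>has_lifting_square\<close>). Conversely, lifts against the codomain component and against the corner map
  are found by lifting against the test squares \<open>L1 i\<close> and \<open>i \<rightarrow> 1\<close> (\<open>has_lifting_codomain\<close>,
  \<open>has_lifting_corner\<close>). So a square lifts against a pointwise class if and only if its codomain
  component and its corner map lift against the class (\<open>RLP_pointwise_iff\<close>). By the retract argument
  the fibrations and the trivial fibrations of \<open>C\<close> are themselves lifting classes, and this
  equivalence is the characterization of the (trivial) fibrations of \<open>Arr C\<close>. Here the domain
  component is the corner map followed by a pullback of the codomain component; this is why fibrations
  are pointwise fibrations, and why the fibrations that are weak equivalences are the squares lifting
  against all cofibrations (\<open>fibration_weq_iff\<close>).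

  Factorizations have the same shape: factor the codomain component, form the pullback of its second
  factor, and factor the resulting corner map. All steps are functors on \<open>Arr (Arr C)\<close>, so the result
  is functorial (\<open>ex_square_factorization\<close>). Limits and colimits are computed at domains and at
  codomains (\<open>bicomplete_Arr\<close>).

  Cofibrations and weak equivalences are pointwise, hence the Quillen conditions are immediate once the
  adjunctions \<open>L0 \<stileturn> Ev0\<close>, \<open>L1 \<stileturn> Ev1\<close>, \<open>Ev0 \<stileturn> U0\<close> and \<open>Ev1 \<stileturn> L0\<close> are known. In particular both
  evaluations preserve pushouts and initial objects. As they also preserve tensor products strictly, the
  pushout product axiom and the unit axiom for \<open>Arr C\<close> follow from those for \<open>C\<close>, applied at the
  domains and at the codomains. The internal hom of arrows is a pullback of internal homs of \<open>C\<close>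
  (\<open>Arr_exponential\<close>).
\<close>


section \<open>Calculating in categories\<close>

lemma Hom_iff: "f \<in> Hom C X Y \<longleftrightarrow> f \<in> Mor C \<and> Dom C f = X \<and> Cod C f = Y"
  by (simp add: Hom_def)

context category
begin

lemma Ident_simps [simp]:
  assumes "X \<in> Obj C"
  shows "Ident C X \<in> Mor C" "Dom C (Ident C X) = X" "Cod C (Ident C X) = X"
  using Ident_Hom[OF assms] by (simp_all add: Hom_iff)

lemma Comp_simps [simp]:
  assumes "f \<in> Mor C" "g \<in> Mor C" "Cod C f = Dom C g"
  shows "g \<cdot>\<^bsub>C\<^esub> f \<in> Mor C" "Dom C (g \<cdot>\<^bsub>C\<^esub> f) = Dom C f" "Cod C (g \<cdot>\<^bsub>C\<^esub> f) = Cod C g"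
  using Comp_Hom[of f "Dom C f" "Cod C f" g "Cod C g"] assms by (simp_all add: Hom_iff)

lemma Comp_Ident_simp [simp]: "f \<in> Mor C \<Longrightarrow> Dom C f = X \<Longrightarrow> f \<cdot>\<^bsub>C\<^esub> Ident C X = f"
  using Comp_Ident[of f X "Cod C f"] by (simp add: Hom_iff)

lemma Ident_Comp_simp [simp]: "f \<in> Mor C \<Longrightarrow> Cod C f = X \<Longrightarrow> Ident C X \<cdot>\<^bsub>C\<^esub> f = f"
  using Ident_Comp[of f "Dom C f" X] by (simp add: Hom_iff)

lemma Comp_assoc_simp [simp]:
  "\<lbrakk>f \<in> Mor C; g \<in> Mor C; h \<in> Mor C; Cod C f = Dom C g; Cod C g = Dom C h\<rbrakk>
    \<Longrightarrow> (h \<cdot>\<^bsub>C\<^esub> g) \<cdot>\<^bsub>C\<^esub> f = h \<cdot>\<^bsub>C\<^esub> g \<cdot>\<^bsub>C\<^esub> f"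
  using Comp_assoc by (simp add: Hom_iff)

declare Dom_Obj [simp] Cod_Obj [simp]

text \<open>
  Composites are normalised by bracketing to the right. A commuting diagram \<open>b \<cdot> a = e\<close> therefore
  also has to be available below a further map \<open>x\<close>.
\<close>

lemma Comp_extend:
  "\<lbrakk>b \<cdot>\<^bsub>C\<^esub> a = e; a \<in> Mor C; b \<in> Mor C; Cod C a = Dom C b; x \<in> Mor C; Cod C x = Dom C a\<rbrakk>
    \<Longrightarrow> b \<cdot>\<^bsub>C\<^esub> a \<cdot>\<^bsub>C\<^esub> x = e \<cdot>\<^bsub>C\<^esub> x"
  using Comp_assoc_simp[of x a b] by simp

end

lemma opp_simps [simp]:
  "Obj (opp C) = Obj C" "Mor (opp C) = Mor C" "Dom (opp C) = Cod C" "Cod (opp C) = Dom C"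
  "Ident (opp C) = Ident C" "g \<cdot>\<^bsub>opp C\<^esub> f = f \<cdot>\<^bsub>C\<^esub> g"
  by (simp_all add: opp_def)

lemma opp_opp [simp]: "opp (opp C) = C"
  by (simp add: opp_def)

lemma Hom_opp [simp]: "Hom (opp C) X Y = Hom C Y X"
  by (auto simp: Hom_iff)

lemma category_opp: "category C \<Longrightarrow> category (opp C)"
  by unfold_locales (auto simp: Hom_iff category.Dom_Obj category.Cod_Obj category.Ident_simps
      category.Comp_simps category.Comp_Ident_simp category.Ident_Comp_simp
      category.Comp_assoc_simp)

lemma is_functor_opp: "is_functor C D F \<Longrightarrow> is_functor (opp C) (opp D) F"
  unfolding is_functor_def is_functor_axioms_def by (simp add: category_opp) blast

lemma prod_cat_simps [simp]:
  "Obj (prod_cat C D) = Obj C \<times> Obj D" "Mor (prod_cat C D) = Mor C \<times> Mor D"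
  "Dom (prod_cat C D) (f, g) = (Dom C f, Dom D g)" "Cod (prod_cat C D) (f, g) = (Cod C f, Cod D g)"
  "Ident (prod_cat C D) (X, Y) = (Ident C X, Ident D Y)"
  "(f', g') \<cdot>\<^bsub>prod_cat C D\<^esub> (f, g) = (f' \<cdot>\<^bsub>C\<^esub> f, g' \<cdot>\<^bsub>D\<^esub> g)"
  by (simp_all add: prod_cat_def)

lemma category_prod_cat:
  assumes "category C" "category D"
  shows "category (prod_cat C D)"
proof -
  interpret C: category C by fact
  interpret D: category D by fact
  show ?thesis
    by unfold_locales (auto simp: Hom_iff)
qed

context is_functor
begin

lemma FMor_simps [simp]:
  assumes "f \<in> Mor C"
  shows "FMor F f \<in> Mor D" "Dom D (FMor F f) = FObj F (Dom C f)"
    "Cod D (FMor F f) = FObj F (Cod C f)"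
  using FMor_Hom[of f "Dom C f" "Cod C f"] assms by (simp_all add: Hom_iff)

lemma FMor_Comp_simp [simp]:
  "\<lbrakk>f \<in> Mor C; g \<in> Mor C; Cod C f = Dom C g\<rbrakk>
    \<Longrightarrow> FMor F (g \<cdot>\<^bsub>C\<^esub> f) = FMor F g \<cdot>\<^bsub>D\<^esub> FMor F f"
  using FMor_Comp by (simp add: Hom_iff)

declare FObj_Obj [simp] FMor_Ident [simp]

end

text \<open>
  The functor laws without hom-sets: all side conditions are equations, which the simplifier can solve.
\<close>

lemma is_functorI:
  assumes "category C" "category D"
    and "\<And>X. X \<in> Obj C \<Longrightarrow> FObj F X \<in> Obj D"
    and "\<And>f. f \<in> Mor C \<Longrightarrow> FMor F f \<in> Mor D \<and> Dom D (FMor F f) = FObj F (Dom C f) \<and>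
      Cod D (FMor F f) = FObj F (Cod C f)"
    and "\<And>X. X \<in> Obj C \<Longrightarrow> FMor F (Ident C X) = Ident D (FObj F X)"
    and "\<And>f g. \<lbrakk>f \<in> Mor C; g \<in> Mor C; Cod C f = Dom C g\<rbrakk>
      \<Longrightarrow> FMor F (g \<cdot>\<^bsub>C\<^esub> f) = FMor F g \<cdot>\<^bsub>D\<^esub> FMor F f"
  shows "is_functor C D F"
  using assms unfolding is_functor_def is_functor_axioms_def by (auto simp: Hom_iff)

definition comp_functor ::
  "('p, 'b, 'q, 'c) cfunctor \<Rightarrow> ('o, 'a, 'p, 'b) cfunctor \<Rightarrow> ('o, 'a, 'q, 'c) cfunctor" where
  "comp_functor G F = \<lparr>FObj = (\<lambda>X. FObj G (FObj F X)), FMor = (\<lambda>f. FMor G (FMor F f))\<rparr>"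

lemma comp_functor_simps [simp]:
  "FObj (comp_functor G F) X = FObj G (FObj F X)" "FMor (comp_functor G F) f = FMor G (FMor F f)"
  by (simp_all add: comp_functor_def)

lemma is_functor_comp_functor:
  assumes "is_functor C D F" "is_functor D E G"
  shows "is_functor C E (comp_functor G F)"
proof -
  interpret F: is_functor C D F by fact
  interpret G: is_functor D E G by fact
  show ?thesis
    by (rule is_functorI) (auto simp: F.C.category_axioms G.D.category_axioms)
qed


section \<open>The arrow category\<close>

lemma Arr_simps [simp]:
  "Obj (Arr C) = Mor C"
  "(f, g, u, v) \<in> Mor (Arr C) \<longleftrightarrow> f \<in> Mor C \<and> g \<in> Mor C \<and> u \<in> Mor C \<and> v \<in> Mor C \<and>
    Dom C u = Dom C f \<and> Cod C u = Dom C g \<and> Dom C v = Cod C f \<and> Cod C v = Cod C g \<and>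
    v \<cdot>\<^bsub>C\<^esub> f = g \<cdot>\<^bsub>C\<^esub> u"
  "Dom (Arr C) (f, g, u, v) = f" "Cod (Arr C) (f, g, u, v) = g"
  "Ident (Arr C) f = (f, f, Ident C (Dom C f), Ident C (Cod C f))"
  "(g', h, u', v') \<cdot>\<^bsub>Arr C\<^esub> (f, g, u, v) = (f, h, u' \<cdot>\<^bsub>C\<^esub> u, v' \<cdot>\<^bsub>C\<^esub> v)"
  by (auto simp: Arr_def Hom_iff)

lemma Arr_MorE:
  assumes "\<alpha> \<in> Mor (Arr C)"
  obtains f g u v where "\<alpha> = (f, g, u, v)" "f \<in> Mor C" "g \<in> Mor C" "u \<in> Mor C" "v \<in> Mor C"
    "Dom C u = Dom C f" "Cod C u = Dom C g" "Dom C v = Cod C f" "Cod C v = Cod C g"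
    "v \<cdot>\<^bsub>C\<^esub> f = g \<cdot>\<^bsub>C\<^esub> u"
  using assms by (cases \<alpha>) auto

lemma (in category) Arr_category: "category (Arr C)"
proof (unfold_locales, goal_cases)
  case (4 \<alpha> f g \<beta> h)
  then obtain u v u' v' where "\<alpha> = (f, g, u, v)" "\<beta> = (g, h, u', v')"
    by (cases \<alpha>; cases \<beta>) (auto simp: Hom_iff)
  then show ?case
    using 4 Comp_extend[of v' g "h \<cdot>\<^bsub>C\<^esub> u'" u] by (simp add: Hom_iff)
qed (auto simp: Hom_iff)

lemma Ev_simps [simp]:
  "FObj (Ev0 C) = Dom C" "FObj (Ev1 C) = Cod C"
  "FMor (Ev0 C) (f, g, u, v) = u" "FMor (Ev1 C) (f, g, u, v) = v"
  by (simp_all add: Ev0_def Ev1_def)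

context category
begin

lemma is_functor_Ev0: "is_functor (Arr C) C (Ev0 C)"
  by (rule is_functorI) (auto simp: Arr_category category_axioms)

lemma is_functor_Ev1: "is_functor (Arr C) C (Ev1 C)"
  by (rule is_functorI) (auto simp: Arr_category category_axioms)

end


section \<open>Limits and colimits\<close>

definition terminal :: "('o, 'a) category \<Rightarrow> 'o \<Rightarrow> bool" where
  "terminal C Z \<longleftrightarrow> Z \<in> Obj C \<and> (\<forall>X \<in> Obj C. \<exists>!f. f \<in> Hom C X Z)"

lemma initial_opp: "initial (opp C) Z \<longleftrightarrow> terminal C Z"
  by (simp add: initial_def terminal_def)

lemma bicomplete_category: "bicomplete U C \<Longrightarrow> category C"
  by (simp add: bicomplete_def)

lemma bicomplete_limit:
  fixes J :: "('u::infinite, 'u) category"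
  assumes "bicomplete TYPE('u) C" "is_functor J C F"
  obtains L p where "is_limit J C F L p"
  using assms unfolding bicomplete_def by blast

lemma bicomplete_colimit:
  fixes J :: "('u::infinite, 'u) category"
  assumes "bicomplete TYPE('u) C" "is_functor J C F"
  shows "\<exists>L i. is_limit (opp J) (opp C) F L i"
  using assms unfolding bicomplete_def is_colimit_def by blast

text \<open>A terminal object is a limit of the empty diagram.\<close>

lemma bicomplete_terminal:
  fixes C :: "('o, 'a) category"
  assumes "bicomplete TYPE('u::infinite) C"
  obtains Z where "terminal C Z"
proof -
  interpret C: category C
    using assms by (rule bicomplete_category)
  define J :: "('u, 'u) category" where
    "J = \<lparr>Obj = {}, Mor = {}, Dom = id, Cod = id, Ident = id, Comp = (\<lambda>g f. f)\<rparr>"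
  define F :: "('u, 'u, 'o, 'a) cfunctor" where "F = \<lparr>FObj = undefined, FMor = undefined\<rparr>"
  have [simp]: "Obj J = {}" "Mor J = {}"
    by (simp_all add: J_def)
  have "category J"
    by unfold_locales (auto simp: Hom_iff)
  then have "is_functor J C F"
    by (intro is_functorI) (auto simp: C.category_axioms)
  then obtain L p where "is_limit J C F L p"
    using bicomplete_limit[OF assms] by blast
  then have "terminal C L"
    by (simp add: is_limit_def is_cone_def terminal_def)
  then show ?thesis
    using that by blast
qed

lemma bicomplete_opp:
  assumes "bicomplete TYPE('u::infinite) C"
  shows "bicomplete TYPE('u) (opp C)"
proof -
  have "is_functor (opp J) C F" if "is_functor J (opp C) F" for J :: "('u, 'u) category" and F
    using is_functor_opp[OF that] by simp
  then show ?thesis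
    using assms category_opp unfolding bicomplete_def is_colimit_def by (metis opp_opp)
qed

lemma bicomplete_initial:
  assumes "bicomplete TYPE('u::infinite) C"
  obtains Z where "initial C Z"
proof -
  obtain Z where "terminal (opp C) Z"
    using bicomplete_terminal[OF bicomplete_opp[OF assms]] .
  then show ?thesis
    using that initial_opp[of "opp C" Z] by simp
qed

context category
begin

lemma from_initial_simps [simp]:
  assumes "initial C Z" "X \<in> Obj C"
  shows "from_initial C Z X \<in> Mor C" "Dom C (from_initial C Z X) = Z" "Cod C (from_initial C Z X) = X"
proof -
  have "from_initial C Z X \<in> Hom C Z X"
    unfolding from_initial_def using assms theI'[of "\<lambda>f. f \<in> Hom C Z X"] by (simp add: initial_def)
  then show "from_initial C Z X \<in> Mor C" "Dom C (from_initial C Z X) = Z" "Cod C (from_initial C Z X) = X"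
    by (simp_all add: Hom_iff)
qed

lemma initial_Obj: "initial C Z \<Longrightarrow> Z \<in> Obj C"
  by (simp add: initial_def)

lemma initial_eq:
  assumes "initial C Z" "f \<in> Mor C" "g \<in> Mor C" "Dom C f = Z" "Dom C g = Z" "Cod C f = Cod C g"
  shows "f = g"
  using assms Cod_Obj[of f] unfolding initial_def Hom_iff by metis

lemma terminal_eq:
  assumes "terminal C Z" "f \<in> Mor C" "g \<in> Mor C" "Cod C f = Z" "Cod C g = Z" "Dom C f = Dom C g"
  shows "f = g"
  using assms Dom_Obj[of f] unfolding terminal_def Hom_iff by metis

end

text \<open>
  A pullback is a limit over the cospan \<open>0 \<rightarrow> 2 \<leftarrow> 1\<close>. In the copy of this category inside the
  universe \<open>'u\<close>, the morphisms \<open>0\<close>, \<open>1\<close>, \<open>2\<close> are the identities, and \<open>3 : 0 \<rightarrow> 2\<close> and \<open>4 : 1 \<rightarrow> 2\<close>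
  are the legs; of two composable morphisms at least one is an identity.
\<close>

lemma bicomplete_pullback:
  fixes C :: "('o, 'a) category"
  assumes bic: "bicomplete TYPE('u::infinite) C"
    and fg: "f \<in> Mor C" "g \<in> Mor C" "Cod C f = Cod C g"
  obtains P p q where "is_pullback C f g P p q"
proof -
  interpret C: category C
    using bic by (rule bicomplete_category)
  obtain e :: "nat \<Rightarrow> 'u" where e: "inj e"
    using infinite_UNIV infinite_countable_subset by blast
  have e_eq [simp]: "e m = e n \<longleftrightarrow> m = n" for m n
    using e by (simp add: inj_eq)
  define J :: "('u, 'u) category" where
    "J = \<lparr>Obj = {e 0, e 1, e 2}, Mor = {e 0, e 1, e 2, e 3, e 4},
      Dom = (\<lambda>m. if m = e 3 then e 0 else if m = e 4 then e 1 else m),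
      Cod = (\<lambda>m. if m = e 3 \<or> m = e 4 then e 2 else m),
      Ident = (\<lambda>x. x),
      Comp = (\<lambda>n m. if m \<in> {e 0, e 1, e 2} then n else m)\<rparr>"
  define F :: "('u, 'u, 'o, 'a) cfunctor" where
    "F = \<lparr>FObj = (\<lambda>x. if x = e 0 then Dom C f else if x = e 1 then Dom C g else Cod C f),
      FMor = (\<lambda>m. if m = e 0 then Ident C (Dom C f) else if m = e 1 then Ident C (Dom C g)
        else if m = e 2 then Ident C (Cod C f) else if m = e 3 then f else g)\<rparr>"
  have "category J"
    unfolding J_def by unfold_locales (auto simp: Hom_iff split: if_splits)
  then have "is_functor J C F"
    using fg by (intro is_functorI) (auto simp: C.category_axioms J_def F_def split: if_splits)
  then obtain L p where lim: "is_limit J C F L p"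
    using bicomplete_limit[OF bic] by blast
  have cone_iff: "is_cone J C F W a \<longleftrightarrow> a (e 0) \<in> Hom C W (Dom C f) \<and>
      a (e 1) \<in> Hom C W (Dom C g) \<and> f \<cdot>\<^bsub>C\<^esub> a (e 0) = a (e 2) \<and> g \<cdot>\<^bsub>C\<^esub> a (e 1) = a (e 2)" for W a
    using fg C.Comp_simps[of "a (e 0)" f] C.Dom_Obj[of "a (e 0)"]
    unfolding is_cone_def J_def F_def Hom_iff
    by (simp del: C.Comp_simps C.Dom_Obj) (metis C.Ident_Comp_simp)
  have "is_pullback C f g L (p (e 0)) (p (e 1))"
    unfolding is_pullback_def
  proof (intro conjI allI impI)
    fix W a b
    assume ab: "a \<in> Hom C W (Dom C f) \<and> b \<in> Hom C W (Dom C g) \<and> f \<cdot>\<^bsub>C\<^esub> a = g \<cdot>\<^bsub>C\<^esub> b"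
    define c where "c x = (if x = e 0 then a else if x = e 1 then b else f \<cdot>\<^bsub>C\<^esub> a)" for x
    have "is_cone J C F W c"
      using ab by (simp add: cone_iff c_def)
    then have "\<exists>!h. h \<in> Hom C W L \<and> (\<forall>j \<in> Obj J. p j \<cdot>\<^bsub>C\<^esub> h = c j)"
      using lim by (simp add: is_limit_def)
    moreover have "(\<forall>j \<in> Obj J. p j \<cdot>\<^bsub>C\<^esub> h = c j) \<longleftrightarrow> p (e 0) \<cdot>\<^bsub>C\<^esub> h = a \<and> p (e 1) \<cdot>\<^bsub>C\<^esub> h = b"
      if "h \<in> Hom C W L" for h
    proof -
      have "p (e 2) \<cdot>\<^bsub>C\<^esub> h = f \<cdot>\<^bsub>C\<^esub> p (e 0) \<cdot>\<^bsub>C\<^esub> h"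
        using lim that fg C.Comp_assoc[of h W L "p (e 0)" "Dom C f" f "Cod C f"]
        by (auto simp: is_limit_def cone_iff Hom_iff)
      then show ?thesis
        by (auto simp: J_def c_def)
    qed
    ultimately show "\<exists>!h. h \<in> Hom C W L \<and> p (e 0) \<cdot>\<^bsub>C\<^esub> h = a \<and> p (e 1) \<cdot>\<^bsub>C\<^esub> h = b"
      by (smt (verit))
  qed (use lim fg in \<open>simp_all add: is_limit_def cone_iff\<close>)
  then show ?thesis
    using that by blast
qed

text \<open>
  Limits in the arrow category are computed at the domains and at the codomains: for limits \<open>K0\<close>
  and \<open>K1\<close> there, the composites \<open>K0 \<rightarrow> Ev0 (F j) \<rightarrow> Ev1 (F j)\<close> form a cone, which induces the arrow
  \<open>K0 \<rightarrow> K1\<close>.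
\<close>

lemma Arr_limit:
  assumes F: "is_functor J (Arr C) F" and C: "category C"
    and lim0: "is_limit J C (comp_functor (Ev0 C) F) K0 p0"
    and lim1: "is_limit J C (comp_functor (Ev1 C) F) K1 p1"
  shows "\<exists>L p. is_limit J (Arr C) F L p"
proof -
  interpret C: category C by fact
  interpret F: is_functor J "Arr C" F by fact
  interpret E0: is_functor "Arr C" C "Ev0 C" by (rule C.is_functor_Ev0)
  interpret E1: is_functor "Arr C" C "Ev1 C" by (rule C.is_functor_Ev1)
  have F_Mor [simp]: "FObj F j \<in> Mor C" if "j \<in> Obj J" for j
    using F.FObj_Obj[OF that] by simp
  have F_square: "FMor F m = (FObj F (Dom J m), FObj F (Cod J m), FMor (Ev0 C) (FMor F m),
      FMor (Ev1 C) (FMor F m))" if "m \<in> Mor J" for m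
    using F.FMor_simps[OF that] by (cases "FMor F m") auto
  have nat: "FMor (Ev1 C) (FMor F m) \<cdot>\<^bsub>C\<^esub> FObj F (Dom J m) =
      FObj F (Cod J m) \<cdot>\<^bsub>C\<^esub> FMor (Ev0 C) (FMor F m)" if "m \<in> Mor J" for m
    using F.FMor_simps(1)[OF that] by (subst (asm) F_square[OF that]) simp
  have E_simps [simp]:
    "FMor (Ev0 C) (FMor F m) \<in> Mor C" "Dom C (FMor (Ev0 C) (FMor F m)) = Dom C (FObj F (Dom J m))"
    "Cod C (FMor (Ev0 C) (FMor F m)) = Dom C (FObj F (Cod J m))"
    "FMor (Ev1 C) (FMor F m) \<in> Mor C" "Dom C (FMor (Ev1 C) (FMor F m)) = Cod C (FObj F (Dom J m))"
    "Cod C (FMor (Ev1 C) (FMor F m)) = Cod C (FObj F (Cod J m))" if "m \<in> Mor J" for m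
    using that by simp_all
  have p0: "K0 \<in> Obj C" "\<And>j. j \<in> Obj J \<Longrightarrow> p0 j \<in> Mor C \<and> Dom C (p0 j) = K0 \<and> Cod C (p0 j) = Dom C (FObj F j)"
    "\<And>m. m \<in> Mor J \<Longrightarrow> FMor (Ev0 C) (FMor F m) \<cdot>\<^bsub>C\<^esub> p0 (Dom J m) = p0 (Cod J m)"
    using lim0 by (auto simp: is_limit_def is_cone_def Hom_iff)
  have p1: "K1 \<in> Obj C" "\<And>j. j \<in> Obj J \<Longrightarrow> p1 j \<in> Mor C \<and> Dom C (p1 j) = K1 \<and> Cod C (p1 j) = Cod C (FObj F j)"
    "\<And>m. m \<in> Mor J \<Longrightarrow> FMor (Ev1 C) (FMor F m) \<cdot>\<^bsub>C\<^esub> p1 (Dom J m) = p1 (Cod J m)"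
    using lim1 by (auto simp: is_limit_def is_cone_def Hom_iff)
  have F_Comp: "FMor F m \<cdot>\<^bsub>Arr C\<^esub> (k, FObj F (Dom J m), x, y) = (k, FObj F (Cod J m),
      FMor (Ev0 C) (FMor F m) \<cdot>\<^bsub>C\<^esub> x, FMor (Ev1 C) (FMor F m) \<cdot>\<^bsub>C\<^esub> y)" if "m \<in> Mor J" for m k x y
    by (subst F_square[OF that]) simp
  have cone_iff: "is_cone J (Arr C) F k (\<lambda>j. (k, FObj F j, a0 j, a1 j)) \<longleftrightarrow>
      k \<in> Mor C \<and> is_cone J C (comp_functor (Ev0 C) F) (Dom C k) a0 \<and>
      is_cone J C (comp_functor (Ev1 C) F) (Cod C k) a1 \<and>
      (\<forall>j \<in> Obj J. a1 j \<cdot>\<^bsub>C\<^esub> k = FObj F j \<cdot>\<^bsub>C\<^esub> a0 j)" for k a0 a1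
    by (auto simp: is_cone_def Hom_iff F_Comp)
  have univ0: "\<exists>!h. h \<in> Hom C W K0 \<and> (\<forall>j \<in> Obj J. p0 j \<cdot>\<^bsub>C\<^esub> h = a j)"
    if "is_cone J C (comp_functor (Ev0 C) F) W a" for W a
    using lim0 that by (simp add: is_limit_def)
  have univ1: "\<exists>!h. h \<in> Hom C W K1 \<and> (\<forall>j \<in> Obj J. p1 j \<cdot>\<^bsub>C\<^esub> h = a j)"
    if "is_cone J C (comp_functor (Ev1 C) F) W a" for W a
    using lim1 that by (simp add: is_limit_def)
  have shift: "is_cone J C (comp_functor (Ev1 C) F) W (\<lambda>j. FObj F j \<cdot>\<^bsub>C\<^esub> a j)"
    if "is_cone J C (comp_functor (Ev0 C) F) W a" for W a
    unfolding is_cone_def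
  proof (intro conjI ballI)
    fix m assume m: "m \<in> Mor J"
    have a: "a j \<in> Mor C" "Dom C (a j) = W" "Cod C (a j) = Dom C (FObj F j)" if "j \<in> Obj J" for j
      using \<open>is_cone J C _ W a\<close> that by (auto simp: is_cone_def Hom_iff)
    have "FMor (Ev0 C) (FMor F m) \<cdot>\<^bsub>C\<^esub> a (Dom J m) = a (Cod J m)"
      using \<open>is_cone J C _ W a\<close> m by (simp add: is_cone_def)
    then show "FMor (comp_functor (Ev1 C) F) m \<cdot>\<^bsub>C\<^esub> FObj F (Dom J m) \<cdot>\<^bsub>C\<^esub> a (Dom J m) =
        FObj F (Cod J m) \<cdot>\<^bsub>C\<^esub> a (Cod J m)"
      using C.Comp_extend[OF nat[OF m], of "a (Dom J m)"] m by (simp add: a)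
  qed (use that in \<open>auto simp: is_cone_def Hom_iff\<close>)
  have "is_cone J C (comp_functor (Ev0 C) F) K0 p0"
    using lim0 by (simp add: is_limit_def)
  then obtain l where "l \<in> Hom C K0 K1" "\<forall>j \<in> Obj J. p1 j \<cdot>\<^bsub>C\<^esub> l = FObj F j \<cdot>\<^bsub>C\<^esub> p0 j"
    using univ1[OF shift] by blast
  then have l: "l \<in> Mor C" "Dom C l = K0" "Cod C l = K1"
    "\<And>j. j \<in> Obj J \<Longrightarrow> p1 j \<cdot>\<^bsub>C\<^esub> l = FObj F j \<cdot>\<^bsub>C\<^esub> p0 j"
    by (simp_all add: Hom_iff)
  define p where "p j = (l, FObj F j, p0 j, p1 j)" for j
  have "is_limit J (Arr C) F l p"
    unfolding is_limit_def
  proof (intro conjI allI impI)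
    show "is_cone J (Arr C) F l p"
      using lim0 lim1 l unfolding p_def cone_iff by (simp add: is_limit_def)
  next
    fix k a assume cone: "is_cone J (Arr C) F k a"
    define a0 a1 where "a0 j = FMor (Ev0 C) (a j)" and "a1 j = FMor (Ev1 C) (a j)" for j
    have a: "a j = (k, FObj F j, a0 j, a1 j)" if "j \<in> Obj J" for j
      using cone that by (cases "a j") (auto simp: is_cone_def Hom_iff a0_def a1_def)
    have "is_cone J (Arr C) F k (\<lambda>j. (k, FObj F j, a0 j, a1 j))"
      using cone a by (auto simp: is_cone_def)
    then have k: "k \<in> Mor C" and cone0: "is_cone J C (comp_functor (Ev0 C) F) (Dom C k) a0"
      and cone1: "is_cone J C (comp_functor (Ev1 C) F) (Cod C k) a1"
      and a_nat: "\<And>j. j \<in> Obj J \<Longrightarrow> a1 j \<cdot>\<^bsub>C\<^esub> k = FObj F j \<cdot>\<^bsub>C\<^esub> a0 j"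
      by (simp_all add: cone_iff)
    note u0 = univ0[OF cone0] and u1 = univ1[OF cone1] and s0 = univ1[OF shift[OF cone0]]
    from u0 obtain h0 where "h0 \<in> Hom C (Dom C k) K0" "\<forall>j \<in> Obj J. p0 j \<cdot>\<^bsub>C\<^esub> h0 = a0 j"
      by blast
    then have h0: "h0 \<in> Mor C" "Dom C h0 = Dom C k" "Cod C h0 = K0"
      "\<And>j. j \<in> Obj J \<Longrightarrow> p0 j \<cdot>\<^bsub>C\<^esub> h0 = a0 j"
      by (simp_all add: Hom_iff)
    from u1 obtain h1 where "h1 \<in> Hom C (Cod C k) K1" "\<forall>j \<in> Obj J. p1 j \<cdot>\<^bsub>C\<^esub> h1 = a1 j"
      by blast
    then have h1: "h1 \<in> Mor C" "Dom C h1 = Cod C k" "Cod C h1 = K1"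
      "\<And>j. j \<in> Obj J \<Longrightarrow> p1 j \<cdot>\<^bsub>C\<^esub> h1 = a1 j"
      by (simp_all add: Hom_iff)
    have "p1 j \<cdot>\<^bsub>C\<^esub> h1 \<cdot>\<^bsub>C\<^esub> k = FObj F j \<cdot>\<^bsub>C\<^esub> a0 j" if "j \<in> Obj J" for j
      using C.Comp_extend[OF h1(4)[OF that], of k] a_nat[OF that] h1 p1 k that by simp
    moreover have "p1 j \<cdot>\<^bsub>C\<^esub> l \<cdot>\<^bsub>C\<^esub> h0 = FObj F j \<cdot>\<^bsub>C\<^esub> a0 j" if "j \<in> Obj J" for j
      using C.Comp_extend[OF l(4)[OF that], of h0] h0 p0 p1 l that by simp
    ultimately have comm: "h1 \<cdot>\<^bsub>C\<^esub> k = l \<cdot>\<^bsub>C\<^esub> h0"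
      using s0 h0 h1 l k C.Comp_simps unfolding Hom_iff by metis
    show "\<exists>!h. h \<in> Hom (Arr C) k l \<and> (\<forall>j \<in> Obj J. p j \<cdot>\<^bsub>Arr C\<^esub> h = a j)"
    proof (rule ex1I[of _ "(k, l, h0, h1)"])
      show "(k, l, h0, h1) \<in> Hom (Arr C) k l \<and> (\<forall>j \<in> Obj J. p j \<cdot>\<^bsub>Arr C\<^esub> (k, l, h0, h1) = a j)"
        using comm h0 h1 l k by (auto simp: Hom_iff a p_def)
    next
      fix h assume h: "h \<in> Hom (Arr C) k l \<and> (\<forall>j \<in> Obj J. p j \<cdot>\<^bsub>Arr C\<^esub> h = a j)"
      obtain h0' h1' where h': "h = (k, l, h0', h1')"
        using h by (cases h) (auto simp: Hom_iff)
      have "h0' = h0"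
        using u0 h h0 l unfolding h' Hom_iff by (simp add: a p_def) metis
      moreover have "h1' = h1"
        using u1 h h1 l unfolding h' Hom_iff by (simp add: a p_def) metis
      ultimately show "h = (k, l, h0, h1)"
        by (simp add: h')
    qed
  qed
  then show ?thesis
    by blast
qed

text \<open>
  Colimits in \<open>Arr C\<close> are limits in \<open>opp (Arr C)\<close>, and reading every square backwards identifies
  this category with \<open>Arr (opp C)\<close>.
\<close>

definition swap_square :: "'a square \<Rightarrow> 'a square" where
  "swap_square = (\<lambda>(f, g, u, v). (g, f, v, u))"

lemma swap_square_simps [simp]: "swap_square (f, g, u, v) = (g, f, v, u)"
  by (simp add: swap_square_def)

lemma swap_square_swap_square [simp]: "swap_square (swap_square \<alpha>) = \<alpha>"
  by (cases \<alpha>) simp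

lemma swap_square_Hom_iff: "swap_square \<alpha> \<in> Hom (Arr (opp C)) g f \<longleftrightarrow> \<alpha> \<in> Hom (Arr C) f g"
  by (cases \<alpha>) (auto simp: Hom_iff)

lemma swap_square_Comp:
  "swap_square (\<beta> \<cdot>\<^bsub>Arr C\<^esub> \<alpha>) = swap_square \<alpha> \<cdot>\<^bsub>Arr (opp C)\<^esub> swap_square \<beta>"
  by (cases \<alpha>; cases \<beta>) simp

lemma swap_square_eq_iff [simp]: "swap_square \<alpha> = swap_square \<beta> \<longleftrightarrow> \<alpha> = \<beta>"
  by (cases \<alpha>; cases \<beta>) auto

definition swap_functor :: "('i, 'm, 'a, 'a square) cfunctor \<Rightarrow> ('i, 'm, 'a, 'a square) cfunctor" where
  "swap_functor F = \<lparr>FObj = FObj F, FMor = (\<lambda>m. swap_square (FMor F m))\<rparr>"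

lemma is_limit_swap:
  assumes "is_limit J (Arr (opp C)) (swap_functor F) L p"
  shows "is_limit J (opp (Arr C)) F L (\<lambda>j. swap_square (p j))"
proof -
  have hom: "\<alpha> \<in> Hom (Arr C) f g \<longleftrightarrow> swap_square \<alpha> \<in> Hom (Arr (opp C)) g f" for \<alpha> f g
    by (simp add: swap_square_Hom_iff)
  have cone: "is_cone J (opp (Arr C)) F K a \<longleftrightarrow>
      is_cone J (Arr (opp C)) (swap_functor F) K (\<lambda>j. swap_square (a j))" for K a
    by (simp add: is_cone_def swap_functor_def hom flip: swap_square_Comp)
  show ?thesis
    unfolding is_limit_def
  proof (intro conjI allI impI)
    show "is_cone J (opp (Arr C)) F L (\<lambda>j. swap_square (p j))"
      using assms by (simp add: cone is_limit_def)
  next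
    fix K a assume "is_cone J (opp (Arr C)) F K a"
    then have *: "\<exists>!h. h \<in> Hom (Arr (opp C)) K L \<and> (\<forall>j \<in> Obj J. p j \<cdot>\<^bsub>Arr (opp C)\<^esub> h = swap_square (a j))"
      using assms by (simp add: cone is_limit_def)
    have **: "swap_square (p j) \<cdot>\<^bsub>opp (Arr C)\<^esub> h = a j \<longleftrightarrow> p j \<cdot>\<^bsub>Arr (opp C)\<^esub> swap_square h = swap_square (a j)" for h j
      by (simp flip: swap_square_eq_iff[of _ "a j"] add: swap_square_Comp)
    show "\<exists>!h. h \<in> Hom (opp (Arr C)) K L \<and> (\<forall>j \<in> Obj J. swap_square (p j) \<cdot>\<^bsub>opp (Arr C)\<^esub> h = a j)"
      unfolding ** Hom_opp hom using * by (metis swap_square_swap_square)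
  qed
qed

lemma bicomplete_Arr:
  assumes "bicomplete TYPE('u::infinite) C"
  shows "bicomplete TYPE('u) (Arr C)"
  unfolding bicomplete_def
proof (intro conjI allI impI)
  interpret C: category C
    using assms by (rule bicomplete_category)
  show "category (Arr C)"
    by (rule C.Arr_category)
  fix J :: "('u, 'u) category" and F
  assume F: "is_functor J (Arr C) F"
  note F0 = is_functor_comp_functor[OF F C.is_functor_Ev0]
  note F1 = is_functor_comp_functor[OF F C.is_functor_Ev1]
  show "\<exists>L p. is_limit J (Arr C) F L p"
    by (rule bicomplete_limit[OF assms F0], rule bicomplete_limit[OF assms F1])
      (rule Arr_limit[OF F C.category_axioms])
  interpret F: is_functor J "Arr C" F by fact
  have "is_functor (opp J) (Arr (opp C)) (swap_functor F)"
  proof (rule is_functorI)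
    show "category (opp J)" "category (Arr (opp C))"
      by (simp_all add: category_opp F.C.category_axioms C.category_axioms category.Arr_category)
  next
    fix m assume "m \<in> Mor (opp J)"
    then have "FMor F m \<in> Hom (Arr C) (FObj F (Dom J m)) (FObj F (Cod J m))"
      by (simp add: Hom_iff)
    then have "swap_square (FMor F m) \<in> Hom (Arr (opp C)) (FObj F (Cod J m)) (FObj F (Dom J m))"
      by (simp add: swap_square_Hom_iff)
    then show "FMor (swap_functor F) m \<in> Mor (Arr (opp C)) \<and>
        Dom (Arr (opp C)) (FMor (swap_functor F) m) = FObj (swap_functor F) (Dom (opp J) m) \<and>
        Cod (Arr (opp C)) (FMor (swap_functor F) m) = FObj (swap_functor F) (Cod (opp J) m)"
      by (simp add: Hom_iff swap_functor_def)
  qed (use F.FObj_Obj in \<open>simp_all add: swap_functor_def swap_square_Comp\<close>)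
  moreover have "comp_functor (Ev0 (opp C)) (swap_functor F) = comp_functor (Ev1 C) F"
    by (auto simp: comp_functor_def swap_functor_def Ev0_def Ev1_def swap_square_def split: prod.splits)
  moreover have "comp_functor (Ev1 (opp C)) (swap_functor F) = comp_functor (Ev0 C) F"
    by (auto simp: comp_functor_def swap_functor_def Ev0_def Ev1_def swap_square_def split: prod.splits)
  moreover have "\<exists>L i. is_limit (opp J) (opp C) (comp_functor (Ev0 C) F) L i"
    "\<exists>L i. is_limit (opp J) (opp C) (comp_functor (Ev1 C) F) L i"
    using bicomplete_colimit[OF assms F0] bicomplete_colimit[OF assms F1] by auto
  ultimately have "\<exists>L p. is_limit (opp J) (Arr (opp C)) (swap_functor F) L p"
    using Arr_limit[of "opp J" "opp C" "swap_functor F"] category_opp[OF C.category_axioms] by auto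
  then show "\<exists>L i. is_colimit J (Arr C) F L i"
    unfolding is_colimit_def by (elim exE) (intro exI, erule is_limit_swap)
qed


section \<open>Lifting properties\<close>

definition RLP :: "('o, 'a) category \<Rightarrow> 'a set \<Rightarrow> 'a set" where
  "RLP C K = {p \<in> Mor C. \<forall>i \<in> K. has_lifting C i p}"

lemma has_liftingI:
  assumes "\<And>u v. \<lbrakk>(i, p, u, v) \<in> Mor (Arr C)\<rbrakk> \<Longrightarrow>
    \<exists>h. h \<in> Mor C \<and> Dom C h = Cod C i \<and> Cod C h = Dom C p \<and> h \<cdot>\<^bsub>C\<^esub> i = u \<and> p \<cdot>\<^bsub>C\<^esub> h = v"
  shows "has_lifting C i p"
  using assms unfolding has_lifting_def Bex_def Hom_iff by blast

lemma has_liftingE: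
  assumes "has_lifting C i p" "(i, p, u, v) \<in> Mor (Arr C)"
  obtains h where "h \<in> Mor C" "Dom C h = Cod C i" "Cod C h = Dom C p"
    "h \<cdot>\<^bsub>C\<^esub> i = u" "p \<cdot>\<^bsub>C\<^esub> h = v"
  using assms unfolding has_lifting_def Bex_def Hom_iff by blast

lemma is_retractE:
  assumes "is_retract C f g"
  obtains s0 s1 t0 t1 where "(f, g, s0, s1) \<in> Mor (Arr C)" "(g, f, t0, t1) \<in> Mor (Arr C)"
    "t0 \<cdot>\<^bsub>C\<^esub> s0 = Ident C (Dom C f)" "t1 \<cdot>\<^bsub>C\<^esub> s1 = Ident C (Cod C f)"
proof -
  obtain \<sigma> \<tau> where *: "\<sigma> \<in> Hom (Arr C) f g" "\<tau> \<in> Hom (Arr C) g f" "\<tau> \<cdot>\<^bsub>Arr C\<^esub> \<sigma> = Ident (Arr C) f"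
    using assms by (auto simp: is_retract_def)
  obtain f1 g1 s0 s1 where \<sigma>: "\<sigma> = (f1, g1, s0, s1)"
    by (cases \<sigma>) auto
  obtain g2 f2 t0 t1 where \<tau>: "\<tau> = (g2, f2, t0, t1)"
    by (cases \<tau>) auto
  show ?thesis
    using * that[of s0 s1 t0 t1] unfolding \<sigma> \<tau> Hom_iff by auto
qed

lemma is_retractI:
  assumes "(f, g, s0, s1) \<in> Mor (Arr C)" "(g, f, t0, t1) \<in> Mor (Arr C)"
    "t0 \<cdot>\<^bsub>C\<^esub> s0 = Ident C (Dom C f)" "t1 \<cdot>\<^bsub>C\<^esub> s1 = Ident C (Cod C f)"
  shows "is_retract C f g"
  unfolding is_retract_def
proof (intro conjI bexI)
  show "(g, f, t0, t1) \<cdot>\<^bsub>Arr C\<^esub> (f, g, s0, s1) = Ident (Arr C) f"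
    using assms by simp
qed (use assms in \<open>auto simp: Hom_iff\<close>)

lemma is_pullbackE:
  assumes "is_pullback C f g P p q" "a \<in> Mor C" "b \<in> Mor C" "Dom C a = Dom C b"
    "Cod C a = Dom C f" "Cod C b = Dom C g" "f \<cdot>\<^bsub>C\<^esub> a = g \<cdot>\<^bsub>C\<^esub> b"
  obtains h where "h \<in> Mor C" "Dom C h = Dom C a" "Cod C h = P" "p \<cdot>\<^bsub>C\<^esub> h = a" "q \<cdot>\<^bsub>C\<^esub> h = b"
  using assms unfolding is_pullback_def Hom_iff by metis

lemma is_pullback_simps:
  assumes "is_pullback C f g P p q"
  shows "f \<in> Mor C" "g \<in> Mor C" "Cod C f = Cod C g" "p \<in> Mor C" "Dom C p = P" "Cod C p = Dom C f"
    "q \<in> Mor C" "Dom C q = P" "Cod C q = Dom C g" "f \<cdot>\<^bsub>C\<^esub> p = g \<cdot>\<^bsub>C\<^esub> q"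
  using assms by (auto simp: is_pullback_def Hom_iff)

lemma (in category) is_pullback_eqI:
  assumes pb: "is_pullback C f g P p q" and "h \<in> Mor C" "k \<in> Mor C" "Dom C h = Dom C k"
    "Cod C h = P" "Cod C k = P" "p \<cdot>\<^bsub>C\<^esub> h = p \<cdot>\<^bsub>C\<^esub> k" "q \<cdot>\<^bsub>C\<^esub> h = q \<cdot>\<^bsub>C\<^esub> k"
  shows "h = k"
proof -
  note [simp] = is_pullback_simps[OF pb]
  have "f \<cdot>\<^bsub>C\<^esub> p \<cdot>\<^bsub>C\<^esub> k = g \<cdot>\<^bsub>C\<^esub> q \<cdot>\<^bsub>C\<^esub> k"
    using Comp_extend[of f p "g \<cdot>\<^bsub>C\<^esub> q" k] assms by simp
  then have "p \<cdot>\<^bsub>C\<^esub> k \<in> Hom C (Dom C k) (Dom C f) \<and> q \<cdot>\<^bsub>C\<^esub> k \<in> Hom C (Dom C k) (Dom C g) \<and>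
      f \<cdot>\<^bsub>C\<^esub> p \<cdot>\<^bsub>C\<^esub> k = g \<cdot>\<^bsub>C\<^esub> q \<cdot>\<^bsub>C\<^esub> k"
    using assms by (simp add: Hom_iff)
  then have "\<exists>!m. m \<in> Hom C (Dom C k) P \<and> p \<cdot>\<^bsub>C\<^esub> m = p \<cdot>\<^bsub>C\<^esub> k \<and> q \<cdot>\<^bsub>C\<^esub> m = q \<cdot>\<^bsub>C\<^esub> k"
    using pb unfolding is_pullback_def by blast
  then show ?thesis
    using assms by (metis Hom_iff)
qed

context category
begin

lemma RLP_Ident: "X \<in> Obj C \<Longrightarrow> Ident C X \<in> RLP C K"
  by (auto simp: RLP_def intro!: has_liftingI)

lemma RLP_Comp:
  assumes f: "f \<in> RLP C K" and g: "g \<in> RLP C K" and fg: "Cod C f = Dom C g"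
  shows "g \<cdot>\<^bsub>C\<^esub> f \<in> RLP C K"
proof -
  have Mor: "f \<in> Mor C" "g \<in> Mor C"
    using f g by (simp_all add: RLP_def)
  have "has_lifting C i (g \<cdot>\<^bsub>C\<^esub> f)" if i: "i \<in> K" for i
  proof (rule has_liftingI)
    fix u v assume sq: "(i, g \<cdot>\<^bsub>C\<^esub> f, u, v) \<in> Mor (Arr C)"
    have "has_lifting C i g" "(i, g, f \<cdot>\<^bsub>C\<^esub> u, v) \<in> Mor (Arr C)"
      using g i sq Mor fg by (auto simp: RLP_def)
    then obtain k where k: "k \<in> Mor C" "Dom C k = Cod C i" "Cod C k = Dom C g" "k \<cdot>\<^bsub>C\<^esub> i = f \<cdot>\<^bsub>C\<^esub> u" "g \<cdot>\<^bsub>C\<^esub> k = v"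
      by (rule has_liftingE)
    have "has_lifting C i f" "(i, f, u, k) \<in> Mor (Arr C)"
      using f i k sq Mor fg by (auto simp: RLP_def)
    then obtain h where "h \<in> Mor C" "Dom C h = Cod C i" "Cod C h = Dom C f" "h \<cdot>\<^bsub>C\<^esub> i = u" "f \<cdot>\<^bsub>C\<^esub> h = k"
      by (rule has_liftingE)
    then show "\<exists>h. h \<in> Mor C \<and> Dom C h = Cod C i \<and> Cod C h = Dom C (g \<cdot>\<^bsub>C\<^esub> f) \<and> h \<cdot>\<^bsub>C\<^esub> i = u \<and> (g \<cdot>\<^bsub>C\<^esub> f) \<cdot>\<^bsub>C\<^esub> h = v"
      using k Mor fg by (intro exI[of _ h]) auto
  qed
  then show ?thesis
    using Mor fg by (simp add: RLP_def)
qed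

lemma RLP_retract:
  assumes "is_retract C f g" and g: "g \<in> RLP C K"
  shows "f \<in> RLP C K"
proof -
  obtain s0 s1 t0 t1 where s: "(f, g, s0, s1) \<in> Mor (Arr C)" and t: "(g, f, t0, t1) \<in> Mor (Arr C)"
    and ts: "t0 \<cdot>\<^bsub>C\<^esub> s0 = Ident C (Dom C f)" "t1 \<cdot>\<^bsub>C\<^esub> s1 = Ident C (Cod C f)"
    using assms(1) by (rule is_retractE)
  note [simp] = s[simplified] t[simplified] Comp_extend[OF ts(1)] Comp_extend[OF ts(2)]
  have "has_lifting C i f" if i: "i \<in> K" for i
  proof (rule has_liftingI)
    fix u v assume sq: "(i, f, u, v) \<in> Mor (Arr C)"
    then have "(i, g, s0 \<cdot>\<^bsub>C\<^esub> u, s1 \<cdot>\<^bsub>C\<^esub> v) \<in> Mor (Arr C)"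
      using Comp_extend[of s1 f "g \<cdot>\<^bsub>C\<^esub> s0" u] by simp
    moreover have "has_lifting C i g"
      using g i by (simp add: RLP_def)
    ultimately obtain h where h: "h \<in> Mor C" "Dom C h = Cod C i" "Cod C h = Dom C g"
      "h \<cdot>\<^bsub>C\<^esub> i = s0 \<cdot>\<^bsub>C\<^esub> u" "g \<cdot>\<^bsub>C\<^esub> h = s1 \<cdot>\<^bsub>C\<^esub> v"
      by (elim has_liftingE)
    have "f \<cdot>\<^bsub>C\<^esub> t0 \<cdot>\<^bsub>C\<^esub> h = t1 \<cdot>\<^bsub>C\<^esub> g \<cdot>\<^bsub>C\<^esub> h"
      using Comp_extend[of t1 g "f \<cdot>\<^bsub>C\<^esub> t0" h] h by simp
    then show "\<exists>h. h \<in> Mor C \<and> Dom C h = Cod C i \<and> Cod C h = Dom C f \<and> h \<cdot>\<^bsub>C\<^esub> i = u \<and> f \<cdot>\<^bsub>C\<^esub> h = v"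
      using h sq by (intro exI[of _ "t0 \<cdot>\<^bsub>C\<^esub> h"]) auto
  qed
  then show ?thesis
    using s by (simp add: RLP_def)
qed

lemma RLP_pullback:
  assumes pb: "is_pullback C f g P p q" and f: "f \<in> RLP C K"
  shows "q \<in> RLP C K"
proof -
  note [simp] = is_pullback_simps[OF pb]
  have "has_lifting C i q" if i: "i \<in> K" for i
  proof (rule has_liftingI)
    fix u v assume sq: "(i, q, u, v) \<in> Mor (Arr C)"
    then have "(i, f, p \<cdot>\<^bsub>C\<^esub> u, g \<cdot>\<^bsub>C\<^esub> v) \<in> Mor (Arr C)"
      using Comp_extend[of f p "g \<cdot>\<^bsub>C\<^esub> q" u] by auto
    moreover have "has_lifting C i f"
      using f i by (simp add: RLP_def)
    ultimately obtain k where k: "k \<in> Mor C" "Dom C k = Cod C i" "Cod C k = Dom C f"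
      "k \<cdot>\<^bsub>C\<^esub> i = p \<cdot>\<^bsub>C\<^esub> u" "f \<cdot>\<^bsub>C\<^esub> k = g \<cdot>\<^bsub>C\<^esub> v"
      by (elim has_liftingE)
    then obtain h where h: "h \<in> Mor C" "Dom C h = Dom C k" "Cod C h = P" "p \<cdot>\<^bsub>C\<^esub> h = k" "q \<cdot>\<^bsub>C\<^esub> h = v"
      using is_pullbackE[OF pb, of k v] sq by auto
    have "h \<cdot>\<^bsub>C\<^esub> i = u"
      by (rule is_pullback_eqI[OF pb])
        (use h k sq Comp_extend[OF h(4), of i] Comp_extend[OF h(5), of i] in auto)
    then show "\<exists>h. h \<in> Mor C \<and> Dom C h = Cod C i \<and> Cod C h = Dom C q \<and> h \<cdot>\<^bsub>C\<^esub> i = u \<and> q \<cdot>\<^bsub>C\<^esub> h = v"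
      using h k by auto
  qed
  then show ?thesis
    by (simp add: RLP_def)
qed

end

text \<open>
  The retract argument: lifting \<open>p\<close> against the first factor of \<open>p = r \<cdot> i\<close> exhibits \<open>p\<close> as a
  retract of \<open>r\<close>.
\<close>

lemma (in category) retract_argument:
  assumes fact: "functorial_factorization C \<alpha> \<beta>" and p: "p \<in> Mor C"
    and lift: "has_lifting C (FObj \<alpha> p) p"
  shows "is_retract C p (FObj \<beta> p)"
proof -
  interpret A: is_functor "Arr C" "Arr C" \<alpha>
    using fact by (simp add: functorial_factorization_def)
  interpret B: is_functor "Arr C" "Arr C" \<beta>
    using fact by (simp add: functorial_factorization_def)
  have [simp]: "FObj \<alpha> p \<in> Mor C" "FObj \<beta> p \<in> Mor C"
    using A.FObj_Obj[of p] B.FObj_Obj[of p] p by simp_all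
  have [simp]: "Dom C (FObj \<alpha> p) = Dom C p" "Cod C (FObj \<beta> p) = Cod C p"
      "Cod C (FObj \<alpha> p) = Dom C (FObj \<beta> p)" and eq: "p = FObj \<beta> p \<cdot>\<^bsub>C\<^esub> FObj \<alpha> p"
    using fact p by (auto simp: functorial_factorization_def)
  have "(FObj \<alpha> p, p, Ident C (Dom C p), FObj \<beta> p) \<in> Mor (Arr C)"
    using p by (simp flip: eq)
  with lift obtain h where h: "h \<in> Mor C" "Dom C h = Cod C (FObj \<alpha> p)" "Cod C h = Dom C p"
      "h \<cdot>\<^bsub>C\<^esub> FObj \<alpha> p = Ident C (Dom C p)" "p \<cdot>\<^bsub>C\<^esub> h = FObj \<beta> p"
    by (rule has_liftingE)
  show ?thesis
    by (rule is_retractI[of _ _ "FObj \<alpha> p" "Ident C (Cod C p)" _ h "Ident C (Cod C p)"])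
      (use p h in \<open>simp_all flip: eq\<close>)
qed

context model_structure
begin

lemma weq_Mor [simp]: "f \<in> weq M \<Longrightarrow> f \<in> Mor C"
  and cof_Mor [simp]: "f \<in> cof M \<Longrightarrow> f \<in> Mor C"
  and fib_Mor [simp]: "f \<in> fib M \<Longrightarrow> f \<in> Mor C"
  using weq_subcategory cof_subcategory fib_subcategory by (auto simp: subcategory_def)

lemma fib_eq_RLP: "fib M = RLP C (tcof M)"
proof (intro equalityI subsetI)
  fix p assume p: "p \<in> RLP C (tcof M)"
  then have "is_retract C p (FObj (fact_fib M) p)"
    by (intro retract_argument[OF factorization_tcof_fib]) (auto simp: RLP_def fact_tcof)
  then show "p \<in> fib M"
    by (rule retract_fib) (use p in \<open>auto simp: RLP_def fact_fib\<close>)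
qed (simp add: RLP_def lifting_tcof_fib)

lemma tfib_eq_RLP: "tfib M = RLP C (cof M)"
proof (intro equalityI subsetI)
  fix p assume p: "p \<in> RLP C (cof M)"
  then have "is_retract C p (FObj (fact_tfib M) p)" "FObj (fact_tfib M) p \<in> tfib M"
    by (auto intro!: retract_argument[OF factorization_cof_tfib] simp: RLP_def fact_cof fact_tfib)
  then show "p \<in> tfib M"
    using retract_fib retract_weq by (auto simp: tfib_def)
next
  fix p assume "p \<in> tfib M"
  then show "p \<in> RLP C (cof M)"
    by (simp add: RLP_def lifting_cof_tfib) (simp add: tfib_def)
qed

lemma Ident_tcof: "X \<in> Obj C \<Longrightarrow> Ident C X \<in> tcof M"
proof -
  assume X: "X \<in> Obj C"
  \<comment> \<open>Every object is the domain of a trivial cofibration, and subcategories contain the identities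
    of the objects that occur in them.\<close>
  let ?i = "FObj (fact_tcof M) (Ident C X)"
  have "?i \<in> cof M" "?i \<in> weq M" "Dom C ?i = X"
    using fact_tcof[of "Ident C X"] factorization_tcof_fib X
    by (auto simp: tcof_def functorial_factorization_def)
  then show ?thesis
    using cof_subcategory weq_subcategory by (auto simp: subcategory_def tcof_def)
qed

lemma tcof_subset: "tcof M \<subseteq> cof M" "tcof M \<subseteq> weq M"
  by (auto simp: tcof_def)

lemma Ident_cof: "X \<in> Obj C \<Longrightarrow> Ident C X \<in> cof M"
  using Ident_tcof tcof_subset by blast

end


section \<open>Lifting properties of squares\<close>

definition pointwise :: "('o, 'a) category \<Rightarrow> 'a set \<Rightarrow> 'a square set" where
  "pointwise C K = {\<alpha> \<in> Mor (Arr C). FMor (Ev0 C) \<alpha> \<in> K \<and> FMor (Ev1 C) \<alpha> \<in> K}"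

lemma pointwise_simp [simp]:
  "(f, g, u, v) \<in> pointwise C K \<longleftrightarrow> (f, g, u, v) \<in> Mor (Arr C) \<and> u \<in> K \<and> v \<in> K"
  by (auto simp: pointwise_def)

text \<open>
  The map \<open>h\<close> is the corner map \<open>(f, u)\<close> of the square \<open>u : f \<rightarrow> g : v\<close>, with respect to the pullback
  \<open>P\<close> of \<open>v\<close> and \<open>g\<close>.
\<close>

definition is_corner :: "('o, 'a) category \<Rightarrow> 'a square \<Rightarrow> 'o \<Rightarrow> 'a \<Rightarrow> 'a \<Rightarrow> 'a \<Rightarrow> bool" where
  "is_corner C = (\<lambda>(f, g, u, v) P p q h. is_pullback C v g P p q \<and>
    h \<in> Hom C (Dom C f) P \<and> p \<cdot>\<^bsub>C\<^esub> h = f \<and> q \<cdot>\<^bsub>C\<^esub> h = u)"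

lemma (in category) is_corner_ex:
  assumes sq: "(f, g, u, v) \<in> Mor (Arr C)" and pb: "is_pullback C v g P p q"
  obtains h where "is_corner C (f, g, u, v) P p q h"
proof -
  obtain h where "h \<in> Mor C" "Dom C h = Dom C f" "Cod C h = P" "p \<cdot>\<^bsub>C\<^esub> h = f" "q \<cdot>\<^bsub>C\<^esub> h = u"
    using is_pullbackE[OF pb, of f u] sq by auto
  then show ?thesis
    using pb that by (simp add: is_corner_def Hom_iff)
qed

text \<open>
  Lifting against a square is done in two stages: once the lift \<open>l1\<close> on codomains is chosen, a lift on
  domains that is compatible with it is the same as a lift against the corner map.
\<close>

lemma (in category) has_lifting_square:
  assumes i: "(a, b, i0, i1) \<in> Mor (Arr C)" and \<alpha>: "(f, g, u, v) \<in> Mor (Arr C)"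
    and corner: "is_corner C (f, g, u, v) P p q h"
    and lift0: "has_lifting C i0 h" and lift1: "has_lifting C i1 v"
  shows "has_lifting (Arr C) (a, b, i0, i1) (f, g, u, v)"
proof (rule has_liftingI)
  fix \<mu> \<nu> assume sq: "((a, b, i0, i1), (f, g, u, v), \<mu>, \<nu>) \<in> Mor (Arr (Arr C))"
  obtain x0 x1 where \<mu>: "\<mu> = (a, f, x0, x1)"
    using sq by (cases \<mu>) auto
  obtain y0 y1 where \<nu>: "\<nu> = (b, g, y0, y1)"
    using sq by (cases \<nu>) auto
  have pb: "is_pullback C v g P p q" and h: "h \<in> Mor C" "Dom C h = Dom C f" "Cod C h = P"
    "p \<cdot>\<^bsub>C\<^esub> h = f" "q \<cdot>\<^bsub>C\<^esub> h = u"
    using corner by (simp_all add: is_corner_def Hom_iff)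
  note [simp] = i[simplified] \<alpha>[simplified] h is_pullback_simps[OF pb]
  have sq0: "y0 \<cdot>\<^bsub>C\<^esub> i0 = u \<cdot>\<^bsub>C\<^esub> x0" and sq1: "(i1, v, x1, y1) \<in> Mor (Arr C)"
    using sq by (auto simp: \<mu> \<nu>)
  have x: "(a, f, x0, x1) \<in> Mor (Arr C)" and y: "(b, g, y0, y1) \<in> Mor (Arr C)"
    using sq by (auto simp: \<mu> \<nu>)
  note [simp] = x[simplified] y[simplified]
  obtain l1 where l1: "l1 \<in> Mor C" "Dom C l1 = Cod C i1" "Cod C l1 = Dom C v" "l1 \<cdot>\<^bsub>C\<^esub> i1 = x1" "v \<cdot>\<^bsub>C\<^esub> l1 = y1"
    using has_liftingE[OF lift1 sq1] .
  have "v \<cdot>\<^bsub>C\<^esub> l1 \<cdot>\<^bsub>C\<^esub> b = g \<cdot>\<^bsub>C\<^esub> y0"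
    using Comp_extend[OF l1(5), of b] l1 by simp
  then obtain k where k: "k \<in> Mor C" "Dom C k = Dom C b" "Cod C k = P" "p \<cdot>\<^bsub>C\<^esub> k = l1 \<cdot>\<^bsub>C\<^esub> b" "q \<cdot>\<^bsub>C\<^esub> k = y0"
    using is_pullbackE[OF pb, of "l1 \<cdot>\<^bsub>C\<^esub> b" y0] l1 by auto
  have "k \<cdot>\<^bsub>C\<^esub> i0 = h \<cdot>\<^bsub>C\<^esub> x0"
  proof (rule is_pullback_eqI[OF pb])
    have "p \<cdot>\<^bsub>C\<^esub> k \<cdot>\<^bsub>C\<^esub> i0 = l1 \<cdot>\<^bsub>C\<^esub> b \<cdot>\<^bsub>C\<^esub> i0"
      using Comp_extend[OF k(4), of i0] k l1 by simp
    also have "\<dots> = l1 \<cdot>\<^bsub>C\<^esub> i1 \<cdot>\<^bsub>C\<^esub> a"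
      using i by simp
    also have "\<dots> = f \<cdot>\<^bsub>C\<^esub> x0"
      using Comp_extend[OF l1(4), of a] l1 by simp
    also have "\<dots> = p \<cdot>\<^bsub>C\<^esub> h \<cdot>\<^bsub>C\<^esub> x0"
      using Comp_extend[of p h f x0] by simp
    finally show "p \<cdot>\<^bsub>C\<^esub> k \<cdot>\<^bsub>C\<^esub> i0 = p \<cdot>\<^bsub>C\<^esub> h \<cdot>\<^bsub>C\<^esub> x0" .
    show "q \<cdot>\<^bsub>C\<^esub> k \<cdot>\<^bsub>C\<^esub> i0 = q \<cdot>\<^bsub>C\<^esub> h \<cdot>\<^bsub>C\<^esub> x0"
      using Comp_extend[OF k(5), of i0] Comp_extend[of q h u x0] k sq0 by simp
  qed (use k in simp_all)
  then have "(i0, h, x0, k) \<in> Mor (Arr C)"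
    using k by simp
  then obtain l0 where l0: "l0 \<in> Mor C" "Dom C l0 = Cod C i0" "Cod C l0 = Dom C h" "l0 \<cdot>\<^bsub>C\<^esub> i0 = x0" "h \<cdot>\<^bsub>C\<^esub> l0 = k"
    using has_liftingE[OF lift0] by metis
  have "l1 \<cdot>\<^bsub>C\<^esub> b = f \<cdot>\<^bsub>C\<^esub> l0"
    using Comp_extend[of p h f l0] k l0 by simp
  moreover have "u \<cdot>\<^bsub>C\<^esub> l0 = y0"
    using Comp_extend[of q h u l0] k l0 by simp
  ultimately have "(b, f, l0, l1) \<in> Mor (Arr C) \<and> (b, f, l0, l1) \<cdot>\<^bsub>Arr C\<^esub> (a, b, i0, i1) = \<mu> \<and>
      (f, g, u, v) \<cdot>\<^bsub>Arr C\<^esub> (b, f, l0, l1) = \<nu>"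
    using l0 l1 by (simp add: \<mu> \<nu>)
  then show "\<exists>l. l \<in> Mor (Arr C) \<and> Dom (Arr C) l = Cod (Arr C) (a, b, i0, i1) \<and>
      Cod (Arr C) l = Dom (Arr C) (f, g, u, v) \<and> l \<cdot>\<^bsub>Arr C\<^esub> (a, b, i0, i1) = \<mu> \<and>
      (f, g, u, v) \<cdot>\<^bsub>Arr C\<^esub> l = \<nu>"
    by (intro exI[of _ "(b, f, l0, l1)"]) simp
qed

text \<open>
  The corner map is detected by the squares from \<open>i : A \<rightarrow> B\<close> to \<open>1\<^sub>B\<close>: a lift against such a square has
  its codomain component prescribed, so that only the lift against the corner map remains.
\<close>

lemma (in category) has_lifting_corner:
  assumes i: "i \<in> Mor C" and \<alpha>: "(f, g, u, v) \<in> Mor (Arr C)"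
    and corner: "is_corner C (f, g, u, v) P p q h"
    and lift: "has_lifting (Arr C) (i, Ident C (Cod C i), i, Ident C (Cod C i)) (f, g, u, v)"
  shows "has_lifting C i h"
proof (rule has_liftingI)
  fix x y assume sq: "(i, h, x, y) \<in> Mor (Arr C)"
  have pb: "is_pullback C v g P p q" and h: "h \<in> Mor C" "Dom C h = Dom C f" "Cod C h = P"
    "p \<cdot>\<^bsub>C\<^esub> h = f" "q \<cdot>\<^bsub>C\<^esub> h = u"
    using corner by (simp_all add: is_corner_def Hom_iff)
  note [simp] = \<alpha>[simplified] h is_pullback_simps[OF pb] sq[simplified]
  let ?id = "Ident C (Cod C i)"
  have eqs: "f \<cdot>\<^bsub>C\<^esub> x = p \<cdot>\<^bsub>C\<^esub> h \<cdot>\<^bsub>C\<^esub> x" "u \<cdot>\<^bsub>C\<^esub> x = q \<cdot>\<^bsub>C\<^esub> h \<cdot>\<^bsub>C\<^esub> x"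
    using Comp_extend[of p h f x] Comp_extend[of q h u x] by simp_all
  have "((i, ?id, i, ?id), (f, g, u, v), (i, f, x, p \<cdot>\<^bsub>C\<^esub> y), (?id, g, q \<cdot>\<^bsub>C\<^esub> y, v \<cdot>\<^bsub>C\<^esub> p \<cdot>\<^bsub>C\<^esub> y)) \<in> Mor (Arr (Arr C))"
    using i Comp_extend[of v p "g \<cdot>\<^bsub>C\<^esub> q" y] by (simp add: eqs)
  then obtain l where l: "l \<in> Mor (Arr C)" "Dom (Arr C) l = ?id" "Cod (Arr C) l = f"
      "l \<cdot>\<^bsub>Arr C\<^esub> (i, ?id, i, ?id) = (i, f, x, p \<cdot>\<^bsub>C\<^esub> y)"
      "(f, g, u, v) \<cdot>\<^bsub>Arr C\<^esub> l = (?id, g, q \<cdot>\<^bsub>C\<^esub> y, v \<cdot>\<^bsub>C\<^esub> p \<cdot>\<^bsub>C\<^esub> y)"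
    using has_liftingE[OF lift] by (metis Arr_simps(3,4))
  obtain l0 l1 where l_eq: "l = (?id, f, l0, l1)"
    using l(2,3) by (cases l) auto
  have l0: "l0 \<in> Mor C" "Dom C l0 = Cod C i" "Cod C l0 = Dom C f" "l0 \<cdot>\<^bsub>C\<^esub> i = x" "u \<cdot>\<^bsub>C\<^esub> l0 = q \<cdot>\<^bsub>C\<^esub> y"
    and "l1 = p \<cdot>\<^bsub>C\<^esub> y" and "l1 = f \<cdot>\<^bsub>C\<^esub> l0"
    using l i unfolding l_eq by auto
  have proj: "p \<cdot>\<^bsub>C\<^esub> h \<cdot>\<^bsub>C\<^esub> l0 = p \<cdot>\<^bsub>C\<^esub> y" "q \<cdot>\<^bsub>C\<^esub> h \<cdot>\<^bsub>C\<^esub> l0 = q \<cdot>\<^bsub>C\<^esub> y"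
    using Comp_extend[of p h f l0] Comp_extend[of q h u l0] l0
    by (simp_all flip: \<open>l1 = p \<cdot>\<^bsub>C\<^esub> y\<close> \<open>l1 = f \<cdot>\<^bsub>C\<^esub> l0\<close>)
  have "h \<cdot>\<^bsub>C\<^esub> l0 = y"
    by (rule is_pullback_eqI[OF pb _ _ _ _ _ proj]) (simp_all add: l0)
  then show "\<exists>l. l \<in> Mor C \<and> Dom C l = Cod C i \<and> Cod C l = Dom C h \<and> l \<cdot>\<^bsub>C\<^esub> i = x \<and> h \<cdot>\<^bsub>C\<^esub> l = y"
    using l0 h(2) by metis
qed


text \<open>
  The codomain component is detected by the squares \<open>L1 i\<close>: their domain component is an identity of
  the initial object, so that a lift on domains always exists and only the codomains matter.
\<close>

lemma (in category) has_lifting_codomain: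
  assumes Z: "initial C Z" and i: "i \<in> Mor C" and \<alpha>: "(f, g, u, v) \<in> Mor (Arr C)"
    and lift: "has_lifting (Arr C) (FMor (L1 C Z) i) (f, g, u, v)"
  shows "has_lifting C i v"
proof (rule has_liftingI)
  fix x y assume sq: "(i, v, x, y) \<in> Mor (Arr C)"
  note [simp] = \<alpha>[simplified] sq[simplified] i initial_Obj[OF Z]
  let ?z = "from_initial C Z"
  have z: "f' \<cdot>\<^bsub>C\<^esub> ?z X = ?z Y" if "f' \<in> Mor C" "Dom C f' = X" "Cod C f' = Y" for f' X Y
    by (rule initial_eq[OF Z]) (use that Z Dom_Obj[of f'] Cod_Obj[of f'] in auto)
  have L1_i: "FMor (L1 C Z) i = (?z (Dom C i), ?z (Cod C i), Ident C Z, i)"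
    by (simp add: L1_def)
  have "(FMor (L1 C Z) i, (f, g, u, v), (?z (Dom C i), f, ?z (Dom C f), x), (?z (Cod C i), g, ?z (Dom C g), y))
      \<in> Mor (Arr (Arr C))"
    using Z by (simp add: L1_i z)
  then obtain l where l: "l \<in> Mor (Arr C)" "Dom (Arr C) l = ?z (Cod C i)" "Cod (Arr C) l = f"
      "l \<cdot>\<^bsub>Arr C\<^esub> FMor (L1 C Z) i = (?z (Dom C i), f, ?z (Dom C f), x)"
      "(f, g, u, v) \<cdot>\<^bsub>Arr C\<^esub> l = (?z (Cod C i), g, ?z (Dom C g), y)"
    using has_liftingE[OF lift] by (metis Arr_simps(3,4) L1_i)
  obtain l0 l1 where l_eq: "l = (?z (Cod C i), f, l0, l1)"
    using l(2,3) by (cases l) auto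
  show "\<exists>l. l \<in> Mor C \<and> Dom C l = Cod C i \<and> Cod C l = Dom C v \<and> l \<cdot>\<^bsub>C\<^esub> i = x \<and> v \<cdot>\<^bsub>C\<^esub> l = y"
    using l Z unfolding l_eq L1_i by (intro exI[of _ l1]) simp
qed

text \<open>
  One direction is the two-stage lifting of \<open>has_lifting_square\<close>, the other one lifts against the test
  squares \<open>L1 i\<close> and \<open>i \<rightarrow> 1\<close>. One component of these is \<open>i\<close> and the other one is an identity, so they
  belong to the pointwise class because \<open>K\<close> contains the identities.
\<close>

lemma (in category) RLP_pointwise_iff:
  assumes Z: "initial C Z" and K: "K \<subseteq> Mor C" "\<And>X. X \<in> Obj C \<Longrightarrow> Ident C X \<in> K"
    and \<alpha>: "(f, g, u, v) \<in> Mor (Arr C)" and corner: "is_corner C (f, g, u, v) P p q h"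
  shows "(f, g, u, v) \<in> RLP (Arr C) (pointwise C K) \<longleftrightarrow> v \<in> RLP C K \<and> h \<in> RLP C K"
proof
  assume *: "(f, g, u, v) \<in> RLP (Arr C) (pointwise C K)"
  have "has_lifting C i v" "has_lifting C i h" if i: "i \<in> K" for i
  proof -
    have Mor [simp]: "i \<in> Mor C"
      using K i by auto
    have "FMor (L1 C Z) i \<in> pointwise C K" "(i, Ident C (Cod C i), i, Ident C (Cod C i)) \<in> pointwise C K"
      using i Z K initial_Obj[OF Z] by (auto simp: L1_def intro!: initial_eq[OF Z])
    then have "has_lifting (Arr C) (FMor (L1 C Z) i) (f, g, u, v)"
      "has_lifting (Arr C) (i, Ident C (Cod C i), i, Ident C (Cod C i)) (f, g, u, v)"
      using * by (simp_all add: RLP_def)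
    then show "has_lifting C i v" "has_lifting C i h"
      using has_lifting_codomain[OF Z Mor \<alpha>] has_lifting_corner[OF Mor \<alpha> corner] by blast+
  qed
  then show "v \<in> RLP C K \<and> h \<in> RLP C K"
    using \<alpha> corner by (simp add: RLP_def is_corner_def Hom_iff)
next
  assume vh: "v \<in> RLP C K \<and> h \<in> RLP C K"
  have "has_lifting (Arr C) i (f, g, u, v)" if "i \<in> pointwise C K" for i
  proof -
    obtain a b i0 i1 where i: "i = (a, b, i0, i1)"
      by (cases i) auto
    have "(a, b, i0, i1) \<in> Mor (Arr C)" "has_lifting C i0 h" "has_lifting C i1 v"
      using vh that by (simp_all add: RLP_def i)
    then show ?thesis
      unfolding i by (intro has_lifting_square[OF _ \<alpha> corner])
  qed
  then show "(f, g, u, v) \<in> RLP (Arr C) (pointwise C K)"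
    using \<alpha> by (simp add: RLP_def)
qed


section \<open>Factorization of squares\<close>

text \<open>A natural transformation between functors to \<open>D\<close> is the same as a functor to \<open>Arr D\<close>.\<close>

definition arrow_functor :: "('p, 'b) category \<Rightarrow> ('p, 'b, 'o, 'a) cfunctor \<Rightarrow> ('p, 'b, 'o, 'a) cfunctor \<Rightarrow>
    ('p \<Rightarrow> 'a) \<Rightarrow> ('p, 'b, 'a, 'a square) cfunctor" where
  "arrow_functor X F G \<eta> =
    \<lparr>FObj = \<eta>, FMor = (\<lambda>\<sigma>. (\<eta> (Dom X \<sigma>), \<eta> (Cod X \<sigma>), FMor F \<sigma>, FMor G \<sigma>))\<rparr>"

lemma arrow_functor_simps [simp]:
  "FObj (arrow_functor X F G \<eta>) = \<eta>"
  "FMor (arrow_functor X F G \<eta>) \<sigma> = (\<eta> (Dom X \<sigma>), \<eta> (Cod X \<sigma>), FMor F \<sigma>, FMor G \<sigma>)"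
  by (simp_all add: arrow_functor_def)

lemma is_functor_arrow_functor:
  assumes F: "is_functor X D F" and G: "is_functor X D G"
    and \<eta>: "\<And>x. x \<in> Obj X \<Longrightarrow> \<eta> x \<in> Hom D (FObj F x) (FObj G x)"
    and natural: "\<And>\<sigma>. \<sigma> \<in> Mor X \<Longrightarrow> FMor G \<sigma> \<cdot>\<^bsub>D\<^esub> \<eta> (Dom X \<sigma>) = \<eta> (Cod X \<sigma>) \<cdot>\<^bsub>D\<^esub> FMor F \<sigma>"
  shows "is_functor X (Arr D) (arrow_functor X F G \<eta>)"
proof -
  interpret F: is_functor X D F by fact
  interpret G: is_functor X D G by fact
  show ?thesis
    by (rule is_functorI) (use \<eta> natural in \<open>auto simp: Hom_iff F.D.Arr_category F.C.category_axioms\<close>)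
qed

locale chosen_pullbacks = category C
  for C :: "('o, 'a) category" +
  fixes pb :: "'a \<Rightarrow> 'a \<Rightarrow> 'o" and pr1 pr2 :: "'a \<Rightarrow> 'a \<Rightarrow> 'a"
  assumes is_pullback_pb:
    "\<lbrakk>f \<in> Mor C; g \<in> Mor C; Cod C f = Cod C g\<rbrakk> \<Longrightarrow> is_pullback C f g (pb f g) (pr1 f g) (pr2 f g)"
begin

lemma pb_simps [simp]:
  assumes "f \<in> Mor C" "g \<in> Mor C" "Cod C f = Cod C g"
  shows "pr1 f g \<in> Mor C" "Dom C (pr1 f g) = pb f g" "Cod C (pr1 f g) = Dom C f"
    "pr2 f g \<in> Mor C" "Dom C (pr2 f g) = pb f g" "Cod C (pr2 f g) = Dom C g"
    "f \<cdot>\<^bsub>C\<^esub> pr1 f g = g \<cdot>\<^bsub>C\<^esub> pr2 f g" "pb f g \<in> Obj C"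
  using is_pullback_simps[OF is_pullback_pb[OF assms]] Dom_Obj[of "pr1 f g"] by auto

definition pair :: "'a \<Rightarrow> 'a \<Rightarrow> 'a \<Rightarrow> 'a \<Rightarrow> 'a" where
  "pair f g a b = (THE h. h \<in> Hom C (Dom C a) (pb f g) \<and> pr1 f g \<cdot>\<^bsub>C\<^esub> h = a \<and> pr2 f g \<cdot>\<^bsub>C\<^esub> h = b)"

lemma pair_simps [simp]:
  assumes "f \<in> Mor C" "g \<in> Mor C" "Cod C f = Cod C g" "a \<in> Mor C" "b \<in> Mor C" "Dom C a = Dom C b"
    "Cod C a = Dom C f" "Cod C b = Dom C g" "f \<cdot>\<^bsub>C\<^esub> a = g \<cdot>\<^bsub>C\<^esub> b"
  shows "pair f g a b \<in> Mor C" "Dom C (pair f g a b) = Dom C b" "Cod C (pair f g a b) = pb f g"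
    "pr1 f g \<cdot>\<^bsub>C\<^esub> pair f g a b = a" "pr2 f g \<cdot>\<^bsub>C\<^esub> pair f g a b = b"
proof -
  have "\<exists>!h. h \<in> Hom C (Dom C a) (pb f g) \<and> pr1 f g \<cdot>\<^bsub>C\<^esub> h = a \<and> pr2 f g \<cdot>\<^bsub>C\<^esub> h = b"
    using is_pullback_pb[OF assms(1-3)] assms(4-) unfolding is_pullback_def Hom_iff by metis
  from theI'[OF this] show "pair f g a b \<in> Mor C" "Dom C (pair f g a b) = Dom C b" "Cod C (pair f g a b) = pb f g"
    "pr1 f g \<cdot>\<^bsub>C\<^esub> pair f g a b = a" "pr2 f g \<cdot>\<^bsub>C\<^esub> pair f g a b = b"
    using assms by (simp_all add: pair_def Hom_iff)
qed

lemma pb_eqI: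
  assumes "f \<in> Mor C" "g \<in> Mor C" "Cod C f = Cod C g" "h \<in> Mor C" "k \<in> Mor C" "Dom C h = Dom C k"
    "Cod C h = pb f g" "Cod C k = pb f g" "pr1 f g \<cdot>\<^bsub>C\<^esub> h = pr1 f g \<cdot>\<^bsub>C\<^esub> k" "pr2 f g \<cdot>\<^bsub>C\<^esub> h = pr2 f g \<cdot>\<^bsub>C\<^esub> k"
  shows "h = k"
  using is_pullback_eqI[OF is_pullback_pb] assms by blast

text \<open>
  The functor of pullbacks of a natural family of cospans, given by two functors \<open>F\<close> and \<open>G\<close> to the
  arrow category that agree at the codomains.
\<close>

definition pb_functor :: "('p, 'b) category \<Rightarrow> ('p, 'b, 'a, 'a square) cfunctor \<Rightarrow>
    ('p, 'b, 'a, 'a square) cfunctor \<Rightarrow> ('p, 'b, 'o, 'a) cfunctor" where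
  "pb_functor X F G = \<lparr>FObj = (\<lambda>x. pb (FObj F x) (FObj G x)),
    FMor = (\<lambda>\<sigma>. pair (FObj F (Cod X \<sigma>)) (FObj G (Cod X \<sigma>))
      (FMor (Ev0 C) (FMor F \<sigma>) \<cdot>\<^bsub>C\<^esub> pr1 (FObj F (Dom X \<sigma>)) (FObj G (Dom X \<sigma>)))
      (FMor (Ev0 C) (FMor G \<sigma>) \<cdot>\<^bsub>C\<^esub> pr2 (FObj F (Dom X \<sigma>)) (FObj G (Dom X \<sigma>))))\<rparr>"

end

text \<open>
  A functor to \<open>Arr C\<close>, split into its components, so that diagrams in \<open>C\<close> can be chased without
  destructing tuples.
\<close>

lemma functor_Arr_simps:
  assumes "is_functor X (Arr C) F"
  shows "x \<in> Obj X \<Longrightarrow> FObj F x \<in> Mor C"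
    "\<sigma> \<in> Mor X \<Longrightarrow> FMor (Ev0 C) (FMor F \<sigma>) \<in> Mor C"
    "\<sigma> \<in> Mor X \<Longrightarrow> Dom C (FMor (Ev0 C) (FMor F \<sigma>)) = Dom C (FObj F (Dom X \<sigma>))"
    "\<sigma> \<in> Mor X \<Longrightarrow> Cod C (FMor (Ev0 C) (FMor F \<sigma>)) = Dom C (FObj F (Cod X \<sigma>))"
    "\<sigma> \<in> Mor X \<Longrightarrow> FMor (Ev1 C) (FMor F \<sigma>) \<in> Mor C"
    "\<sigma> \<in> Mor X \<Longrightarrow> Dom C (FMor (Ev1 C) (FMor F \<sigma>)) = Cod C (FObj F (Dom X \<sigma>))"
    "\<sigma> \<in> Mor X \<Longrightarrow> Cod C (FMor (Ev1 C) (FMor F \<sigma>)) = Cod C (FObj F (Cod X \<sigma>))"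
    "\<sigma> \<in> Mor X \<Longrightarrow> FMor (Ev1 C) (FMor F \<sigma>) \<cdot>\<^bsub>C\<^esub> FObj F (Dom X \<sigma>) =
      FObj F (Cod X \<sigma>) \<cdot>\<^bsub>C\<^esub> FMor (Ev0 C) (FMor F \<sigma>)"
    "\<sigma> \<in> Mor X \<Longrightarrow> FMor F \<sigma> = (FObj F (Dom X \<sigma>), FObj F (Cod X \<sigma>), FMor (Ev0 C) (FMor F \<sigma>), FMor (Ev1 C) (FMor F \<sigma>))"
proof -
  interpret F: is_functor X "Arr C" F by fact
  show "x \<in> Obj X \<Longrightarrow> FObj F x \<in> Mor C"
    using F.FObj_Obj by simp
  assume "\<sigma> \<in> Mor X"
  from F.FMor_simps[OF this]
  show "FMor (Ev0 C) (FMor F \<sigma>) \<in> Mor C"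
    "Dom C (FMor (Ev0 C) (FMor F \<sigma>)) = Dom C (FObj F (Dom X \<sigma>))"
    "Cod C (FMor (Ev0 C) (FMor F \<sigma>)) = Dom C (FObj F (Cod X \<sigma>))"
    "FMor (Ev1 C) (FMor F \<sigma>) \<in> Mor C"
    "Dom C (FMor (Ev1 C) (FMor F \<sigma>)) = Cod C (FObj F (Dom X \<sigma>))"
    "Cod C (FMor (Ev1 C) (FMor F \<sigma>)) = Cod C (FObj F (Cod X \<sigma>))"
    "FMor (Ev1 C) (FMor F \<sigma>) \<cdot>\<^bsub>C\<^esub> FObj F (Dom X \<sigma>) = FObj F (Cod X \<sigma>) \<cdot>\<^bsub>C\<^esub> FMor (Ev0 C) (FMor F \<sigma>)"
    "FMor F \<sigma> = (FObj F (Dom X \<sigma>), FObj F (Cod X \<sigma>), FMor (Ev0 C) (FMor F \<sigma>), FMor (Ev1 C) (FMor F \<sigma>))"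
    by (cases "FMor F \<sigma>"; auto)+
qed

context chosen_pullbacks
begin

lemma is_functor_pb_functor:
  assumes F: "is_functor X (Arr C) F" and G: "is_functor X (Arr C) G"
    and Cod_eq: "\<And>x. x \<in> Obj X \<Longrightarrow> Cod C (FObj F x) = Cod C (FObj G x)"
    and Ev1_eq: "\<And>\<sigma>. \<sigma> \<in> Mor X \<Longrightarrow> FMor (Ev1 C) (FMor F \<sigma>) = FMor (Ev1 C) (FMor G \<sigma>)"
  shows "is_functor X C (pb_functor X F G)"
    and "\<sigma> \<in> Mor X \<Longrightarrow> pr1 (FObj F (Cod X \<sigma>)) (FObj G (Cod X \<sigma>)) \<cdot>\<^bsub>C\<^esub> FMor (pb_functor X F G) \<sigma> =
      FMor (Ev0 C) (FMor F \<sigma>) \<cdot>\<^bsub>C\<^esub> pr1 (FObj F (Dom X \<sigma>)) (FObj G (Dom X \<sigma>))"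
    and "\<sigma> \<in> Mor X \<Longrightarrow> pr2 (FObj F (Cod X \<sigma>)) (FObj G (Cod X \<sigma>)) \<cdot>\<^bsub>C\<^esub> FMor (pb_functor X F G) \<sigma> =
      FMor (Ev0 C) (FMor G \<sigma>) \<cdot>\<^bsub>C\<^esub> pr2 (FObj F (Dom X \<sigma>)) (FObj G (Dom X \<sigma>))"
proof -
  interpret F: is_functor X "Arr C" F by fact
  interpret G: is_functor X "Arr C" G by fact
  interpret E0: is_functor "Arr C" C "Ev0 C" by (rule is_functor_Ev0)
  note [simp] = functor_Arr_simps(1-7)[OF F] functor_Arr_simps(1-7)[OF G] Cod_eq
  define \<pi>1 \<pi>2 where "\<pi>1 x = pr1 (FObj F x) (FObj G x)" and "\<pi>2 x = pr2 (FObj F x) (FObj G x)" for x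
  define F0 G0 where "F0 \<sigma> = FMor (Ev0 C) (FMor F \<sigma>)" and "G0 \<sigma> = FMor (Ev0 C) (FMor G \<sigma>)" for \<sigma>
  let ?P = "pb_functor X F G"
  have P_Obj: "FObj ?P x = pb (FObj F x) (FObj G x)" for x
    by (simp add: pb_functor_def)
  have P_Mor: "FMor ?P \<sigma> = pair (FObj F (Cod X \<sigma>)) (FObj G (Cod X \<sigma>)) (F0 \<sigma> \<cdot>\<^bsub>C\<^esub> \<pi>1 (Dom X \<sigma>)) (G0 \<sigma> \<cdot>\<^bsub>C\<^esub> \<pi>2 (Dom X \<sigma>))" for \<sigma>
    by (simp add: pb_functor_def \<pi>1_def \<pi>2_def F0_def G0_def)
  have \<pi> [simp]: "\<pi>1 x \<in> Mor C" "Dom C (\<pi>1 x) = FObj ?P x" "Cod C (\<pi>1 x) = Dom C (FObj F x)"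
    "\<pi>2 x \<in> Mor C" "Dom C (\<pi>2 x) = FObj ?P x" "Cod C (\<pi>2 x) = Dom C (FObj G x)"
    "FObj F x \<cdot>\<^bsub>C\<^esub> \<pi>1 x = FObj G x \<cdot>\<^bsub>C\<^esub> \<pi>2 x" if "x \<in> Obj X" for x
    using that by (simp_all add: \<pi>1_def \<pi>2_def P_Obj)
  have FG0 [simp]: "F0 \<sigma> \<in> Mor C" "Dom C (F0 \<sigma>) = Dom C (FObj F (Dom X \<sigma>))" "Cod C (F0 \<sigma>) = Dom C (FObj F (Cod X \<sigma>))"
    "G0 \<sigma> \<in> Mor C" "Dom C (G0 \<sigma>) = Dom C (FObj G (Dom X \<sigma>))" "Cod C (G0 \<sigma>) = Dom C (FObj G (Cod X \<sigma>))"
    if "\<sigma> \<in> Mor X" for \<sigma>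
    using that by (simp_all add: F0_def G0_def)
  have comm: "FObj F (Cod X \<sigma>) \<cdot>\<^bsub>C\<^esub> F0 \<sigma> \<cdot>\<^bsub>C\<^esub> \<pi>1 (Dom X \<sigma>) = FObj G (Cod X \<sigma>) \<cdot>\<^bsub>C\<^esub> G0 \<sigma> \<cdot>\<^bsub>C\<^esub> \<pi>2 (Dom X \<sigma>)"
    if \<sigma>: "\<sigma> \<in> Mor X" for \<sigma>
  proof -
    let ?t = "FMor (Ev1 C) (FMor F \<sigma>)"
    have *: "?t \<cdot>\<^bsub>C\<^esub> FObj F (Dom X \<sigma>) = FObj F (Cod X \<sigma>) \<cdot>\<^bsub>C\<^esub> F0 \<sigma>"
        "?t \<cdot>\<^bsub>C\<^esub> FObj G (Dom X \<sigma>) = FObj G (Cod X \<sigma>) \<cdot>\<^bsub>C\<^esub> G0 \<sigma>"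
      using functor_Arr_simps(8)[OF F \<sigma>] functor_Arr_simps(8)[OF G \<sigma>] Ev1_eq[OF \<sigma>]
      by (simp_all add: F0_def G0_def)
    have "?t \<cdot>\<^bsub>C\<^esub> FObj F (Dom X \<sigma>) \<cdot>\<^bsub>C\<^esub> \<pi>1 (Dom X \<sigma>) = ?t \<cdot>\<^bsub>C\<^esub> FObj G (Dom X \<sigma>) \<cdot>\<^bsub>C\<^esub> \<pi>2 (Dom X \<sigma>)"
      using \<sigma> by simp
    then show ?thesis
      using Comp_extend[OF *(1), of "\<pi>1 (Dom X \<sigma>)"] Comp_extend[OF *(2), of "\<pi>2 (Dom X \<sigma>)"] \<sigma>
      by simp
  qed
  have P [simp]: "FMor ?P \<sigma> \<in> Mor C" "Dom C (FMor ?P \<sigma>) = FObj ?P (Dom X \<sigma>)"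
    "Cod C (FMor ?P \<sigma>) = FObj ?P (Cod X \<sigma>)"
    and P_proj: "\<pi>1 (Cod X \<sigma>) \<cdot>\<^bsub>C\<^esub> FMor ?P \<sigma> = F0 \<sigma> \<cdot>\<^bsub>C\<^esub> \<pi>1 (Dom X \<sigma>)"
    "\<pi>2 (Cod X \<sigma>) \<cdot>\<^bsub>C\<^esub> FMor ?P \<sigma> = G0 \<sigma> \<cdot>\<^bsub>C\<^esub> \<pi>2 (Dom X \<sigma>)" if "\<sigma> \<in> Mor X" for \<sigma>
    using that pair_simps[of "FObj F (Cod X \<sigma>)" "FObj G (Cod X \<sigma>)" "F0 \<sigma> \<cdot>\<^bsub>C\<^esub> \<pi>1 (Dom X \<sigma>)" "G0 \<sigma> \<cdot>\<^bsub>C\<^esub> \<pi>2 (Dom X \<sigma>)"] comm[of \<sigma>]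
    by (simp_all add: P_Mor P_Obj \<pi>1_def \<pi>2_def)
  have eqI: "h = k" if "x \<in> Obj X" "h \<in> Mor C" "k \<in> Mor C" "Dom C h = Dom C k" "Cod C h = FObj ?P x"
      "Cod C k = FObj ?P x" "\<pi>1 x \<cdot>\<^bsub>C\<^esub> h = \<pi>1 x \<cdot>\<^bsub>C\<^esub> k" "\<pi>2 x \<cdot>\<^bsub>C\<^esub> h = \<pi>2 x \<cdot>\<^bsub>C\<^esub> k" for x h k
    by (rule pb_eqI[of "FObj F x" "FObj G x"]) (use that in \<open>simp_all add: \<pi>1_def \<pi>2_def P_Obj\<close>)
  have [simp]: "FObj ?P x \<in> Obj C" if "x \<in> Obj X" for x
    using that by (simp add: P_Obj)
  have F0_Comp: "F0 (\<tau> \<cdot>\<^bsub>X\<^esub> \<sigma>) = F0 \<tau> \<cdot>\<^bsub>C\<^esub> F0 \<sigma>" "G0 (\<tau> \<cdot>\<^bsub>X\<^esub> \<sigma>) = G0 \<tau> \<cdot>\<^bsub>C\<^esub> G0 \<sigma>"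
    if "\<sigma> \<in> Mor X" "\<tau> \<in> Mor X" "Cod X \<sigma> = Dom X \<tau>" for \<sigma> \<tau>
    using that by (simp_all add: F0_def G0_def)
  show "is_functor X C ?P"
  proof (rule is_functorI)
    fix x assume x: "x \<in> Obj X"
    have id: "F0 (Ident X x) = Ident C (Dom C (FObj F x))" "G0 (Ident X x) = Ident C (Dom C (FObj G x))"
      using x by (simp_all add: F0_def G0_def)
    show "FMor ?P (Ident X x) = Ident C (FObj ?P x)"
      by (rule eqI[OF x]) (use P_proj[of "Ident X x"] x in \<open>simp_all add: id\<close>)
  next
    fix \<sigma> \<tau> assume \<sigma>\<tau>: "\<sigma> \<in> Mor X" "\<tau> \<in> Mor X" "Cod X \<sigma> = Dom X \<tau>"
    show "FMor ?P (\<tau> \<cdot>\<^bsub>X\<^esub> \<sigma>) = FMor ?P \<tau> \<cdot>\<^bsub>C\<^esub> FMor ?P \<sigma>"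
    proof (rule eqI[of "Cod X \<tau>"])
      show "\<pi>1 (Cod X \<tau>) \<cdot>\<^bsub>C\<^esub> FMor ?P (\<tau> \<cdot>\<^bsub>X\<^esub> \<sigma>) = \<pi>1 (Cod X \<tau>) \<cdot>\<^bsub>C\<^esub> FMor ?P \<tau> \<cdot>\<^bsub>C\<^esub> FMor ?P \<sigma>"
        using P_proj(1)[of "\<tau> \<cdot>\<^bsub>X\<^esub> \<sigma>"] P_proj(1)[of \<sigma>] Comp_extend[OF P_proj(1)[of \<tau>], of "FMor ?P \<sigma>"] \<sigma>\<tau>
        by (simp add: F0_Comp)
      show "\<pi>2 (Cod X \<tau>) \<cdot>\<^bsub>C\<^esub> FMor ?P (\<tau> \<cdot>\<^bsub>X\<^esub> \<sigma>) = \<pi>2 (Cod X \<tau>) \<cdot>\<^bsub>C\<^esub> FMor ?P \<tau> \<cdot>\<^bsub>C\<^esub> FMor ?P \<sigma>"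
        using P_proj(2)[of "\<tau> \<cdot>\<^bsub>X\<^esub> \<sigma>"] P_proj(2)[of \<sigma>] Comp_extend[OF P_proj(2)[of \<tau>], of "FMor ?P \<sigma>"] \<sigma>\<tau>
        by (simp add: F0_Comp)
    qed (use \<sigma>\<tau> in simp_all)
  qed (simp_all add: F.C.category_axioms category_axioms)
  assume "\<sigma> \<in> Mor X"
  then show "pr1 (FObj F (Cod X \<sigma>)) (FObj G (Cod X \<sigma>)) \<cdot>\<^bsub>C\<^esub> FMor ?P \<sigma> =
      FMor (Ev0 C) (FMor F \<sigma>) \<cdot>\<^bsub>C\<^esub> pr1 (FObj F (Dom X \<sigma>)) (FObj G (Dom X \<sigma>))"
    "pr2 (FObj F (Cod X \<sigma>)) (FObj G (Cod X \<sigma>)) \<cdot>\<^bsub>C\<^esub> FMor ?P \<sigma> =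
      FMor (Ev0 C) (FMor G \<sigma>) \<cdot>\<^bsub>C\<^esub> pr2 (FObj F (Dom X \<sigma>)) (FObj G (Dom X \<sigma>))"
    using P_proj[of \<sigma>] unfolding \<pi>1_def \<pi>2_def F0_def G0_def by simp_all
qed

end


text \<open>
  The pullback is existentially quantified. For classes stable under isomorphism, such as lifting
  classes, its choice does not matter.
\<close>

definition has_corner_in :: "('o, 'a) category \<Rightarrow> 'a set \<Rightarrow> 'a square \<Rightarrow> bool" where
  "has_corner_in C L \<alpha> \<longleftrightarrow> (\<exists>f g u v P p q h. \<alpha> = (f, g, u, v) \<and> (f, g, u, v) \<in> Mor (Arr C) \<and>
    is_corner C (f, g, u, v) P p q h \<and> v \<in> L \<and> h \<in> L)"

locale square_factorization = chosen_pullbacks C pb pr1 pr2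
  for C :: "('o, 'a) category" and pb pr1 pr2 +
  fixes A B :: "('a, 'a square, 'a, 'a square) cfunctor"
  assumes fact: "functorial_factorization C A B"
begin

text \<open>
  A square \<open>u : f \<rightarrow> g : v\<close> is factored in two steps. First \<open>v\<close> is factored in \<open>C\<close>; its second factor
  and \<open>g\<close> have a pullback, and the corner map from the domain of \<open>f\<close> to this pullback is factored
  next. Everything is expressed through functors on \<open>Arr (Arr C)\<close>, so that the functoriality of the
  result is automatic.
\<close>

abbreviation "AA \<equiv> Arr (Arr C)"

definition codomain_functor :: "('a square, 'a square square, 'a, 'a square) cfunctor" where
  "codomain_functor = arrow_functor AA (comp_functor (Ev1 C) (Ev0 (Arr C)))
    (comp_functor (Ev1 C) (Ev1 (Arr C))) (FMor (Ev1 C))"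

definition pb_square :: "('a square, 'a square square, 'o, 'a) cfunctor" where
  "pb_square = pb_functor AA (comp_functor B codomain_functor) (Ev1 (Arr C))"

definition corner :: "'a square \<Rightarrow> 'a" where
  "corner = (\<lambda>(f, g, u, v). pair (FObj B v) g (FObj A v \<cdot>\<^bsub>C\<^esub> f) u)"

definition corner_functor :: "('a square, 'a square square, 'a, 'a square) cfunctor" where
  "corner_functor = arrow_functor AA (comp_functor (Ev0 C) (Ev0 (Arr C))) pb_square corner"

definition middle :: "'a square \<Rightarrow> 'a" where
  "middle \<alpha> = (case \<alpha> of (f, g, u, v) \<Rightarrow> pr1 (FObj B v) g \<cdot>\<^bsub>C\<^esub> FObj B (corner \<alpha>))"

definition middle_functor :: "('a square, 'a square square, 'a, 'a square) cfunctor" where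
  "middle_functor = arrow_functor AA (comp_functor (Ev1 C) (comp_functor A corner_functor))
    (comp_functor (Ev1 C) (comp_functor A codomain_functor)) middle"

definition left_square :: "'a square \<Rightarrow> 'a square" where
  "left_square \<alpha> = (case \<alpha> of (f, g, u, v) \<Rightarrow> (f, middle \<alpha>, FObj A (corner \<alpha>), FObj A v))"

definition right_square :: "'a square \<Rightarrow> 'a square" where
  "right_square \<alpha> = (case \<alpha> of (f, g, u, v) \<Rightarrow>
    (middle \<alpha>, g, pr2 (FObj B v) g \<cdot>\<^bsub>C\<^esub> FObj B (corner \<alpha>), FObj B v))"

definition left_functor :: "('a square, 'a square square, 'a square, 'a square square) cfunctor" where
  "left_functor = arrow_functor AA (Ev0 (Arr C)) middle_functor left_square"

definition right_functor :: "('a square, 'a square square, 'a square, 'a square square) cfunctor" where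
  "right_functor = arrow_functor AA middle_functor (Ev1 (Arr C)) right_square"

lemma is_functor_A: "is_functor (Arr C) (Arr C) A" and is_functor_B: "is_functor (Arr C) (Arr C) B"
  using fact by (simp_all add: functorial_factorization_def)

lemma A_B_simps [simp]:
  assumes "f \<in> Mor C"
  shows "FObj A f \<in> Mor C" "FObj B f \<in> Mor C" "Dom C (FObj A f) = Dom C f"
    "Cod C (FObj A f) = Dom C (FObj B f)" "Cod C (FObj B f) = Cod C f"
    "FObj B f \<cdot>\<^bsub>C\<^esub> FObj A f = f"
  using assms fact is_functor.FObj_Obj[OF is_functor_A] is_functor.FObj_Obj[OF is_functor_B]
  by (simp_all add: functorial_factorization_def)

lemma A_B_FMor:
  assumes "(f, g, u, v) \<in> Mor (Arr C)"
  shows "\<exists>w. FMor A (f, g, u, v) = (FObj A f, FObj A g, u, w) \<and> FMor B (f, g, u, v) = (FObj B f, FObj B g, w, v) \<and>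
    (FObj A f, FObj A g, u, w) \<in> Mor (Arr C) \<and> (FObj B f, FObj B g, w, v) \<in> Mor (Arr C)"
proof -
  interpret A: is_functor "Arr C" "Arr C" A by (rule is_functor_A)
  interpret B: is_functor "Arr C" "Arr C" B by (rule is_functor_B)
  obtain f1 g1 u1 w1 where 1: "FMor A (f, g, u, v) = (f1, g1, u1, w1)"
    by (cases "FMor A (f, g, u, v)")
  obtain f2 g2 w2 v2 where 2: "FMor B (f, g, u, v) = (f2, g2, w2, v2)"
    by (cases "FMor B (f, g, u, v)")
  have "u1 = u" "v2 = v" "w1 = w2"
    using fact assms 1 2 unfolding functorial_factorization_def by (metis Ev_simps(3,4))+
  then show ?thesis
    using A.FMor_simps[OF assms] B.FMor_simps[OF assms] 1 2 by (intro exI[of _ w1]) simp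
qed

lemma AA_functors:
  "is_functor AA (Arr C) (Ev0 (Arr C))" "is_functor AA (Arr C) (Ev1 (Arr C))"
  using category.is_functor_Ev0[OF Arr_category] category.is_functor_Ev1[OF Arr_category] by auto

lemma is_functor_codomain_functor: "is_functor AA (Arr C) codomain_functor"
  unfolding codomain_functor_def
proof (rule is_functor_arrow_functor)
  fix \<sigma> assume "\<sigma> \<in> Mor AA"
  then show "FMor (comp_functor (Ev1 C) (Ev1 (Arr C))) \<sigma> \<cdot>\<^bsub>C\<^esub> FMor (Ev1 C) (Dom AA \<sigma>) =
      FMor (Ev1 C) (Cod AA \<sigma>) \<cdot>\<^bsub>C\<^esub> FMor (comp_functor (Ev1 C) (Ev0 (Arr C))) \<sigma>"
    by (elim Arr_MorE) auto
qed (auto intro: is_functor_comp_functor AA_functors is_functor_Ev1 simp: Hom_iff)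

lemma is_functor_B_codomain: "is_functor AA (Arr C) (comp_functor B codomain_functor)"
  by (rule is_functor_comp_functor[OF is_functor_codomain_functor is_functor_B])

lemma codomain_functor_simps [simp]:
  "FObj codomain_functor (f, g, u, v) = v"
  "FMor codomain_functor ((f, g, u, v), (f', g', u', v'), (a, b, s0, s1), (c, d, t0, t1)) = (v, v', s1, t1)"
  by (simp_all add: codomain_functor_def)

lemma is_functor_pb_square: "is_functor AA C pb_square"
  and pb_square_pr1: "\<sigma> \<in> Mor AA \<Longrightarrow>
    pr1 (FObj B (FObj codomain_functor (Cod AA \<sigma>))) (Cod (Arr C) (Cod AA \<sigma>)) \<cdot>\<^bsub>C\<^esub> FMor pb_square \<sigma> =
    FMor (Ev0 C) (FMor B (FMor codomain_functor \<sigma>)) \<cdot>\<^bsub>C\<^esub>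
      pr1 (FObj B (FObj codomain_functor (Dom AA \<sigma>))) (Cod (Arr C) (Dom AA \<sigma>))"
  and pb_square_pr2: "\<sigma> \<in> Mor AA \<Longrightarrow>
    pr2 (FObj B (FObj codomain_functor (Cod AA \<sigma>))) (Cod (Arr C) (Cod AA \<sigma>)) \<cdot>\<^bsub>C\<^esub> FMor pb_square \<sigma> =
    FMor (Ev0 C) (FMor (Ev1 (Arr C)) \<sigma>) \<cdot>\<^bsub>C\<^esub>
      pr2 (FObj B (FObj codomain_functor (Dom AA \<sigma>))) (Cod (Arr C) (Dom AA \<sigma>))"
proof -
  have Cod_eq: "Cod C (FObj (comp_functor B codomain_functor) \<alpha>) = Cod C (FObj (Ev1 (Arr C)) \<alpha>)" if "\<alpha> \<in> Obj AA" for \<alpha>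
    using that by (cases \<alpha>) auto
  have Ev1_eq: "FMor (Ev1 C) (FMor (comp_functor B codomain_functor) \<sigma>) = FMor (Ev1 C) (FMor (Ev1 (Arr C)) \<sigma>)"
    if "\<sigma> \<in> Mor AA" for \<sigma>
  proof -
    have "FMor codomain_functor \<sigma> \<in> Mor (Arr C)"
      using is_functor.FMor_simps[OF is_functor_codomain_functor that] by simp
    then have "FMor (Ev1 C) (FMor B (FMor codomain_functor \<sigma>)) = FMor (Ev1 C) (FMor codomain_functor \<sigma>)"
      using fact by (simp add: functorial_factorization_def)
    then show ?thesis
      by (simp add: codomain_functor_def)
  qed
  note * = is_functor_pb_functor[OF is_functor_B_codomain AA_functors(2) Cod_eq Ev1_eq, folded pb_square_def]
  show "is_functor AA C pb_square"
    by (rule *(1))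
  show "\<sigma> \<in> Mor AA \<Longrightarrow>
    pr1 (FObj B (FObj codomain_functor (Cod AA \<sigma>))) (Cod (Arr C) (Cod AA \<sigma>)) \<cdot>\<^bsub>C\<^esub> FMor pb_square \<sigma> =
    FMor (Ev0 C) (FMor B (FMor codomain_functor \<sigma>)) \<cdot>\<^bsub>C\<^esub>
      pr1 (FObj B (FObj codomain_functor (Dom AA \<sigma>))) (Cod (Arr C) (Dom AA \<sigma>))"
    using *(2)[of \<sigma>] by simp
  show "\<sigma> \<in> Mor AA \<Longrightarrow>
    pr2 (FObj B (FObj codomain_functor (Cod AA \<sigma>))) (Cod (Arr C) (Cod AA \<sigma>)) \<cdot>\<^bsub>C\<^esub> FMor pb_square \<sigma> =
    FMor (Ev0 C) (FMor (Ev1 (Arr C)) \<sigma>) \<cdot>\<^bsub>C\<^esub>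
      pr2 (FObj B (FObj codomain_functor (Dom AA \<sigma>))) (Cod (Arr C) (Dom AA \<sigma>))"
    using *(3)[of \<sigma>] by simp
qed

lemma pb_square_Obj [simp]: "FObj pb_square (f, g, u, v) = pb (FObj B v) g"
  by (simp add: pb_square_def pb_functor_def)

lemma corner_simps [simp]:
  assumes "(f, g, u, v) \<in> Mor (Arr C)"
  shows "corner (f, g, u, v) \<in> Mor C" "Dom C (corner (f, g, u, v)) = Dom C f"
    "Cod C (corner (f, g, u, v)) = pb (FObj B v) g"
    "pr1 (FObj B v) g \<cdot>\<^bsub>C\<^esub> corner (f, g, u, v) = FObj A v \<cdot>\<^bsub>C\<^esub> f"
    "pr2 (FObj B v) g \<cdot>\<^bsub>C\<^esub> corner (f, g, u, v) = u"
proof -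
  have "FObj B v \<cdot>\<^bsub>C\<^esub> FObj A v \<cdot>\<^bsub>C\<^esub> f = g \<cdot>\<^bsub>C\<^esub> u"
    using Comp_extend[OF A_B_simps(6), of v f] assms by simp
  then show "corner (f, g, u, v) \<in> Mor C" "Dom C (corner (f, g, u, v)) = Dom C f"
    "Cod C (corner (f, g, u, v)) = pb (FObj B v) g"
    "pr1 (FObj B v) g \<cdot>\<^bsub>C\<^esub> corner (f, g, u, v) = FObj A v \<cdot>\<^bsub>C\<^esub> f"
    "pr2 (FObj B v) g \<cdot>\<^bsub>C\<^esub> corner (f, g, u, v) = u"
    using assms pair_simps[of "FObj B v" g "FObj A v \<cdot>\<^bsub>C\<^esub> f" u] by (simp_all add: corner_def)
qed

text \<open>
  All data of a morphism of squares at once: \<open>w1\<close> is the induced map between the factorizations of the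
  codomain components, \<open>k\<close> the one between the pullbacks and \<open>w0\<close> the one between the factorizations of
  the corner maps.
\<close>

lemma square_MorE:
  assumes "\<sigma> \<in> Mor AA"
  obtains f g u v f' g' u' v' s0 s1 t0 t1 w0 w1 k where
    "\<sigma> = ((f, g, u, v), (f', g', u', v'), (f, f', s0, s1), (g, g', t0, t1))"
    "(f, g, u, v) \<in> Mor (Arr C)" "(f', g', u', v') \<in> Mor (Arr C)"
    "(f, f', s0, s1) \<in> Mor (Arr C)" "(g, g', t0, t1) \<in> Mor (Arr C)" "(v, v', s1, t1) \<in> Mor (Arr C)"
    "t0 \<cdot>\<^bsub>C\<^esub> u = u' \<cdot>\<^bsub>C\<^esub> s0"
    "FMor A (v, v', s1, t1) = (FObj A v, FObj A v', s1, w1)"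
    "FMor B (v, v', s1, t1) = (FObj B v, FObj B v', w1, t1)"
    "(FObj A v, FObj A v', s1, w1) \<in> Mor (Arr C)" "(FObj B v, FObj B v', w1, t1) \<in> Mor (Arr C)"
    "FMor pb_square \<sigma> = k" "k \<in> Mor C" "Dom C k = pb (FObj B v) g" "Cod C k = pb (FObj B v') g'"
    "pr1 (FObj B v') g' \<cdot>\<^bsub>C\<^esub> k = w1 \<cdot>\<^bsub>C\<^esub> pr1 (FObj B v) g"
    "pr2 (FObj B v') g' \<cdot>\<^bsub>C\<^esub> k = t0 \<cdot>\<^bsub>C\<^esub> pr2 (FObj B v) g"
    "(corner (f, g, u, v), corner (f', g', u', v'), s0, k) \<in> Mor (Arr C)"
    "FMor A (corner (f, g, u, v), corner (f', g', u', v'), s0, k) =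
      (FObj A (corner (f, g, u, v)), FObj A (corner (f', g', u', v')), s0, w0)"
    "FMor B (corner (f, g, u, v), corner (f', g', u', v'), s0, k) =
      (FObj B (corner (f, g, u, v)), FObj B (corner (f', g', u', v')), w0, k)"
    "(FObj A (corner (f, g, u, v)), FObj A (corner (f', g', u', v')), s0, w0) \<in> Mor (Arr C)"
    "(FObj B (corner (f, g, u, v)), FObj B (corner (f', g', u', v')), w0, k) \<in> Mor (Arr C)"
proof -
  obtain f g u v f' g' u' v' s0 s1 t0 t1 where \<sigma>:
    "\<sigma> = ((f, g, u, v), (f', g', u', v'), (f, f', s0, s1), (g, g', t0, t1))"
    using assms by (elim Arr_MorE) auto
  have \<alpha>: "(f, g, u, v) \<in> Mor (Arr C)" and \<beta>: "(f', g', u', v') \<in> Mor (Arr C)"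
    and s: "(f, f', s0, s1) \<in> Mor (Arr C)" and t: "(g, g', t0, t1) \<in> Mor (Arr C)"
    and v: "(v, v', s1, t1) \<in> Mor (Arr C)" and comm: "t0 \<cdot>\<^bsub>C\<^esub> u = u' \<cdot>\<^bsub>C\<^esub> s0"
    using assms unfolding \<sigma> by simp_all
  obtain w1 where w1: "FMor A (v, v', s1, t1) = (FObj A v, FObj A v', s1, w1)"
    "FMor B (v, v', s1, t1) = (FObj B v, FObj B v', w1, t1)"
    "(FObj A v, FObj A v', s1, w1) \<in> Mor (Arr C)" "(FObj B v, FObj B v', w1, t1) \<in> Mor (Arr C)"
    using A_B_FMor[OF v] by blast
  define k where "k = FMor pb_square \<sigma>"
  have k: "k \<in> Mor C" "Dom C k = pb (FObj B v) g" "Cod C k = pb (FObj B v') g'"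
    using is_functor.FMor_simps[OF is_functor_pb_square assms] by (simp_all add: k_def \<sigma>)
  have k1: "pr1 (FObj B v') g' \<cdot>\<^bsub>C\<^esub> k = w1 \<cdot>\<^bsub>C\<^esub> pr1 (FObj B v) g"
    and k2: "pr2 (FObj B v') g' \<cdot>\<^bsub>C\<^esub> k = t0 \<cdot>\<^bsub>C\<^esub> pr2 (FObj B v) g"
    using pb_square_pr1[OF assms] pb_square_pr2[OF assms] w1 by (simp_all add: \<sigma> k_def)
  let ?c = "corner (f, g, u, v)" and ?c' = "corner (f', g', u', v')"
  have "k \<cdot>\<^bsub>C\<^esub> ?c = ?c' \<cdot>\<^bsub>C\<^esub> s0"
  proof (rule pb_eqI[of "FObj B v'" g'])
    note [simp] = \<alpha>[simplified] \<beta>[simplified] s[simplified] t[simplified] v[simplified] w1[simplified] k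
    have "pr1 (FObj B v') g' \<cdot>\<^bsub>C\<^esub> k \<cdot>\<^bsub>C\<^esub> ?c = w1 \<cdot>\<^bsub>C\<^esub> FObj A v \<cdot>\<^bsub>C\<^esub> f"
      using Comp_extend[OF k1, of ?c] by simp
    also have "\<dots> = FObj A v' \<cdot>\<^bsub>C\<^esub> s1 \<cdot>\<^bsub>C\<^esub> f"
      using Comp_extend[of w1 "FObj A v" "FObj A v' \<cdot>\<^bsub>C\<^esub> s1" f] by simp
    also have "\<dots> = pr1 (FObj B v') g' \<cdot>\<^bsub>C\<^esub> ?c' \<cdot>\<^bsub>C\<^esub> s0"
      using Comp_extend[of "pr1 (FObj B v') g'" ?c' "FObj A v' \<cdot>\<^bsub>C\<^esub> f'" s0] by simp
    finally show "pr1 (FObj B v') g' \<cdot>\<^bsub>C\<^esub> k \<cdot>\<^bsub>C\<^esub> ?c = pr1 (FObj B v') g' \<cdot>\<^bsub>C\<^esub> ?c' \<cdot>\<^bsub>C\<^esub> s0" .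
    show "pr2 (FObj B v') g' \<cdot>\<^bsub>C\<^esub> k \<cdot>\<^bsub>C\<^esub> ?c = pr2 (FObj B v') g' \<cdot>\<^bsub>C\<^esub> ?c' \<cdot>\<^bsub>C\<^esub> s0"
      using Comp_extend[OF k2, of ?c] Comp_extend[of "pr2 (FObj B v') g'" ?c' u' s0] comm by simp
  qed (use \<alpha> \<beta> s t v w1 k in simp_all)
  then have c: "(?c, ?c', s0, k) \<in> Mor (Arr C)"
    using \<alpha> \<beta> s k by simp
  obtain w0 where "FMor A (?c, ?c', s0, k) = (FObj A ?c, FObj A ?c', s0, w0)"
    "FMor B (?c, ?c', s0, k) = (FObj B ?c, FObj B ?c', w0, k)"
    "(FObj A ?c, FObj A ?c', s0, w0) \<in> Mor (Arr C)" "(FObj B ?c, FObj B ?c', w0, k) \<in> Mor (Arr C)"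
    using A_B_FMor[OF c] by blast
  with that[OF \<sigma> \<alpha> \<beta> s t v comm w1 _ k k1 k2 c] show ?thesis
    by (simp add: k_def)
qed

lemma is_functor_corner_functor: "is_functor AA (Arr C) corner_functor"
  unfolding corner_functor_def
proof (rule is_functor_arrow_functor)
  fix \<sigma> assume \<sigma>: "\<sigma> \<in> Mor AA"
  then show "FMor pb_square \<sigma> \<cdot>\<^bsub>C\<^esub> corner (Dom AA \<sigma>) =
      corner (Cod AA \<sigma>) \<cdot>\<^bsub>C\<^esub> FMor (comp_functor (Ev0 C) (Ev0 (Arr C))) \<sigma>"
    by (elim square_MorE) simp
qed (auto intro: is_functor_comp_functor AA_functors is_functor_Ev0 is_functor_pb_square simp: Hom_iff)

lemma middle_simps [simp]:
  assumes "(f, g, u, v) \<in> Mor (Arr C)"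
  shows "middle (f, g, u, v) \<in> Mor C" "Dom C (middle (f, g, u, v)) = Dom C (FObj B (corner (f, g, u, v)))"
    "Cod C (middle (f, g, u, v)) = Dom C (FObj B v)"
  using assms by (simp_all add: middle_def)

lemma is_functor_middle_functor: "is_functor AA (Arr C) middle_functor"
  unfolding middle_functor_def
proof (rule is_functor_arrow_functor)
  show "is_functor AA C (comp_functor (Ev1 C) (comp_functor A corner_functor))"
    "is_functor AA C (comp_functor (Ev1 C) (comp_functor A codomain_functor))"
    using is_functor_comp_functor[OF is_functor_corner_functor is_functor_A]
      is_functor_comp_functor[OF is_functor_codomain_functor is_functor_A]
    by (auto intro: is_functor_comp_functor is_functor_Ev1)
next
  fix \<alpha> assume "\<alpha> \<in> Obj AA"
  then show "middle \<alpha> \<in> Hom C (FObj (comp_functor (Ev1 C) (comp_functor A corner_functor)) \<alpha>)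
      (FObj (comp_functor (Ev1 C) (comp_functor A codomain_functor)) \<alpha>)"
    by (cases \<alpha>) (simp add: Hom_iff corner_functor_def)
next
  fix \<sigma> assume "\<sigma> \<in> Mor AA"
  then show "FMor (comp_functor (Ev1 C) (comp_functor A codomain_functor)) \<sigma> \<cdot>\<^bsub>C\<^esub> middle (Dom AA \<sigma>) =
      middle (Cod AA \<sigma>) \<cdot>\<^bsub>C\<^esub> FMor (comp_functor (Ev1 C) (comp_functor A corner_functor)) \<sigma>"
  proof (cases \<sigma> rule: square_MorE)
    case (1 f g u v f' g' u' v' s0 s1 t0 t1 w0 w1 k)
    let ?c = "corner (f, g, u, v)" and ?c' = "corner (f', g', u', v')"
    have "w1 \<cdot>\<^bsub>C\<^esub> pr1 (FObj B v) g \<cdot>\<^bsub>C\<^esub> FObj B ?c = pr1 (FObj B v') g' \<cdot>\<^bsub>C\<^esub> k \<cdot>\<^bsub>C\<^esub> FObj B ?c"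
      using Comp_extend[of "pr1 (FObj B v') g'" k "w1 \<cdot>\<^bsub>C\<^esub> pr1 (FObj B v) g" "FObj B ?c"] 1(2-) by simp
    also have "\<dots> = pr1 (FObj B v') g' \<cdot>\<^bsub>C\<^esub> FObj B ?c' \<cdot>\<^bsub>C\<^esub> w0"
      \<comment> \<open>the square between the second factors of the corner maps\<close>
      using 1(22) by simp
    finally show ?thesis
      using 1 by (simp add: middle_def corner_functor_def)
  qed
qed

lemma left_square_Mor: "(f, g, u, v) \<in> Mor (Arr C) \<Longrightarrow> left_square (f, g, u, v) \<in> Mor (Arr C)"
  and right_square_Mor: "(f, g, u, v) \<in> Mor (Arr C) \<Longrightarrow> right_square (f, g, u, v) \<in> Mor (Arr C)"
  and right_left_square: "(f, g, u, v) \<in> Mor (Arr C) \<Longrightarrow>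
    right_square (f, g, u, v) \<cdot>\<^bsub>Arr C\<^esub> left_square (f, g, u, v) = (f, g, u, v)"
proof -
  assume \<alpha>: "(f, g, u, v) \<in> Mor (Arr C)"
  let ?c = "corner (f, g, u, v)"
  note [simp] = \<alpha>[simplified]
  have c: "FObj B ?c \<cdot>\<^bsub>C\<^esub> FObj A ?c = ?c"
    by simp
  have "FObj B v \<cdot>\<^bsub>C\<^esub> pr1 (FObj B v) g \<cdot>\<^bsub>C\<^esub> FObj B ?c = g \<cdot>\<^bsub>C\<^esub> pr2 (FObj B v) g \<cdot>\<^bsub>C\<^esub> FObj B ?c"
    using Comp_extend[of "FObj B v" "pr1 (FObj B v) g" "g \<cdot>\<^bsub>C\<^esub> pr2 (FObj B v) g" "FObj B ?c"] by simp
  then show "left_square (f, g, u, v) \<in> Mor (Arr C)" "right_square (f, g, u, v) \<in> Mor (Arr C)"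
    "right_square (f, g, u, v) \<cdot>\<^bsub>Arr C\<^esub> left_square (f, g, u, v) = (f, g, u, v)"
    by (simp_all add: left_square_def right_square_def) (simp_all add: middle_def)
qed

lemma left_square_Hom: "\<alpha> \<in> Mor (Arr C) \<Longrightarrow> left_square \<alpha> \<in> Hom (Arr C) (Dom (Arr C) \<alpha>) (middle \<alpha>)"
  and right_square_Hom: "\<alpha> \<in> Mor (Arr C) \<Longrightarrow> right_square \<alpha> \<in> Hom (Arr C) (middle \<alpha>) (Cod (Arr C) \<alpha>)"
  using left_square_Mor right_square_Mor
  by (cases \<alpha>; simp only: Hom_iff; simp add: left_square_def right_square_def; fail)+

lemma is_functor_left_functor: "is_functor AA AA left_functor"
  unfolding left_functor_def
proof (rule is_functor_arrow_functor[OF AA_functors(1) is_functor_middle_functor])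
  fix \<alpha> assume "\<alpha> \<in> Obj AA"
  then show "left_square \<alpha> \<in> Hom (Arr C) (FObj (Ev0 (Arr C)) \<alpha>) (FObj middle_functor \<alpha>)"
    using left_square_Hom by (simp add: middle_functor_def)
next
  fix \<sigma> assume "\<sigma> \<in> Mor AA"
  then show "FMor middle_functor \<sigma> \<cdot>\<^bsub>Arr C\<^esub> left_square (Dom AA \<sigma>) =
      left_square (Cod AA \<sigma>) \<cdot>\<^bsub>Arr C\<^esub> FMor (Ev0 (Arr C)) \<sigma>"
    by (cases \<sigma> rule: square_MorE)
      (simp_all add: middle_functor_def left_square_def corner_functor_def)
qed

lemma is_functor_right_functor: "is_functor AA AA right_functor"
  unfolding right_functor_def
proof (rule is_functor_arrow_functor[OF is_functor_middle_functor AA_functors(2)])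
  fix \<alpha> assume "\<alpha> \<in> Obj AA"
  then show "right_square \<alpha> \<in> Hom (Arr C) (FObj middle_functor \<alpha>) (FObj (Ev1 (Arr C)) \<alpha>)"
    using right_square_Hom by (simp add: middle_functor_def)
next
  fix \<sigma> assume "\<sigma> \<in> Mor AA"
  then show "FMor (Ev1 (Arr C)) \<sigma> \<cdot>\<^bsub>Arr C\<^esub> right_square (Dom AA \<sigma>) =
      right_square (Cod AA \<sigma>) \<cdot>\<^bsub>Arr C\<^esub> FMor middle_functor \<sigma>"
  proof (cases \<sigma> rule: square_MorE)
    case (1 f g u v f' g' u' v' s0 s1 t0 t1 w0 w1 k)
    let ?c = "corner (f, g, u, v)" and ?c' = "corner (f', g', u', v')"
    have "t0 \<cdot>\<^bsub>C\<^esub> pr2 (FObj B v) g \<cdot>\<^bsub>C\<^esub> FObj B ?c = pr2 (FObj B v') g' \<cdot>\<^bsub>C\<^esub> k \<cdot>\<^bsub>C\<^esub> FObj B ?c"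
      using Comp_extend[of "pr2 (FObj B v') g'" k "t0 \<cdot>\<^bsub>C\<^esub> pr2 (FObj B v) g" "FObj B ?c"] 1(2-) by simp
    also have "\<dots> = pr2 (FObj B v') g' \<cdot>\<^bsub>C\<^esub> FObj B ?c' \<cdot>\<^bsub>C\<^esub> w0"
      \<comment> \<open>the square between the second factors of the corner maps\<close>
      using 1(22) by simp
    finally show ?thesis
      using 1 by (simp add: middle_functor_def right_square_def corner_functor_def)
  qed
qed

lemma functorial_factorization_squares: "functorial_factorization (Arr C) left_functor right_functor"
  unfolding functorial_factorization_def
proof (intro conjI ballI)
  fix \<alpha> assume "\<alpha> \<in> Mor (Arr C)"
  then show "Dom (Arr C) (FObj left_functor \<alpha>) = Dom (Arr C) \<alpha>" "Cod (Arr C) (FObj right_functor \<alpha>) = Cod (Arr C) \<alpha>"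
    "Cod (Arr C) (FObj left_functor \<alpha>) = Dom (Arr C) (FObj right_functor \<alpha>)"
    "\<alpha> = FObj right_functor \<alpha> \<cdot>\<^bsub>Arr C\<^esub> FObj left_functor \<alpha>"
    using right_left_square left_square_Hom[of \<alpha>] right_square_Hom[of \<alpha>]
    by (simp_all add: left_functor_def right_functor_def Hom_iff, cases \<alpha>) metis
qed (use is_functor_left_functor is_functor_right_functor in
    \<open>simp_all add: left_functor_def right_functor_def\<close>)

lemma left_square_pointwise:
  assumes "\<alpha> \<in> Mor (Arr C)" "\<And>f. f \<in> Mor C \<Longrightarrow> FObj A f \<in> K"
  shows "FObj left_functor \<alpha> \<in> pointwise C K"
proof -
  obtain f g u v where \<alpha>: "\<alpha> = (f, g, u, v)"
    by (cases \<alpha>)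
  have Mor: "left_square (f, g, u, v) \<in> Mor (Arr C)"
    using assms(1) left_square_Mor by (simp only: \<alpha>)
  have eq: "left_square (f, g, u, v) = (f, middle (f, g, u, v), FObj A (corner (f, g, u, v)), FObj A v)"
    by (simp add: left_square_def)
  have "FObj A (corner (f, g, u, v)) \<in> K" "FObj A v \<in> K"
    using assms(1) by (auto simp: \<alpha> intro!: assms(2))
  then show ?thesis
    using Mor unfolding left_functor_def \<alpha> arrow_functor_simps eq pointwise_simp by blast
qed

lemma right_square_corner:
  assumes "\<alpha> \<in> Mor (Arr C)" "\<And>f. f \<in> Mor C \<Longrightarrow> FObj B f \<in> L"
  shows "has_corner_in C L (FObj right_functor \<alpha>)"
proof -
  obtain f g u v where \<alpha>: "\<alpha> = (f, g, u, v)"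
    by (cases \<alpha>)
  let ?c = "corner (f, g, u, v)"
  have Mor: "right_square (f, g, u, v) \<in> Mor (Arr C)"
    using assms(1) right_square_Mor by (simp only: \<alpha>)
  have corner: "is_corner C (right_square (f, g, u, v)) (pb (FObj B v) g) (pr1 (FObj B v) g) (pr2 (FObj B v) g) (FObj B ?c)"
    using assms(1) is_pullback_pb[of "FObj B v" g]
    by (simp add: right_square_def is_corner_def \<alpha> Hom_iff) (simp add: middle_def)
  then show ?thesis
    using assms Mor corner[unfolded right_square_def, simplified]
    unfolding has_corner_in_def by (intro exI conjI) (auto simp: right_functor_def right_square_def \<alpha>)
qed

end

text \<open>
  The second factor is controlled through its corner map and not pointwise, matching the shape of
  fibrations in \<open>RLP_pointwise_iff\<close>.
\<close>

lemma (in category) ex_square_factorization: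
  assumes pb: "\<And>f g. \<lbrakk>f \<in> Mor C; g \<in> Mor C; Cod C f = Cod C g\<rbrakk> \<Longrightarrow> \<exists>P p q. is_pullback C f g P p q"
    and fact: "functorial_factorization C A B"
    and A: "\<And>f. f \<in> Mor C \<Longrightarrow> FObj A f \<in> K" and B: "\<And>f. f \<in> Mor C \<Longrightarrow> FObj B f \<in> L"
  shows "\<exists>A' B'. functorial_factorization (Arr C) A' B' \<and>
    (\<forall>\<alpha> \<in> Mor (Arr C). FObj A' \<alpha> \<in> pointwise C K \<and> has_corner_in C L (FObj B' \<alpha>))"
proof -
  obtain P p q where "\<And>f g. \<lbrakk>f \<in> Mor C; g \<in> Mor C; Cod C f = Cod C g\<rbrakk> \<Longrightarrow> is_pullback C f g (P f g) (p f g) (q f g)"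
    using pb by metis
  then interpret square_factorization C P p q A B
    by unfold_locales (auto simp: fact)
  show ?thesis
    using functorial_factorization_squares left_square_pointwise[OF _ A] right_square_corner[OF _ B]
    by blast
qed


section \<open>The injective model structure\<close>

lemma (in is_functor) FMor_square:
  assumes "(f, g, u, v) \<in> Mor (Arr C)"
  shows "(FMor F f, FMor F g, FMor F u, FMor F v) \<in> Mor (Arr D)"
proof -
  have "FMor F v \<cdot>\<^bsub>D\<^esub> FMor F f = FMor F g \<cdot>\<^bsub>D\<^esub> FMor F u"
    using assms by (simp flip: FMor_Comp_simp)
  then show ?thesis
    using assms by simp
qed

lemma (in is_functor) is_retract_FMor:
  assumes "is_retract C f g"
  shows "is_retract D (FMor F f) (FMor F g)"
proof -
  obtain s0 s1 t0 t1 where s: "(f, g, s0, s1) \<in> Mor (Arr C)" and t: "(g, f, t0, t1) \<in> Mor (Arr C)"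
    and id: "t0 \<cdot>\<^bsub>C\<^esub> s0 = Ident C (Dom C f)" "t1 \<cdot>\<^bsub>C\<^esub> s1 = Ident C (Cod C f)"
    using assms by (rule is_retractE)
  show ?thesis
    by (rule is_retractI[OF FMor_square[OF s] FMor_square[OF t]])
      (use s t id in \<open>simp_all flip: FMor_Comp_simp\<close>)
qed

context category
begin

lemma subcategory_pointwise:
  assumes "subcategory C K"
  shows "subcategory (Arr C) (pointwise C K)"
proof -
  interpret A: category "Arr C" by (rule Arr_category)
  have id: "Ident C (Dom C f) \<in> K" "Ident C (Cod C f) \<in> K" if "f \<in> K" for f
    using assms that by (auto simp: subcategory_def)
  have comp: "g \<cdot>\<^bsub>C\<^esub> f \<in> K" if "f \<in> K" "g \<in> K" "Cod C f = Dom C g" for f g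
    using assms that by (auto simp: subcategory_def)
  have "Ident (Arr C) (Dom (Arr C) \<alpha>) \<in> pointwise C K" "Ident (Arr C) (Cod (Arr C) \<alpha>) \<in> pointwise C K"
    if "\<alpha> \<in> pointwise C K" for \<alpha>
    using that by (cases \<alpha>; auto dest: id)+
  moreover have "\<beta> \<cdot>\<^bsub>Arr C\<^esub> \<alpha> \<in> pointwise C K"
    if "\<alpha> \<in> pointwise C K" "\<beta> \<in> pointwise C K" "Cod (Arr C) \<alpha> = Dom (Arr C) \<beta>" for \<alpha> \<beta>
  proof -
    have "\<beta> \<cdot>\<^bsub>Arr C\<^esub> \<alpha> \<in> Mor (Arr C)"
      using that by (simp add: pointwise_def)
    then show ?thesis
      using that by (cases \<alpha>; cases \<beta>) (auto intro: comp)
  qed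
  ultimately show ?thesis
    by (auto simp: subcategory_def pointwise_def)
qed

lemma retract_pointwise:
  assumes K: "\<And>f g. is_retract C f g \<Longrightarrow> g \<in> K \<Longrightarrow> f \<in> K"
    and "is_retract (Arr C) \<alpha> \<beta>" "\<beta> \<in> pointwise C K"
  shows "\<alpha> \<in> pointwise C K"
  using assms(3) is_functor.is_retract_FMor[OF is_functor_Ev0 assms(2)]
    is_functor.is_retract_FMor[OF is_functor_Ev1 assms(2)] assms(2)
  by (auto simp: pointwise_def is_retract_def[of "Arr C"] intro: K)

lemma subcategory_RLP: "subcategory C (RLP C K)"
  using RLP_Ident RLP_Comp unfolding subcategory_def by (auto simp: RLP_def)

end

lemma pointwise_Int: "pointwise C K \<inter> pointwise C L = pointwise C (K \<inter> L)"
  by (auto simp: pointwise_def)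

text \<open>
  Pullbacks are needed for corner maps, and an initial object for the test squares \<open>L1 i\<close>.
\<close>

locale injective_setting = model_structure +
  assumes ex_pullback: "\<lbrakk>f \<in> Mor C; g \<in> Mor C; Cod C f = Cod C g\<rbrakk> \<Longrightarrow> \<exists>P p q. is_pullback C f g P p q"
    and ex_initial: "\<exists>Z. initial C Z"
begin

lemma ex_corner:
  assumes "(f, g, u, v) \<in> Mor (Arr C)"
  obtains P p q h where "is_corner C (f, g, u, v) P p q h"
proof -
  obtain P p q where "is_pullback C v g P p q"
    using ex_pullback[of v g] assms by auto
  then show ?thesis
    using is_corner_ex[OF assms] that by metis
qed

lemma cof_tcof_subset_Mor: "cof M \<subseteq> Mor C" "tcof M \<subseteq> Mor C"
  using cof_Mor tcof_subset by blast+

lemma RLP_tcof_iff: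
  assumes "(f, g, u, v) \<in> Mor (Arr C)" "is_corner C (f, g, u, v) P p q h"
  shows "(f, g, u, v) \<in> RLP (Arr C) (pointwise C (tcof M)) \<longleftrightarrow> v \<in> fib M \<and> h \<in> fib M"
proof -
  obtain Z where "initial C Z"
    using ex_initial by blast
  then show ?thesis
    using RLP_pointwise_iff[OF _ _ _ assms, of Z "tcof M"] Ident_tcof cof_tcof_subset_Mor
    by (auto simp: fib_eq_RLP)
qed

lemma RLP_cof_iff:
  assumes "(f, g, u, v) \<in> Mor (Arr C)" "is_corner C (f, g, u, v) P p q h"
  shows "(f, g, u, v) \<in> RLP (Arr C) (pointwise C (cof M)) \<longleftrightarrow> v \<in> tfib M \<and> h \<in> tfib M"
proof -
  obtain Z where "initial C Z"
    using ex_initial by blast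
  then show ?thesis
    using RLP_pointwise_iff[OF _ _ _ assms, of Z "cof M"] Ident_cof cof_tcof_subset_Mor
    by (auto simp: tfib_eq_RLP)
qed

text \<open>
  The domain component is the corner map followed by a pullback \<open>q\<close> of the codomain component.
  If the latter is a trivial fibration, so is \<open>q\<close>, and by two out of three the corner map is a weak
  equivalence exactly if the domain component is.
\<close>

lemma fibration_weq_iff:
  assumes \<alpha>: "(f, g, u, v) \<in> Mor (Arr C)" and corner: "is_corner C (f, g, u, v) P p q h"
  shows "(f, g, u, v) \<in> RLP (Arr C) (pointwise C (tcof M)) \<inter> pointwise C (weq M) \<longleftrightarrow> v \<in> tfib M \<and> h \<in> tfib M"
proof -
  have pb: "is_pullback C v g P p q" and h: "h \<in> Hom C (Dom C f) P" "q \<cdot>\<^bsub>C\<^esub> h = u"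
    using corner by (simp_all add: is_corner_def)
  have q: "q \<in> Hom C P (Dom C g)"
    using is_pullback_simps[OF pb] by (simp add: Hom_iff)
  have "u \<in> weq M \<longleftrightarrow> h \<in> weq M" if "v \<in> tfib M"
  proof -
    have "q \<in> tfib M"
      using RLP_pullback[OF pb, of "cof M"] that by (simp add: tfib_eq_RLP)
    then have "q \<in> weq M"
      by (simp add: tfib_def)
    then show ?thesis
      using two_out_of_three(1,3)[OF h(1) q] h(2) by metis
  qed
  then show ?thesis
    using RLP_tcof_iff[OF \<alpha> corner] \<alpha> by (auto simp: tfib_def)
qed

text \<open>
  Both classes have the same description in terms of codomain components and corner maps. The equation
  is one of the lifting axioms, and it is the reason why the second factor in the factorization into a
  cofibration and a trivial fibration is indeed a trivial fibration.
\<close>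

lemma RLP_cof_eq:
  "RLP (Arr C) (pointwise C (cof M)) = RLP (Arr C) (pointwise C (tcof M)) \<inter> pointwise C (weq M)"
proof (rule set_eqI)
  fix \<alpha>
  show "\<alpha> \<in> RLP (Arr C) (pointwise C (cof M)) \<longleftrightarrow>
      \<alpha> \<in> RLP (Arr C) (pointwise C (tcof M)) \<inter> pointwise C (weq M)"
  proof (cases "\<alpha> \<in> Mor (Arr C)")
    case True
    obtain f g u v where \<alpha>: "\<alpha> = (f, g, u, v)"
      by (cases \<alpha>)
    obtain P p q h where "is_corner C (f, g, u, v) P p q h"
      using ex_corner True unfolding \<alpha> by blast
    then show ?thesis
      using RLP_cof_iff fibration_weq_iff True unfolding \<alpha> by blast
  qed (simp add: RLP_def)
qed

text \<open>
  With fibrations defined by their lifting property, one lifting axiom holds by definition, and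
  composites and retracts of fibrations are fibrations. The other lifting axiom is \<open>RLP_cof_eq\<close>.
\<close>

lemma ex_injective_model_structure:
  obtains I where "model_structure (Arr C) I" "weq I = pointwise C (weq M)"
    "cof I = pointwise C (cof M)" "fib I = RLP (Arr C) (pointwise C (tcof M))"
proof -
  interpret A: category "Arr C" by (rule Arr_category)
  have "\<exists>a b. functorial_factorization (Arr C) a b \<and>
      (\<forall>\<alpha> \<in> Mor (Arr C). FObj a \<alpha> \<in> pointwise C (cof M) \<and> has_corner_in C (tfib M) (FObj b \<alpha>))"
    by (rule ex_square_factorization[OF ex_pullback factorization_cof_tfib fact_cof fact_tfib])
  then obtain a b where ab: "functorial_factorization (Arr C) a b"
    "\<And>\<alpha>. \<alpha> \<in> Mor (Arr C) \<Longrightarrow> FObj a \<alpha> \<in> pointwise C (cof M)"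
    "\<And>\<alpha>. \<alpha> \<in> Mor (Arr C) \<Longrightarrow> has_corner_in C (tfib M) (FObj b \<alpha>)"
    by blast
  have "\<exists>c d. functorial_factorization (Arr C) c d \<and>
      (\<forall>\<alpha> \<in> Mor (Arr C). FObj c \<alpha> \<in> pointwise C (tcof M) \<and> has_corner_in C (fib M) (FObj d \<alpha>))"
    by (rule ex_square_factorization[OF ex_pullback factorization_tcof_fib fact_tcof fact_fib])
  then obtain c d where cd: "functorial_factorization (Arr C) c d"
    "\<And>\<alpha>. \<alpha> \<in> Mor (Arr C) \<Longrightarrow> FObj c \<alpha> \<in> pointwise C (tcof M)"
    "\<And>\<alpha>. \<alpha> \<in> Mor (Arr C) \<Longrightarrow> has_corner_in C (fib M) (FObj d \<alpha>)"
    by blast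
  define I where "I = \<lparr>weq = pointwise C (weq M), cof = pointwise C (cof M),
    fib = RLP (Arr C) (pointwise C (tcof M)), fact_cof = a, fact_tfib = b, fact_tcof = c, fact_fib = d\<rparr>"
  have tcof_I: "tcof I = pointwise C (tcof M)"
    by (auto simp: tcof_def I_def pointwise_Int[symmetric])
  have tfib_I: "tfib I = RLP (Arr C) (pointwise C (cof M))"
    by (simp add: tfib_def I_def RLP_cof_eq)
  have "model_structure (Arr C) I"
  proof (unfold_locales, goal_cases)
    case (6 \<alpha> X Y \<beta> Z)
    then show ?case
      using subcategory_pointwise[OF weq_subcategory] by (simp add: subcategory_def I_def Hom_iff)
  next
    case (7 \<alpha> X Y \<beta> Z)
    obtain u v u' v' where \<alpha>: "\<alpha> = (X, Y, u, v)" and \<beta>: "\<beta> = (Y, Z, u', v')"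
      using 7 by (cases \<alpha>; cases \<beta>) (auto simp: Hom_iff)
    show ?case
      using 7 two_out_of_three(2)[of u _ _ u'] two_out_of_three(2)[of v _ _ v'] unfolding \<alpha> \<beta>
      by (simp add: I_def Hom_iff)
  next
    case (8 \<alpha> X Y \<beta> Z)
    obtain u v u' v' where \<alpha>: "\<alpha> = (X, Y, u, v)" and \<beta>: "\<beta> = (Y, Z, u', v')"
      using 8 by (cases \<alpha>; cases \<beta>) (auto simp: Hom_iff)
    show ?case
      using 8 two_out_of_three(3)[of u _ _ u'] two_out_of_three(3)[of v _ _ v'] unfolding \<alpha> \<beta>
      by (simp add: I_def Hom_iff)
  next
    case (9 \<alpha> \<beta>)
    then show ?case
      using retract_pointwise[OF retract_weq] by (simp add: I_def)
  next
    case (10 \<alpha> \<beta>)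
    then show ?case
      using retract_pointwise[OF retract_cof] by (simp add: I_def)
  next
    case (11 \<alpha> \<beta>)
    then show ?case
      using A.RLP_retract by (simp add: I_def)
  next
    case (12 i p)
    then show ?case
      unfolding tcof_I by (simp add: I_def RLP_def)
  next
    case (13 i p)
    then show ?case
      unfolding tfib_I by (simp add: I_def RLP_def)
  next
    case (15 \<alpha>)
    then show ?case
      unfolding tfib_I using ab(3)[OF 15] RLP_cof_iff by (auto simp: I_def has_corner_in_def)
  next
    case (17 \<alpha>)
    then show ?case
      using cd(3)[OF 17] RLP_tcof_iff by (auto simp: I_def has_corner_in_def)
  qed (use subcategory_pointwise[OF weq_subcategory] subcategory_pointwise[OF cof_subcategory]
      A.subcategory_RLP ab cd tcof_I in \<open>simp_all add: I_def\<close>)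
  then show ?thesis
    using that by (simp add: I_def)
qed

end

locale injective_model_structure = injective_setting C M + I: model_structure "Arr C" I
  for C :: "('o, 'a) category" and M I +
  assumes weq_I: "weq I = pointwise C (weq M)" and cof_I: "cof I = pointwise C (cof M)"
    and fib_I: "fib I = RLP (Arr C) (pointwise C (tcof M))"
begin

lemma tcof_I: "tcof I = pointwise C (tcof M)"
  by (simp add: tcof_def weq_I cof_I pointwise_Int)

lemma fib_I_iff:
  assumes "(f, g, u, v) \<in> Mor (Arr C)" "is_corner C (f, g, u, v) P p q h"
  shows "(f, g, u, v) \<in> fib I \<longleftrightarrow> v \<in> fib M \<and> h \<in> fib M"
    and "(f, g, u, v) \<in> tfib I \<longleftrightarrow> v \<in> tfib M \<and> h \<in> tfib M"
  using RLP_tcof_iff[OF assms] fibration_weq_iff[OF assms] by (simp_all add: tfib_def fib_I weq_I)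

lemma fib_I_components:
  assumes "(f, g, u, v) \<in> fib I"
  shows "u \<in> fib M" "v \<in> fib M"
proof -
  have \<alpha>: "(f, g, u, v) \<in> Mor (Arr C)"
    using assms by (rule I.fib_Mor)
  then obtain P p q h where corner: "is_corner C (f, g, u, v) P p q h"
    by (rule ex_corner)
  then have *: "v \<in> fib M" "h \<in> fib M"
    using fib_I_iff[OF \<alpha>] assms by blast+
  have pb: "is_pullback C v g P p q" and h: "Cod C h = Dom C q" "q \<cdot>\<^bsub>C\<^esub> h = u"
    using corner is_pullback_simps[of C v g P p q] by (auto simp: is_corner_def Hom_iff)
  have "q \<in> fib M"
    using RLP_pullback[OF pb] *(1) by (simp add: fib_eq_RLP)
  then show "u \<in> fib M" "v \<in> fib M"
    using RLP_Comp[of h "tcof M" q] h * by (simp_all add: fib_eq_RLP)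
qed

end


section \<open>Adjunctions\<close>

context category
begin

lemma L0_simps [simp]:
  "FObj (L0 C) = Ident C" "FMor (L0 C) u = (Ident C (Dom C u), Ident C (Cod C u), u, u)"
  by (simp_all add: L0_def)

lemma is_functor_L0: "is_functor C (Arr C) (L0 C)"
  by (rule is_functorI) (auto simp: category_axioms Arr_category)

lemma left_adjoint_L0: "left_adjoint C (Arr C) (L0 C)"
  unfolding left_adjoint_def
proof (intro conjI exI[of _ "Ev0 C"] exI[of _ "\<lambda>X g. FMor (Ev0 C)"] ballI allI impI)
  fix X g assume "X \<in> Obj C" "g \<in> Obj (Arr C)"
  then show "bij_betw (FMor (Ev0 C)) (Hom (Arr C) (FObj (L0 C) X) g) (Hom C X (FObj (Ev0 C) g))"
    by (intro bij_betw_byWitness[where f' = "\<lambda>u. (Ident C X, g, u, g \<cdot>\<^bsub>C\<^esub> u)"]) (auto simp: Hom_iff)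
next
  fix X' X g g' a b \<alpha>
  assume "a \<in> Hom C X' X \<and> b \<in> Hom (Arr C) g g' \<and> \<alpha> \<in> Hom (Arr C) (FObj (L0 C) X) g"
  then show "FMor (Ev0 C) (b \<cdot>\<^bsub>Arr C\<^esub> \<alpha> \<cdot>\<^bsub>Arr C\<^esub> FMor (L0 C) a) = FMor (Ev0 C) b \<cdot>\<^bsub>C\<^esub> FMor (Ev0 C) \<alpha> \<cdot>\<^bsub>C\<^esub> a"
    by (cases b; cases \<alpha>) simp
qed (simp_all add: is_functor_L0 is_functor_Ev0)

text \<open>The functor \<open>L0\<close> is also the right adjoint \<open>U1\<close> of \<open>Ev1\<close>.\<close>

lemma left_adjoint_Ev1: "left_adjoint (Arr C) C (Ev1 C)"
  unfolding left_adjoint_def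
proof (intro conjI exI[of _ "L0 C"] exI[of _ "\<lambda>f Y v. (f, Ident C Y, v \<cdot>\<^bsub>C\<^esub> f, v)"] ballI allI impI)
  fix f Y assume "f \<in> Obj (Arr C)" "Y \<in> Obj C"
  then show "bij_betw (\<lambda>v. (f, Ident C Y, v \<cdot>\<^bsub>C\<^esub> f, v)) (Hom C (FObj (Ev1 C) f) Y) (Hom (Arr C) f (FObj (L0 C) Y))"
    by (intro bij_betw_byWitness[where f' = "FMor (Ev1 C)"]) (auto simp: Hom_iff)
next
  fix f' f Y Y' \<alpha> b v
  assume *: "\<alpha> \<in> Hom (Arr C) f' f \<and> b \<in> Hom C Y Y' \<and> v \<in> Hom C (FObj (Ev1 C) f) Y"
  then obtain s t where "\<alpha> = (f', f, s, t)"
    by (cases \<alpha>) (auto simp: Hom_iff)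
  with * show "(f', Ident C Y', (b \<cdot>\<^bsub>C\<^esub> v \<cdot>\<^bsub>C\<^esub> FMor (Ev1 C) \<alpha>) \<cdot>\<^bsub>C\<^esub> f', b \<cdot>\<^bsub>C\<^esub> v \<cdot>\<^bsub>C\<^esub> FMor (Ev1 C) \<alpha>) =
      FMor (L0 C) b \<cdot>\<^bsub>Arr C\<^esub> (f, Ident C Y, v \<cdot>\<^bsub>C\<^esub> f, v) \<cdot>\<^bsub>Arr C\<^esub> \<alpha>"
    by (auto simp: Hom_iff)
qed (simp_all add: is_functor_L0 is_functor_Ev1)

lemma L1_simps [simp]:
  "FObj (L1 C Z) = from_initial C Z"
  "FMor (L1 C Z) u = (from_initial C Z (Dom C u), from_initial C Z (Cod C u), Ident C Z, u)"
  by (simp_all add: L1_def)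

lemma from_initial_Comp:
  assumes "initial C Z" "u \<in> Mor C" "Dom C u = X"
  shows "u \<cdot>\<^bsub>C\<^esub> from_initial C Z X = from_initial C Z (Cod C u)"
  by (rule initial_eq[OF assms(1)]) (use assms Dom_Obj[of u] in auto)

lemma is_functor_L1:
  assumes "initial C Z"
  shows "is_functor C (Arr C) (L1 C Z)"
  by (rule is_functorI) (use assms in \<open>simp_all add: category_axioms Arr_category initial_Obj from_initial_Comp\<close>)

lemma left_adjoint_L1:
  assumes Z: "initial C Z"
  shows "left_adjoint C (Arr C) (L1 C Z)"
  unfolding left_adjoint_def
proof (intro conjI exI[of _ "Ev1 C"] exI[of _ "\<lambda>X g. FMor (Ev1 C)"] ballI allI impI)
  fix X g assume Xg: "X \<in> Obj C" "g \<in> Obj (Arr C)"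
  have u: "u = from_initial C Z (Dom C g)" if "u \<in> Mor C" "Dom C u = Z" "Cod C u = Dom C g" for u
    by (rule initial_eq[OF Z]) (use Z Xg that in auto)
  show "bij_betw (FMor (Ev1 C)) (Hom (Arr C) (FObj (L1 C Z) X) g) (Hom C X (FObj (Ev1 C) g))"
    by (intro bij_betw_byWitness[where f' = "\<lambda>v. (from_initial C Z X, g, from_initial C Z (Dom C g), v)"])
      (use Xg Z in \<open>auto simp: Hom_iff from_initial_Comp dest: u\<close>)
next
  fix X' X g g' a b \<alpha>
  assume "a \<in> Hom C X' X \<and> b \<in> Hom (Arr C) g g' \<and> \<alpha> \<in> Hom (Arr C) (FObj (L1 C Z) X) g"
  then show "FMor (Ev1 C) (b \<cdot>\<^bsub>Arr C\<^esub> \<alpha> \<cdot>\<^bsub>Arr C\<^esub> FMor (L1 C Z) a) = FMor (Ev1 C) b \<cdot>\<^bsub>C\<^esub> FMor (Ev1 C) \<alpha> \<cdot>\<^bsub>C\<^esub> a"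
    by (cases b; cases \<alpha>) simp
qed (simp_all add: is_functor_L1[OF Z] is_functor_Ev1)

end

text \<open>
  The right adjoint of \<open>Ev0\<close>. It depends on the choice of a terminal object \<open>Z\<close>, and
  \<open>from_initial (opp C) Z X\<close> is the unique map \<open>X \<rightarrow> Z\<close>.
\<close>

definition U0 :: "('o, 'a) category \<Rightarrow> 'o \<Rightarrow> ('o, 'a, 'a, 'a square) cfunctor" where
  "U0 C Z = \<lparr>FObj = from_initial (opp C) Z,
    FMor = (\<lambda>u. (from_initial (opp C) Z (Dom C u), from_initial (opp C) Z (Cod C u), u, Ident C Z))\<rparr>"

lemma U0_simps [simp]:
  "FObj (U0 C Z) = from_initial (opp C) Z"
  "FMor (U0 C Z) u = (from_initial (opp C) Z (Dom C u), from_initial (opp C) Z (Cod C u), u, Ident C Z)"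
  by (simp_all add: U0_def)

context category
begin

lemma left_adjoint_Ev0:
  assumes Z: "terminal C Z"
  shows "left_adjoint (Arr C) C (Ev0 C)"
proof -
  let ?t = "from_initial (opp C) Z"
  have Z': "initial (opp C) Z"
    using Z by (simp add: initial_opp)
  have [simp]: "Z \<in> Obj C"
    using Z by (simp add: terminal_def)
  have t [simp]: "?t X \<in> Mor C" "Dom C (?t X) = X" "Cod C (?t X) = Z" if "X \<in> Obj C" for X
    using category.from_initial_simps[OF category_opp[OF category_axioms] Z'] that by simp_all
  have t_Comp [simp]: "?t Y \<cdot>\<^bsub>C\<^esub> u = ?t (Dom C u)" if "u \<in> Mor C" "Cod C u = Y" for u Y
    by (rule terminal_eq[OF Z]) (use that Cod_Obj[of u] in auto)
  have t_Z [simp]: "?t Z = Ident C Z"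
    by (rule terminal_eq[OF Z]) auto
  have is_functor_U0: "is_functor C (Arr C) (U0 C Z)"
    by (rule is_functorI) (auto simp: category_axioms Arr_category)
  show ?thesis
    unfolding left_adjoint_def
  proof (intro conjI exI[of _ "U0 C Z"] exI[of _ "\<lambda>f Y u. (f, ?t Y, u, ?t (Cod C f))"] ballI allI impI)
    fix f Y assume fY: "f \<in> Obj (Arr C)" "Y \<in> Obj C"
    have v: "v = ?t (Cod C f)" if "v \<in> Mor C" "Cod C v = Z" "Dom C v = Cod C f" for v
      by (rule terminal_eq[OF Z]) (use that fY in auto)
    show "bij_betw (\<lambda>u. (f, ?t Y, u, ?t (Cod C f))) (Hom C (FObj (Ev0 C) f) Y) (Hom (Arr C) f (FObj (U0 C Z) Y))"
      by (intro bij_betw_byWitness[where f' = "FMor (Ev0 C)"]) (use fY in \<open>auto simp: Hom_iff dest: v\<close>)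
  next
    fix f' f Y Y' \<alpha> b u
    assume *: "\<alpha> \<in> Hom (Arr C) f' f \<and> b \<in> Hom C Y Y' \<and> u \<in> Hom C (FObj (Ev0 C) f) Y"
    then obtain s t where "\<alpha> = (f', f, s, t)"
      by (cases \<alpha>) (auto simp: Hom_iff)
    with * show "(f', ?t Y', b \<cdot>\<^bsub>C\<^esub> u \<cdot>\<^bsub>C\<^esub> FMor (Ev0 C) \<alpha>, ?t (Cod C f')) =
        FMor (U0 C Z) b \<cdot>\<^bsub>Arr C\<^esub> (f, ?t Y, u, ?t (Cod C f)) \<cdot>\<^bsub>Arr C\<^esub> \<alpha>"
      by (auto simp: Hom_iff)
  qed (simp_all add: is_functor_U0 is_functor_Ev0)
qed

end

lemma left_adjoint_initial:
  assumes "left_adjoint C D F" "initial C Z"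
  shows "initial D (FObj F Z)"
proof -
  obtain G :: "('c, 'd, 'a, 'b) cfunctor" and \<phi> where G: "is_functor D C G"
    and bij: "\<And>X Y. X \<in> Obj C \<Longrightarrow> Y \<in> Obj D \<Longrightarrow> bij_betw (\<phi> X Y) (Hom D (FObj F X) Y) (Hom C X (FObj G Y))"
    and F: "is_functor C D F"
    using assms(1) unfolding left_adjoint_def by blast
  have Z: "Z \<in> Obj C" and Z1: "\<And>X. X \<in> Obj C \<Longrightarrow> \<exists>!f. f \<in> Hom C Z X"
    using assms(2) by (simp_all add: initial_def)
  show ?thesis
    unfolding initial_def
  proof (intro conjI ballI)
    show "FObj F Z \<in> Obj D"
      by (rule is_functor.FObj_Obj[OF F Z])
    fix Y assume Y: "Y \<in> Obj D"
    obtain y where "Hom C Z (FObj G Y) = {y}"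
      using Z1[OF is_functor.FObj_Obj[OF G Y]] by blast
    then have "card (Hom D (FObj F Z) Y) = 1"
      using bij_betw_same_card[OF bij[OF Z Y]] by simp
    then show "\<exists>!f. f \<in> Hom D (FObj F Z) Y"
      by (metis card_1_singletonE singletonD singletonI)
  qed
qed

lemma is_pushout_iff:
  "is_pushout C f g P i j \<longleftrightarrow> f \<in> Mor C \<and> g \<in> Mor C \<and> Dom C f = Dom C g \<and>
    i \<in> Hom C (Cod C f) P \<and> j \<in> Hom C (Cod C g) P \<and> i \<cdot>\<^bsub>C\<^esub> f = j \<cdot>\<^bsub>C\<^esub> g \<and>
    (\<forall>W a b. a \<in> Hom C (Cod C f) W \<and> b \<in> Hom C (Cod C g) W \<and> a \<cdot>\<^bsub>C\<^esub> f = b \<cdot>\<^bsub>C\<^esub> g \<longrightarrow>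
      (\<exists>!h. h \<in> Hom C P W \<and> h \<cdot>\<^bsub>C\<^esub> i = a \<and> h \<cdot>\<^bsub>C\<^esub> j = b))"
  by (simp add: is_pushout_def is_pullback_def)

text \<open>
  The adjunction turns a cocone with vertex \<open>W\<close> under the image of a span into a cocone with vertex
  \<open>G W\<close> under the span itself, compatibly with induced maps.
\<close>

lemma left_adjoint_pushout:
  assumes "left_adjoint C D F" and po: "is_pushout C f g P i j"
  shows "is_pushout D (FMor F f) (FMor F g) (FObj F P) (FMor F i) (FMor F j)"
proof -
  obtain G :: "('c, 'd, 'a, 'b) cfunctor" and \<phi> where G: "is_functor D C G" and F: "is_functor C D F"
    and bij: "\<And>X Y. X \<in> Obj C \<Longrightarrow> Y \<in> Obj D \<Longrightarrow> bij_betw (\<phi> X Y) (Hom D (FObj F X) Y) (Hom C X (FObj G Y))"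
    and natural: "\<And>X' X Y Y' a b f. a \<in> Hom C X' X \<Longrightarrow> b \<in> Hom D Y Y' \<Longrightarrow> f \<in> Hom D (FObj F X) Y \<Longrightarrow>
        \<phi> X' Y' (b \<cdot>\<^bsub>D\<^esub> f \<cdot>\<^bsub>D\<^esub> FMor F a) = FMor G b \<cdot>\<^bsub>C\<^esub> \<phi> X Y f \<cdot>\<^bsub>C\<^esub> a"
    using assms(1) unfolding left_adjoint_def by blast
  interpret F: is_functor C D F by fact
  interpret G: is_functor D C G by fact
  have \<phi>_Hom: "\<phi> X Y a \<in> Hom C X (FObj G Y)" if "a \<in> Hom D (FObj F X) Y" "X \<in> Obj C" "Y \<in> Obj D" for X Y a
    using bij that by (meson bij_betwE)
  have natural1: "\<phi> X' Y (a \<cdot>\<^bsub>D\<^esub> FMor F x) = \<phi> X Y a \<cdot>\<^bsub>C\<^esub> x"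
    if "x \<in> Hom C X' X" "a \<in> Hom D (FObj F X) Y" for X' X Y x a
  proof -
    have "X \<in> Obj C" "Y \<in> Obj D" "X' \<in> Obj C"
      using that F.D.Cod_Obj F.C.Cod_Obj F.C.Dom_Obj by (auto simp: Hom_iff)
    then show ?thesis
      using natural[of x X' X "Ident D Y" Y Y a] that \<phi>_Hom[of a X Y] by (simp add: Hom_iff)
  qed
  have fg: "f \<in> Mor C" "g \<in> Mor C" "Dom C f = Dom C g" and i: "i \<in> Hom C (Cod C f) P" and j: "j \<in> Hom C (Cod C g) P"
    and comm: "i \<cdot>\<^bsub>C\<^esub> f = j \<cdot>\<^bsub>C\<^esub> g"
    using po by (simp_all add: is_pushout_iff)
  have P: "P \<in> Obj C"
    using F.C.Cod_Obj i by (auto simp: Hom_iff)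
  show ?thesis
    unfolding is_pushout_iff
  proof (intro conjI allI impI)
    show "FMor F i \<cdot>\<^bsub>D\<^esub> FMor F f = FMor F j \<cdot>\<^bsub>D\<^esub> FMor F g"
      using fg i j comm by (simp add: Hom_iff flip: F.FMor_Comp_simp)
  next
    fix W a b
    assume ab: "a \<in> Hom D (Cod D (FMor F f)) W \<and> b \<in> Hom D (Cod D (FMor F g)) W \<and>
      a \<cdot>\<^bsub>D\<^esub> FMor F f = b \<cdot>\<^bsub>D\<^esub> FMor F g"
    have a: "a \<in> Hom D (FObj F (Cod C f)) W" and b: "b \<in> Hom D (FObj F (Cod C g)) W"
      using ab fg by simp_all
    have W: "W \<in> Obj D"
      using a F.D.Cod_Obj by (auto simp: Hom_iff)
    have "\<phi> (Cod C f) W a \<cdot>\<^bsub>C\<^esub> f = \<phi> (Cod C g) W b \<cdot>\<^bsub>C\<^esub> g"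
      using natural1[of f "Dom C f" "Cod C f" a W] natural1[of g "Dom C f" "Cod C g" b W] a b ab fg
      by (simp add: Hom_iff)
    then have ex1: "\<exists>!k. k \<in> Hom C P (FObj G W) \<and> k \<cdot>\<^bsub>C\<^esub> i = \<phi> (Cod C f) W a \<and> k \<cdot>\<^bsub>C\<^esub> j = \<phi> (Cod C g) W b"
      using po \<phi>_Hom[OF a] \<phi>_Hom[OF b] fg W unfolding is_pushout_iff by simp
    have inj: "x = y" if "\<phi> X W x = \<phi> X W y" "x \<in> Hom D (FObj F X) W" "y \<in> Hom D (FObj F X) W" "X \<in> Obj C" for x y X
      using bij[of X W] W that unfolding bij_betw_def inj_on_def by blast
    have iff: "h \<cdot>\<^bsub>D\<^esub> FMor F i = a \<and> h \<cdot>\<^bsub>D\<^esub> FMor F j = b \<longleftrightarrow>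
        \<phi> P W h \<cdot>\<^bsub>C\<^esub> i = \<phi> (Cod C f) W a \<and> \<phi> P W h \<cdot>\<^bsub>C\<^esub> j = \<phi> (Cod C g) W b"
      if h: "h \<in> Hom D (FObj F P) W" for h
    proof -
      have "h \<cdot>\<^bsub>D\<^esub> FMor F i \<in> Hom D (FObj F (Cod C f)) W" "h \<cdot>\<^bsub>D\<^esub> FMor F j \<in> Hom D (FObj F (Cod C g)) W"
        using h i j by (simp_all add: Hom_iff)
      then show ?thesis
        using inj a b fg natural1[OF i h] natural1[OF j h] F.C.Cod_Obj by metis
    qed
    obtain k where k: "k \<in> Hom C P (FObj G W)" "k \<cdot>\<^bsub>C\<^esub> i = \<phi> (Cod C f) W a" "k \<cdot>\<^bsub>C\<^esub> j = \<phi> (Cod C g) W b"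
      using ex1 by blast
    obtain h where h: "h \<in> Hom D (FObj F P) W" "\<phi> P W h = k"
      using bij[OF P W] k(1) unfolding bij_betw_def by (metis imageE)
    show "\<exists>!h. h \<in> Hom D (FObj F P) W \<and> h \<cdot>\<^bsub>D\<^esub> FMor F i = a \<and> h \<cdot>\<^bsub>D\<^esub> FMor F j = b"
    proof (rule ex1I[of _ h])
      fix h' assume h': "h' \<in> Hom D (FObj F P) W \<and> h' \<cdot>\<^bsub>D\<^esub> FMor F i = a \<and> h' \<cdot>\<^bsub>D\<^esub> FMor F j = b"
      then have "\<phi> P W h' = k"
        using iff[of h'] ex1 k \<phi>_Hom[of h' P W] P W by blast
      then show "h' = h"
        using h h' inj P by blast
    qed (use iff[of h] h k in simp)
  qed (use fg i j in \<open>simp_all add: Hom_iff\<close>)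
qed

context injective_model_structure
begin

lemma left_Quillen_L0: "left_Quillen C M (Arr C) I (L0 C)"
  unfolding left_Quillen_def cof_I tcof_I
  using left_adjoint_L0 cof_tcof_subset_Mor by auto

lemma left_Quillen_L1: "initial C Z \<Longrightarrow> left_Quillen C M (Arr C) I (L1 C Z)"
  unfolding left_Quillen_def cof_I tcof_I
  using left_adjoint_L1 is_functor.FMor_simps(1)[OF is_functor_L1[of Z]] cof_tcof_subset_Mor
    Ident_cof Ident_tcof initial_Obj
  by (auto simp: pointwise_def)

lemma left_Quillen_Ev0: "terminal C Z \<Longrightarrow> left_Quillen (Arr C) I C M (Ev0 C)"
  unfolding left_Quillen_def cof_I tcof_I using left_adjoint_Ev0 by (auto simp: pointwise_def)

lemma left_Quillen_Ev1: "left_Quillen (Arr C) I C M (Ev1 C)"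
  unfolding left_Quillen_def cof_I tcof_I using left_adjoint_Ev1 by (auto simp: pointwise_def)

end


section \<open>The tensor product of arrows\<close>

context symmetric_monoidal
begin

lemma tensor_simps [simp]:
  "X \<in> Obj C \<Longrightarrow> Y \<in> Obj C \<Longrightarrow> X \<odot>\<^bsub>T\<^esub> Y \<in> Obj C"
  "f \<in> Mor C \<Longrightarrow> g \<in> Mor C \<Longrightarrow> f \<otimes>\<^bsub>T\<^esub> g \<in> Mor C"
  "f \<in> Mor C \<Longrightarrow> g \<in> Mor C \<Longrightarrow> Dom C (f \<otimes>\<^bsub>T\<^esub> g) = Dom C f \<odot>\<^bsub>T\<^esub> Dom C g"
  "f \<in> Mor C \<Longrightarrow> g \<in> Mor C \<Longrightarrow> Cod C (f \<otimes>\<^bsub>T\<^esub> g) = Cod C f \<odot>\<^bsub>T\<^esub> Cod C g"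
  "X \<in> Obj C \<Longrightarrow> Y \<in> Obj C \<Longrightarrow> Ident C X \<otimes>\<^bsub>T\<^esub> Ident C Y = Ident C (X \<odot>\<^bsub>T\<^esub> Y)"
  using tensor.FObj_Obj[of "(X, Y)"] tensor.FMor_simps[of "(f, g)"] tensor.FMor_Ident[of "(X, Y)"]
  by simp_all

lemma interchange [simp]:
  "\<lbrakk>f \<in> Mor C; g \<in> Mor C; f' \<in> Mor C; g' \<in> Mor C; Cod C f = Dom C g; Cod C f' = Dom C g'\<rbrakk>
    \<Longrightarrow> (g \<otimes>\<^bsub>T\<^esub> g') \<cdot>\<^bsub>C\<^esub> (f \<otimes>\<^bsub>T\<^esub> f') = (g \<cdot>\<^bsub>C\<^esub> f) \<otimes>\<^bsub>T\<^esub> (g' \<cdot>\<^bsub>C\<^esub> f')"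
  using tensor.FMor_Comp_simp[of "(f, f')" "(g, g')"] by simp

lemma structure_simps [simp]:
  assumes "X \<in> Obj C"
  shows "lunit T X \<in> Mor C" "Dom C (lunit T X) = tunit T \<odot>\<^bsub>T\<^esub> X" "Cod C (lunit T X) = X"
    "runit T X \<in> Mor C" "Dom C (runit T X) = X \<odot>\<^bsub>T\<^esub> tunit T" "Cod C (runit T X) = X"
    "Y \<in> Obj C \<Longrightarrow> braid T X Y \<in> Mor C" "Y \<in> Obj C \<Longrightarrow> Dom C (braid T X Y) = X \<odot>\<^bsub>T\<^esub> Y"
    "Y \<in> Obj C \<Longrightarrow> Cod C (braid T X Y) = Y \<odot>\<^bsub>T\<^esub> X"
    "Y \<in> Obj C \<Longrightarrow> Z \<in> Obj C \<Longrightarrow> assoc T X Y Z \<in> Mor C"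
    "Y \<in> Obj C \<Longrightarrow> Z \<in> Obj C \<Longrightarrow> Dom C (assoc T X Y Z) = (X \<odot>\<^bsub>T\<^esub> Y) \<odot>\<^bsub>T\<^esub> Z"
    "Y \<in> Obj C \<Longrightarrow> Z \<in> Obj C \<Longrightarrow> Cod C (assoc T X Y Z) = X \<odot>\<^bsub>T\<^esub> (Y \<odot>\<^bsub>T\<^esub> Z)"
  using lunit_Hom[OF assms] runit_Hom[OF assms] braid_Hom[OF assms] assoc_Hom[OF assms]
  by (simp_all add: Hom_iff)

lemma naturality:
  assumes "f \<in> Mor C"
  shows "lunit T (Cod C f) \<cdot>\<^bsub>C\<^esub> (Ident C (tunit T) \<otimes>\<^bsub>T\<^esub> f) = f \<cdot>\<^bsub>C\<^esub> lunit T (Dom C f)"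
    "runit T (Cod C f) \<cdot>\<^bsub>C\<^esub> (f \<otimes>\<^bsub>T\<^esub> Ident C (tunit T)) = f \<cdot>\<^bsub>C\<^esub> runit T (Dom C f)"
    "g \<in> Mor C \<Longrightarrow> braid T (Cod C f) (Cod C g) \<cdot>\<^bsub>C\<^esub> (f \<otimes>\<^bsub>T\<^esub> g) = (g \<otimes>\<^bsub>T\<^esub> f) \<cdot>\<^bsub>C\<^esub> braid T (Dom C f) (Dom C g)"
    "g \<in> Mor C \<Longrightarrow> h \<in> Mor C \<Longrightarrow> assoc T (Cod C f) (Cod C g) (Cod C h) \<cdot>\<^bsub>C\<^esub> ((f \<otimes>\<^bsub>T\<^esub> g) \<otimes>\<^bsub>T\<^esub> h) =
      (f \<otimes>\<^bsub>T\<^esub> (g \<otimes>\<^bsub>T\<^esub> h)) \<cdot>\<^bsub>C\<^esub> assoc T (Dom C f) (Dom C g) (Dom C h)"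
  using assms lunit_natural[of f] runit_natural[of f] braid_natural[of f _ _ g] assoc_natural[of f _ _ g _ _ h]
  by (simp_all add: Hom_iff)

end

lemma Arr_tensor_simps [simp]:
  "f \<odot>\<^bsub>Arr_tensor C T\<^esub> g = f \<otimes>\<^bsub>T\<^esub> g"
  "(f, g, u, v) \<otimes>\<^bsub>Arr_tensor C T\<^esub> (f', g', u', v') = (f \<otimes>\<^bsub>T\<^esub> f', g \<otimes>\<^bsub>T\<^esub> g', u \<otimes>\<^bsub>T\<^esub> u', v \<otimes>\<^bsub>T\<^esub> v')"
  "tunit (Arr_tensor C T) = Ident C (tunit T)"
  "assoc (Arr_tensor C T) f g h = ((f \<otimes>\<^bsub>T\<^esub> g) \<otimes>\<^bsub>T\<^esub> h, f \<otimes>\<^bsub>T\<^esub> (g \<otimes>\<^bsub>T\<^esub> h),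
    assoc T (Dom C f) (Dom C g) (Dom C h), assoc T (Cod C f) (Cod C g) (Cod C h))"
  "lunit (Arr_tensor C T) f = (Ident C (tunit T) \<otimes>\<^bsub>T\<^esub> f, f, lunit T (Dom C f), lunit T (Cod C f))"
  "runit (Arr_tensor C T) f = (f \<otimes>\<^bsub>T\<^esub> Ident C (tunit T), f, runit T (Dom C f), runit T (Cod C f))"
  "braid (Arr_tensor C T) f g = (f \<otimes>\<^bsub>T\<^esub> g, g \<otimes>\<^bsub>T\<^esub> f, braid T (Dom C f) (Dom C g), braid T (Cod C f) (Cod C g))"
  by (simp_all add: Arr_tensor_def)

lemma (in category) iso_square:
  assumes sq: "(f, g, u, v) \<in> Mor (Arr C)" and "iso C u" "iso C v"
  shows "iso (Arr C) (f, g, u, v)"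
proof -
  obtain u' where u': "u' \<in> Mor C" "Dom C u' = Cod C u" "Cod C u' = Dom C u"
    "u' \<cdot>\<^bsub>C\<^esub> u = Ident C (Dom C u)" "u \<cdot>\<^bsub>C\<^esub> u' = Ident C (Cod C u)"
    using assms(2) unfolding iso_def Bex_def Hom_iff by blast
  obtain v' where v': "v' \<in> Mor C" "Dom C v' = Cod C v" "Cod C v' = Dom C v"
    "v' \<cdot>\<^bsub>C\<^esub> v = Ident C (Dom C v)" "v \<cdot>\<^bsub>C\<^esub> v' = Ident C (Cod C v)"
    using assms(3) unfolding iso_def Bex_def Hom_iff by blast
  note [simp] = sq[simplified]
  have "v' \<cdot>\<^bsub>C\<^esub> g = v' \<cdot>\<^bsub>C\<^esub> g \<cdot>\<^bsub>C\<^esub> u \<cdot>\<^bsub>C\<^esub> u'"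
    using u' v' by simp
  also have "\<dots> = v' \<cdot>\<^bsub>C\<^esub> v \<cdot>\<^bsub>C\<^esub> f \<cdot>\<^bsub>C\<^esub> u'"
    using Comp_extend[of v f "g \<cdot>\<^bsub>C\<^esub> u" u'] u' v' by simp
  also have "\<dots> = f \<cdot>\<^bsub>C\<^esub> u'"
    using Comp_extend[OF v'(4), of "f \<cdot>\<^bsub>C\<^esub> u'"] u' v' by simp
  finally have "(g, f, u', v') \<in> Mor (Arr C)"
    using u' v' by simp
  then show ?thesis
    unfolding iso_def using sq u' v' by (intro conjI bexI[of _ "(g, f, u', v')"]) (simp_all add: Hom_iff)
qed

context symmetric_monoidal
begin

lemma is_functor_Arr_tensor:
  "is_functor (prod_cat (Arr C) (Arr C)) (Arr C) (tensor (Arr_tensor C T))"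
  by (rule is_functorI) (auto simp: C.Arr_category category_prod_cat)

text \<open>
  The coherence laws hold at the domains and at the codomains separately. That the structure maps are
  squares is their naturality in \<open>C\<close>.
\<close>

lemma symmetric_monoidal_Arr: "symmetric_monoidal (Arr C) (Arr_tensor C T)"
proof -
  interpret A: category "Arr C" by (rule C.Arr_category)
  interpret t: is_functor "prod_cat (Arr C) (Arr C)" "Arr C" "tensor (Arr_tensor C T)"
    by (rule is_functor_Arr_tensor)
  note [simp] = tunit_Obj
  show ?thesis
  proof (unfold_locales, goal_cases)
    case (3 f g h)
    then show ?case
      by (auto intro!: C.iso_square simp: assoc_iso naturality)
  next
    case (4 \<alpha> f f' \<beta> g g' \<gamma> h h')
    then obtain u v where \<alpha>: "\<alpha> = (f, f', u, v)" by (cases \<alpha>) (auto simp: Hom_iff)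
    from 4 obtain u' v' where \<beta>: "\<beta> = (g, g', u', v')" by (cases \<beta>) (auto simp: Hom_iff)
    from 4 obtain u'' v'' where \<gamma>: "\<gamma> = (h, h', u'', v'')" by (cases \<gamma>) (auto simp: Hom_iff)
    show ?case
      using 4 naturality(4)[of u u' u''] naturality(4)[of v v' v''] unfolding \<alpha> \<beta> \<gamma> by (simp add: Hom_iff)
  next
    case (6 f)
    then show ?case
      by (auto intro!: C.iso_square simp: lunit_iso naturality)
  next
    case (7 \<alpha> f g)
    then obtain u v where \<alpha>: "\<alpha> = (f, g, u, v)" by (cases \<alpha>) (auto simp: Hom_iff)
    show ?case
      using 7 naturality(1)[of u] naturality(1)[of v] unfolding \<alpha> by (simp add: Hom_iff)
  next
    case (9 f)
    then show ?case
      by (auto intro!: C.iso_square simp: runit_iso naturality)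
  next
    case (10 \<alpha> f g)
    then obtain u v where \<alpha>: "\<alpha> = (f, g, u, v)" by (cases \<alpha>) (auto simp: Hom_iff)
    show ?case
      using 10 naturality(2)[of u] naturality(2)[of v] unfolding \<alpha> by (simp add: Hom_iff)
  next
    case (11 f g h k)
    then show ?case
      using pentagon[of "Dom C f" "Dom C g" "Dom C h" "Dom C k"] pentagon[of "Cod C f" "Cod C g" "Cod C h" "Cod C k"]
      by simp
  next
    case (12 f g)
    then show ?case
      using triangle[of "Dom C f" "Dom C g"] triangle[of "Cod C f" "Cod C g"] by simp
  next
    case (15 \<alpha> f f' \<beta> g g')
    then obtain u v where \<alpha>: "\<alpha> = (f, f', u, v)" by (cases \<alpha>) (auto simp: Hom_iff)
    from 15 obtain u' v' where \<beta>: "\<beta> = (g, g', u', v')" by (cases \<beta>) (auto simp: Hom_iff)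
    show ?case
      using 15 naturality(3)[of u u'] naturality(3)[of v v'] unfolding \<alpha> \<beta> by (simp add: Hom_iff)
  next
    case (18 f g h)
    then show ?case
      using hexagon[of "Dom C f" "Dom C g" "Dom C h"] hexagon[of "Cod C f" "Cod C g" "Cod C h"] by simp
  qed (simp_all add: Hom_iff naturality lunit_runit braid_symmetric braid_unit)
qed

end


section \<open>Internal homs\<close>

text \<open>
  A symmetric monoidal category is closed if for all \<open>Y\<close> and \<open>Z\<close> there is a universal map
  \<open>ev : R Y Z \<otimes> Y \<rightarrow> Z\<close>; the internal hom functor and the naturality of the adjunction then come for
  free.
\<close>

locale exponentials = symmetric_monoidal C T
  for C :: "('o, 'a) category" and T +
  fixes R :: "'o \<Rightarrow> 'o \<Rightarrow> 'o" and ev :: "'o \<Rightarrow> 'o \<Rightarrow> 'a"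
  assumes R_Obj [simp]: "\<lbrakk>Y \<in> Obj C; Z \<in> Obj C\<rbrakk> \<Longrightarrow> R Y Z \<in> Obj C"
    and ev_Hom: "\<lbrakk>Y \<in> Obj C; Z \<in> Obj C\<rbrakk> \<Longrightarrow> ev Y Z \<in> Hom C (R Y Z \<odot>\<^bsub>T\<^esub> Y) Z"
    and transpose_ex1: "\<lbrakk>X \<in> Obj C; Y \<in> Obj C; Z \<in> Obj C; f \<in> Hom C (X \<odot>\<^bsub>T\<^esub> Y) Z\<rbrakk>
      \<Longrightarrow> \<exists>!k. k \<in> Hom C X (R Y Z) \<and> ev Y Z \<cdot>\<^bsub>C\<^esub> (k \<otimes>\<^bsub>T\<^esub> Ident C Y) = f"
begin

lemma ev_simps [simp]:
  assumes "Y \<in> Obj C" "Z \<in> Obj C"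
  shows "ev Y Z \<in> Mor C" "Dom C (ev Y Z) = R Y Z \<odot>\<^bsub>T\<^esub> Y" "Cod C (ev Y Z) = Z"
  using ev_Hom[OF assms] by (simp_all add: Hom_iff)

definition transpose :: "'o \<Rightarrow> 'o \<Rightarrow> 'o \<Rightarrow> 'a \<Rightarrow> 'a" where
  "transpose X Y Z f = (THE k. k \<in> Hom C X (R Y Z) \<and> ev Y Z \<cdot>\<^bsub>C\<^esub> (k \<otimes>\<^bsub>T\<^esub> Ident C Y) = f)"

lemma transpose_simps [simp]:
  assumes "X \<in> Obj C" "Y \<in> Obj C" "Z \<in> Obj C" "f \<in> Mor C" "Dom C f = X \<odot>\<^bsub>T\<^esub> Y" "Cod C f = Z"
  shows "transpose X Y Z f \<in> Mor C" "Dom C (transpose X Y Z f) = X" "Cod C (transpose X Y Z f) = R Y Z"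
    "ev Y Z \<cdot>\<^bsub>C\<^esub> (transpose X Y Z f \<otimes>\<^bsub>T\<^esub> Ident C Y) = f"
proof -
  have "transpose X Y Z f \<in> Hom C X (R Y Z) \<and> ev Y Z \<cdot>\<^bsub>C\<^esub> (transpose X Y Z f \<otimes>\<^bsub>T\<^esub> Ident C Y) = f"
    unfolding transpose_def by (rule theI'[OF transpose_ex1]) (use assms in \<open>simp_all add: Hom_iff\<close>)
  then show "transpose X Y Z f \<in> Mor C" "Dom C (transpose X Y Z f) = X" "Cod C (transpose X Y Z f) = R Y Z"
    "ev Y Z \<cdot>\<^bsub>C\<^esub> (transpose X Y Z f \<otimes>\<^bsub>T\<^esub> Ident C Y) = f"
    by (simp_all add: Hom_iff)
qed

lemma transpose_eqI:
  assumes "Y \<in> Obj C" "Z \<in> Obj C" "h \<in> Mor C" "k \<in> Mor C" "Dom C h = Dom C k" "Cod C h = R Y Z" "Cod C k = R Y Z"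
    "ev Y Z \<cdot>\<^bsub>C\<^esub> (h \<otimes>\<^bsub>T\<^esub> Ident C Y) = ev Y Z \<cdot>\<^bsub>C\<^esub> (k \<otimes>\<^bsub>T\<^esub> Ident C Y)"
  shows "h = k"
proof -
  have "ev Y Z \<cdot>\<^bsub>C\<^esub> (k \<otimes>\<^bsub>T\<^esub> Ident C Y) \<in> Hom C (Dom C k \<odot>\<^bsub>T\<^esub> Y) Z"
    using assms by (simp add: Hom_iff)
  from transpose_ex1[OF _ assms(1,2) this] show ?thesis
    using assms C.Dom_Obj[of k] by (metis Hom_iff)
qed

lemma ev_Comp:
  assumes "ev Y Z \<cdot>\<^bsub>C\<^esub> (k \<otimes>\<^bsub>T\<^esub> Ident C Y) = e" "Y \<in> Obj C" "Z \<in> Obj C" "k \<in> Mor C" "Cod C k = R Y Z"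
    "h \<in> Mor C" "Cod C h = Dom C k"
  shows "ev Y Z \<cdot>\<^bsub>C\<^esub> ((k \<cdot>\<^bsub>C\<^esub> h) \<otimes>\<^bsub>T\<^esub> Ident C Y) = e \<cdot>\<^bsub>C\<^esub> (h \<otimes>\<^bsub>T\<^esub> Ident C Y)"
  using C.Comp_extend[OF assms(1), of "h \<otimes>\<^bsub>T\<^esub> Ident C Y"] assms by simp

definition internal_hom :: "('o \<times> 'o, 'a \<times> 'a, 'o, 'a) cfunctor" where
  "internal_hom = \<lparr>FObj = (\<lambda>(Y, Z). R Y Z),
    FMor = (\<lambda>(b, c). transpose (R (Cod C b) (Dom C c)) (Dom C b) (Cod C c)
      (c \<cdot>\<^bsub>C\<^esub> ev (Cod C b) (Dom C c) \<cdot>\<^bsub>C\<^esub> (Ident C (R (Cod C b) (Dom C c)) \<otimes>\<^bsub>T\<^esub> b)))\<rparr>"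

lemma internal_hom_simps [simp]:
  "FObj internal_hom (Y, Z) = R Y Z"
  "b \<in> Mor C \<Longrightarrow> c \<in> Mor C \<Longrightarrow> FMor internal_hom (b, c) \<in> Mor C"
  "b \<in> Mor C \<Longrightarrow> c \<in> Mor C \<Longrightarrow> Dom C (FMor internal_hom (b, c)) = R (Cod C b) (Dom C c)"
  "b \<in> Mor C \<Longrightarrow> c \<in> Mor C \<Longrightarrow> Cod C (FMor internal_hom (b, c)) = R (Dom C b) (Cod C c)"
  by (simp_all add: internal_hom_def)

lemma ev_internal_hom:
  assumes "b \<in> Mor C" "c \<in> Mor C" "k \<in> Mor C" "Cod C k = R (Cod C b) (Dom C c)"
  shows "ev (Dom C b) (Cod C c) \<cdot>\<^bsub>C\<^esub> ((FMor internal_hom (b, c) \<cdot>\<^bsub>C\<^esub> k) \<otimes>\<^bsub>T\<^esub> Ident C (Dom C b)) =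
    c \<cdot>\<^bsub>C\<^esub> ev (Cod C b) (Dom C c) \<cdot>\<^bsub>C\<^esub> (k \<otimes>\<^bsub>T\<^esub> b)"
proof -
  have "ev (Dom C b) (Cod C c) \<cdot>\<^bsub>C\<^esub> (FMor internal_hom (b, c) \<otimes>\<^bsub>T\<^esub> Ident C (Dom C b)) =
      c \<cdot>\<^bsub>C\<^esub> ev (Cod C b) (Dom C c) \<cdot>\<^bsub>C\<^esub> (Ident C (R (Cod C b) (Dom C c)) \<otimes>\<^bsub>T\<^esub> b)"
    using assms by (simp add: internal_hom_def)
  from ev_Comp[OF this, of k] show ?thesis
    using assms by simp
qed

lemma is_functor_internal_hom: "is_functor (prod_cat (opp C) C) C internal_hom"
proof (rule is_functorI)
  show "category (prod_cat (opp C) C)" "category C"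
    by (simp_all add: category_prod_cat category_opp C.category_axioms)
next
  fix YZ assume YZ: "YZ \<in> Obj (prod_cat (opp C) C)"
  obtain Y Z where [simp]: "YZ = (Y, Z)" by (cases YZ)
  have "FMor internal_hom (Ident C Y, Ident C Z) = Ident C (R Y Z)"
    by (rule transpose_eqI[of Y Z])
      (use YZ ev_internal_hom[of "Ident C Y" "Ident C Z" "Ident C (R Y Z)"] in simp_all)
  then show "FMor internal_hom (Ident (prod_cat (opp C) C) YZ) = Ident C (FObj internal_hom YZ)"
    by simp
next
  fix bc bc' assume *: "bc \<in> Mor (prod_cat (opp C) C)" "bc' \<in> Mor (prod_cat (opp C) C)"
    "Cod (prod_cat (opp C) C) bc = Dom (prod_cat (opp C) C) bc'"
  obtain b c b' c' where [simp]: "bc = (b, c)" "bc' = (b', c')" by (cases bc; cases bc')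
  have Mor: "b \<in> Mor C" "c \<in> Mor C" "b' \<in> Mor C" "c' \<in> Mor C" "Cod C b' = Dom C b" "Cod C c = Dom C c'"
    using * by simp_all
  let ?H = "FMor internal_hom" and ?R = "R (Cod C b) (Dom C c)"
  have "?H (b \<cdot>\<^bsub>C\<^esub> b', c' \<cdot>\<^bsub>C\<^esub> c) = ?H (b', c') \<cdot>\<^bsub>C\<^esub> ?H (b, c)"
  proof (rule transpose_eqI[of "Dom C b'" "Cod C c'"])
    have bc: "ev (Dom C b) (Cod C c) \<cdot>\<^bsub>C\<^esub> (?H (b, c) \<otimes>\<^bsub>T\<^esub> Ident C (Dom C b)) =
        c \<cdot>\<^bsub>C\<^esub> ev (Cod C b) (Dom C c) \<cdot>\<^bsub>C\<^esub> (Ident C ?R \<otimes>\<^bsub>T\<^esub> b)"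
      using ev_internal_hom[of b c "Ident C ?R"] Mor by simp
    have "ev (Dom C b') (Cod C c') \<cdot>\<^bsub>C\<^esub> ((?H (b', c') \<cdot>\<^bsub>C\<^esub> ?H (b, c)) \<otimes>\<^bsub>T\<^esub> Ident C (Dom C b')) =
        c' \<cdot>\<^bsub>C\<^esub> ev (Dom C b) (Cod C c) \<cdot>\<^bsub>C\<^esub> (?H (b, c) \<otimes>\<^bsub>T\<^esub> b')"
      using ev_internal_hom[of b' c' "?H (b, c)"] Mor by simp
    also have "\<dots> = c' \<cdot>\<^bsub>C\<^esub> ev (Dom C b) (Cod C c) \<cdot>\<^bsub>C\<^esub> (?H (b, c) \<otimes>\<^bsub>T\<^esub> Ident C (Dom C b)) \<cdot>\<^bsub>C\<^esub> (Ident C ?R \<otimes>\<^bsub>T\<^esub> b')"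
      using Mor by simp
    also have "\<dots> = c' \<cdot>\<^bsub>C\<^esub> c \<cdot>\<^bsub>C\<^esub> ev (Cod C b) (Dom C c) \<cdot>\<^bsub>C\<^esub> (Ident C ?R \<otimes>\<^bsub>T\<^esub> (b \<cdot>\<^bsub>C\<^esub> b'))"
      using C.Comp_extend[OF bc, of "Ident C ?R \<otimes>\<^bsub>T\<^esub> b'"] Mor by simp
    also have "\<dots> = ev (Dom C b') (Cod C c') \<cdot>\<^bsub>C\<^esub> (?H (b \<cdot>\<^bsub>C\<^esub> b', c' \<cdot>\<^bsub>C\<^esub> c) \<otimes>\<^bsub>T\<^esub> Ident C (Dom C b'))"
      using ev_internal_hom[of "b \<cdot>\<^bsub>C\<^esub> b'" "c' \<cdot>\<^bsub>C\<^esub> c" "Ident C ?R"] Mor by simp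
    finally show "ev (Dom C b') (Cod C c') \<cdot>\<^bsub>C\<^esub> (?H (b \<cdot>\<^bsub>C\<^esub> b', c' \<cdot>\<^bsub>C\<^esub> c) \<otimes>\<^bsub>T\<^esub> Ident C (Dom C b')) =
        ev (Dom C b') (Cod C c') \<cdot>\<^bsub>C\<^esub> ((?H (b', c') \<cdot>\<^bsub>C\<^esub> ?H (b, c)) \<otimes>\<^bsub>T\<^esub> Ident C (Dom C b'))" ..
  qed (use Mor in simp_all)
  then show "?H (bc' \<cdot>\<^bsub>prod_cat (opp C) C\<^esub> bc) = ?H bc' \<cdot>\<^bsub>C\<^esub> ?H bc"
    by simp
qed auto

lemma closed: "closed_symmetric_monoidal C T"
  unfolding closed_symmetric_monoidal_def
proof (intro conjI exI[of _ internal_hom] exI[of _ transpose] ballI allI impI)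
  fix X Y Z assume XYZ: "X \<in> Obj C" "Y \<in> Obj C" "Z \<in> Obj C"
  have "transpose X Y Z (ev Y Z \<cdot>\<^bsub>C\<^esub> (k \<otimes>\<^bsub>T\<^esub> Ident C Y)) = k" if "k \<in> Hom C X (R Y Z)" for k
    by (rule transpose_eqI[of Y Z]) (use XYZ that in \<open>simp_all add: Hom_iff\<close>)
  then show "bij_betw (transpose X Y Z) (Hom C (X \<odot>\<^bsub>T\<^esub> Y) Z) (Hom C X (FObj internal_hom (Y, Z)))"
    by (intro bij_betw_byWitness[where f' = "\<lambda>k. ev Y Z \<cdot>\<^bsub>C\<^esub> (k \<otimes>\<^bsub>T\<^esub> Ident C Y)"])
      (use XYZ in \<open>auto simp: Hom_iff\<close>)
next
  fix X' X Y' Y Z Z' a b c f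
  assume *: "a \<in> Hom C X' X \<and> b \<in> Hom C Y' Y \<and> c \<in> Hom C Z Z' \<and> f \<in> Hom C (X \<odot>\<^bsub>T\<^esub> Y) Z"
  have Obj: "X \<in> Obj C" "X' \<in> Obj C" "Y \<in> Obj C" "Y' \<in> Obj C" "Z \<in> Obj C" "Z' \<in> Obj C"
    using * C.Dom_Obj C.Cod_Obj unfolding Hom_iff by metis+
  have Mor: "a \<in> Mor C" "Dom C a = X'" "Cod C a = X" "b \<in> Mor C" "Dom C b = Y'" "Cod C b = Y"
    "c \<in> Mor C" "Dom C c = Z" "Cod C c = Z'" "f \<in> Mor C" "Dom C f = X \<odot>\<^bsub>T\<^esub> Y" "Cod C f = Z"
    using * by (simp_all add: Hom_iff)
  let ?f = "transpose X Y Z f"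
  show "transpose X' Y' Z' (c \<cdot>\<^bsub>C\<^esub> f \<cdot>\<^bsub>C\<^esub> (a \<otimes>\<^bsub>T\<^esub> b)) = FMor internal_hom (b, c) \<cdot>\<^bsub>C\<^esub> ?f \<cdot>\<^bsub>C\<^esub> a"
  proof (rule transpose_eqI[of Y' Z'])
    have "ev Y Z \<cdot>\<^bsub>C\<^esub> ((?f \<cdot>\<^bsub>C\<^esub> a) \<otimes>\<^bsub>T\<^esub> b) = ev Y Z \<cdot>\<^bsub>C\<^esub> (?f \<otimes>\<^bsub>T\<^esub> Ident C Y) \<cdot>\<^bsub>C\<^esub> (a \<otimes>\<^bsub>T\<^esub> b)"
      using Obj Mor by simp
    also have "\<dots> = f \<cdot>\<^bsub>C\<^esub> (a \<otimes>\<^bsub>T\<^esub> b)"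
      using C.Comp_extend[of "ev Y Z" "?f \<otimes>\<^bsub>T\<^esub> Ident C Y" f "a \<otimes>\<^bsub>T\<^esub> b"] Obj Mor by simp
    finally show "ev Y' Z' \<cdot>\<^bsub>C\<^esub> (transpose X' Y' Z' (c \<cdot>\<^bsub>C\<^esub> f \<cdot>\<^bsub>C\<^esub> (a \<otimes>\<^bsub>T\<^esub> b)) \<otimes>\<^bsub>T\<^esub> Ident C Y') =
        ev Y' Z' \<cdot>\<^bsub>C\<^esub> ((FMor internal_hom (b, c) \<cdot>\<^bsub>C\<^esub> ?f \<cdot>\<^bsub>C\<^esub> a) \<otimes>\<^bsub>T\<^esub> Ident C Y')"
      using ev_internal_hom[of b c "?f \<cdot>\<^bsub>C\<^esub> a"] Obj Mor by simp
  qed (use Obj Mor in simp_all)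
qed (simp_all add: is_functor_internal_hom symmetric_monoidal_axioms)

end

text \<open>The universal map \<open>ev Y Z\<close> corresponds to the identity of the internal hom of \<open>Y\<close> and \<open>Z\<close>.\<close>

lemma closed_exponentials:
  fixes C :: "('o, 'a) category"
  assumes "closed_symmetric_monoidal C T"
  obtains R ev where "exponentials C T R ev"
proof -
  interpret symmetric_monoidal C T
    using assms by (simp add: closed_symmetric_monoidal_def)
  obtain H :: "('o \<times> 'o, 'a \<times> 'a, 'o, 'a) cfunctor" and \<phi> where H: "is_functor (prod_cat (opp C) C) C H"
    and bij_all: "\<forall>X \<in> Obj C. \<forall>Y \<in> Obj C. \<forall>Z \<in> Obj C.
      bij_betw (\<phi> X Y Z) (Hom C (X \<odot>\<^bsub>T\<^esub> Y) Z) (Hom C X (FObj H (Y, Z)))"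
    and natural_all: "\<forall>X' X Y' Y Z Z' a b c f.
      a \<in> Hom C X' X \<and> b \<in> Hom C Y' Y \<and> c \<in> Hom C Z Z' \<and> f \<in> Hom C (X \<odot>\<^bsub>T\<^esub> Y) Z \<longrightarrow>
      \<phi> X' Y' Z' (c \<cdot>\<^bsub>C\<^esub> f \<cdot>\<^bsub>C\<^esub> (a \<otimes>\<^bsub>T\<^esub> b)) = FMor H (b, c) \<cdot>\<^bsub>C\<^esub> \<phi> X Y Z f \<cdot>\<^bsub>C\<^esub> a"
    using assms unfolding closed_symmetric_monoidal_def by blast
  note bij = bij_all[rule_format] and natural = natural_all[rule_format, OF conjI[OF _ conjI[OF _ conjI]]]
  interpret H: is_functor "prod_cat (opp C) C" C H by fact
  have H_Obj: "FObj H (Y, Z) \<in> Obj C" if "Y \<in> Obj C" "Z \<in> Obj C" for Y Z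
    using H.FObj_Obj[of "(Y, Z)"] that by simp
  have "\<exists>e. e \<in> Hom C (FObj H (Y, Z) \<odot>\<^bsub>T\<^esub> Y) Z \<and> \<phi> (FObj H (Y, Z)) Y Z e = Ident C (FObj H (Y, Z))"
    if "Y \<in> Obj C" "Z \<in> Obj C" for Y Z
  proof -
    have "Ident C (FObj H (Y, Z)) \<in> Hom C (FObj H (Y, Z)) (FObj H (Y, Z))"
      using H_Obj[OF that] by (simp add: Hom_iff)
    also have "\<dots> = \<phi> (FObj H (Y, Z)) Y Z ` Hom C (FObj H (Y, Z) \<odot>\<^bsub>T\<^esub> Y) Z"
      using bij[OF H_Obj[OF that] that] by (simp add: bij_betw_def)
    finally show ?thesis
      by (elim imageE) (intro exI conjI, simp_all)
  qed
  then obtain ev where ev: "\<And>Y Z. \<lbrakk>Y \<in> Obj C; Z \<in> Obj C\<rbrakk> \<Longrightarrow> ev Y Z \<in> Hom C (FObj H (Y, Z) \<odot>\<^bsub>T\<^esub> Y) Z"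
    "\<And>Y Z. \<lbrakk>Y \<in> Obj C; Z \<in> Obj C\<rbrakk> \<Longrightarrow> \<phi> (FObj H (Y, Z)) Y Z (ev Y Z) = Ident C (FObj H (Y, Z))"
    by metis
  have "exponentials C T (\<lambda>Y Z. FObj H (Y, Z)) ev"
  proof (unfold_locales, goal_cases)
    case (3 X Y Z f)
    let ?R = "FObj H (Y, Z)"
    have inj: "inj_on (\<phi> X Y Z) (Hom C (X \<odot>\<^bsub>T\<^esub> Y) Z)" and onto: "\<phi> X Y Z f \<in> Hom C X ?R"
      using bij[OF 3(1-3)] 3(4) by (auto simp: bij_betw_def)
    have ev_Mor: "ev Y Z \<in> Mor C" "Dom C (ev Y Z) = ?R \<odot>\<^bsub>T\<^esub> Y" "Cod C (ev Y Z) = Z"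
      using ev(1)[OF 3(2,3)] by (simp_all add: Hom_iff)
    have H_id: "FMor H (Ident C Y, Ident C Z) = Ident C ?R"
      using H.FMor_Ident[of "(Y, Z)"] 3 by simp
    have \<phi>: "\<phi> X Y Z (ev Y Z \<cdot>\<^bsub>C\<^esub> (k \<otimes>\<^bsub>T\<^esub> Ident C Y)) = k" if k: "k \<in> Hom C X ?R" for k
      using natural[OF k, of "Ident C Y" Y Y "Ident C Z" Z Z "ev Y Z"] 3 k ev[OF 3(2,3)] H_Obj[OF 3(2,3)]
      by (simp add: Hom_iff H_id)
    have Hom: "ev Y Z \<cdot>\<^bsub>C\<^esub> (k \<otimes>\<^bsub>T\<^esub> Ident C Y) \<in> Hom C (X \<odot>\<^bsub>T\<^esub> Y) Z" if "k \<in> Hom C X ?R" for k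
      using that ev_Mor 3 by (simp add: Hom_iff)
    show ?case
    proof (rule ex1I[of _ "\<phi> X Y Z f"])
      show "\<phi> X Y Z f \<in> Hom C X ?R \<and> ev Y Z \<cdot>\<^bsub>C\<^esub> (\<phi> X Y Z f \<otimes>\<^bsub>T\<^esub> Ident C Y) = f"
        using inj_onD[OF inj \<phi>[OF onto] Hom[OF onto] 3(4)] onto by blast
    qed (use \<phi> in auto)
  qed (simp_all add: H_Obj ev)
  then show ?thesis
    using that by blast
qed

text \<open>
  A map \<open>x \<otimes> y \<rightarrow> z\<close> of arrows consists of maps \<open>X1 \<rightarrow> R Y1 Z1\<close> and \<open>X0 \<rightarrow> R Y0 Z0\<close> that agree in
  \<open>R Y0 Z1\<close>. Therefore the internal hom from \<open>y\<close> to \<open>z\<close> is the projection from the pullback of these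
  three objects to \<open>R Y1 Z1\<close>.
\<close>

lemma (in exponentials) Arr_exponential:
  assumes pb: "\<And>f g. \<lbrakk>f \<in> Mor C; g \<in> Mor C; Cod C f = Cod C g\<rbrakk> \<Longrightarrow> \<exists>P p q. is_pullback C f g P p q"
    and y: "y \<in> Mor C" and z: "z \<in> Mor C"
  shows "\<exists>p e. p \<in> Mor C \<and> e \<in> Hom (Arr C) (p \<odot>\<^bsub>Arr_tensor C T\<^esub> y) z \<and>
    (\<forall>x \<alpha>. x \<in> Mor C \<and> \<alpha> \<in> Hom (Arr C) (x \<odot>\<^bsub>Arr_tensor C T\<^esub> y) z \<longrightarrow>
      (\<exists>!\<kappa>. \<kappa> \<in> Hom (Arr C) x p \<and> e \<cdot>\<^bsub>Arr C\<^esub> (\<kappa> \<otimes>\<^bsub>Arr_tensor C T\<^esub> Ident (Arr C) y) = \<alpha>))"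
proof -
  define Y0 Y1 Z0 Z1 where YZ: "Y0 = Dom C y" "Y1 = Cod C y" "Z0 = Dom C z" "Z1 = Cod C z"
  have [simp]: "Y0 \<in> Obj C" "Y1 \<in> Obj C" "Z0 \<in> Obj C" "Z1 \<in> Obj C" "Dom C y = Y0" "Cod C y = Y1"
    "Dom C z = Z0" "Cod C z = Z1" "y \<in> Mor C" "z \<in> Mor C"
    using y z by (simp_all add: YZ)
  define r where "r = transpose (R Y1 Z1) Y0 Z1 (ev Y1 Z1 \<cdot>\<^bsub>C\<^esub> (Ident C (R Y1 Z1) \<otimes>\<^bsub>T\<^esub> y))"
  define t where "t = transpose (R Y0 Z0) Y0 Z1 (z \<cdot>\<^bsub>C\<^esub> ev Y0 Z0)"
  have r [simp]: "r \<in> Mor C" "Dom C r = R Y1 Z1" "Cod C r = R Y0 Z1"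
    and r_ev: "ev Y0 Z1 \<cdot>\<^bsub>C\<^esub> (r \<otimes>\<^bsub>T\<^esub> Ident C Y0) = ev Y1 Z1 \<cdot>\<^bsub>C\<^esub> (Ident C (R Y1 Z1) \<otimes>\<^bsub>T\<^esub> y)"
    by (simp_all add: r_def)
  have t [simp]: "t \<in> Mor C" "Dom C t = R Y0 Z0" "Cod C t = R Y0 Z1"
    and t_ev: "ev Y0 Z1 \<cdot>\<^bsub>C\<^esub> (t \<otimes>\<^bsub>T\<^esub> Ident C Y0) = z \<cdot>\<^bsub>C\<^esub> ev Y0 Z0"
    by (simp_all add: t_def)
  have ev_r: "ev Y0 Z1 \<cdot>\<^bsub>C\<^esub> ((r \<cdot>\<^bsub>C\<^esub> k) \<otimes>\<^bsub>T\<^esub> Ident C Y0) = ev Y1 Z1 \<cdot>\<^bsub>C\<^esub> (k \<otimes>\<^bsub>T\<^esub> y)"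
    if "k \<in> Mor C" "Cod C k = R Y1 Z1" for k
    using ev_Comp[OF r_ev, of k] that by simp
  have ev_t: "ev Y0 Z1 \<cdot>\<^bsub>C\<^esub> ((t \<cdot>\<^bsub>C\<^esub> k) \<otimes>\<^bsub>T\<^esub> Ident C Y0) = z \<cdot>\<^bsub>C\<^esub> ev Y0 Z0 \<cdot>\<^bsub>C\<^esub> (k \<otimes>\<^bsub>T\<^esub> Ident C Y0)"
    if "k \<in> Mor C" "Cod C k = R Y0 Z0" for k
    using ev_Comp[OF t_ev, of k] that by simp
  obtain P p q where P: "is_pullback C r t P p q"
    using pb[of r t] by auto
  note pq [simp] = is_pullback_simps(4-9)[OF P, simplified] and rp = is_pullback_simps(10)[OF P]
  define e where "e = (p \<otimes>\<^bsub>T\<^esub> y, z, ev Y0 Z0 \<cdot>\<^bsub>C\<^esub> (q \<otimes>\<^bsub>T\<^esub> Ident C Y0), ev Y1 Z1)"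
  have P_Obj [simp]: "P \<in> Obj C"
    using C.Dom_Obj[of p] by simp
  have "e \<in> Hom (Arr C) (p \<otimes>\<^bsub>T\<^esub> y) z"
    using ev_r[of p] ev_t[of q] rp by (simp add: e_def Hom_iff)
  moreover have "\<exists>!\<kappa>. \<kappa> \<in> Hom (Arr C) x p \<and> e \<cdot>\<^bsub>Arr C\<^esub> (\<kappa> \<otimes>\<^bsub>Arr_tensor C T\<^esub> Ident (Arr C) y) = \<alpha>"
    if x: "x \<in> Mor C" and \<alpha>: "\<alpha> \<in> Hom (Arr C) (x \<otimes>\<^bsub>T\<^esub> y) z" for x \<alpha>
  proof -
    obtain f0 f1 where \<alpha>_eq: "\<alpha> = (x \<otimes>\<^bsub>T\<^esub> y, z, f0, f1)"
      using \<alpha> by (cases \<alpha>) (auto simp: Hom_iff)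
    have f [simp]: "f0 \<in> Mor C" "Dom C f0 = Dom C x \<odot>\<^bsub>T\<^esub> Y0" "Cod C f0 = Z0"
      "f1 \<in> Mor C" "Dom C f1 = Cod C x \<odot>\<^bsub>T\<^esub> Y1" "Cod C f1 = Z1" and f_comm: "f1 \<cdot>\<^bsub>C\<^esub> (x \<otimes>\<^bsub>T\<^esub> y) = z \<cdot>\<^bsub>C\<^esub> f0"
      using \<alpha> x unfolding \<alpha>_eq by (simp_all add: Hom_iff)
    define k1 where "k1 = transpose (Cod C x) Y1 Z1 f1"
    define m where "m = transpose (Dom C x) Y0 Z0 f0"
    have k1 [simp]: "k1 \<in> Mor C" "Dom C k1 = Cod C x" "Cod C k1 = R Y1 Z1"
      and k1_ev: "ev Y1 Z1 \<cdot>\<^bsub>C\<^esub> (k1 \<otimes>\<^bsub>T\<^esub> Ident C Y1) = f1"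
      using x by (simp_all add: k1_def)
    have m [simp]: "m \<in> Mor C" "Dom C m = Dom C x" "Cod C m = R Y0 Z0"
      and m_ev: "ev Y0 Z0 \<cdot>\<^bsub>C\<^esub> (m \<otimes>\<^bsub>T\<^esub> Ident C Y0) = f0"
      using x by (simp_all add: m_def)
    have "r \<cdot>\<^bsub>C\<^esub> k1 \<cdot>\<^bsub>C\<^esub> x = t \<cdot>\<^bsub>C\<^esub> m"
    proof (rule transpose_eqI[of Y0 Z1])
      have "ev Y0 Z1 \<cdot>\<^bsub>C\<^esub> ((r \<cdot>\<^bsub>C\<^esub> k1 \<cdot>\<^bsub>C\<^esub> x) \<otimes>\<^bsub>T\<^esub> Ident C Y0) = f1 \<cdot>\<^bsub>C\<^esub> (x \<otimes>\<^bsub>T\<^esub> y)"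
        using ev_r[of "k1 \<cdot>\<^bsub>C\<^esub> x"] C.Comp_extend[OF k1_ev, of "x \<otimes>\<^bsub>T\<^esub> y"] x by simp
      also have "\<dots> = ev Y0 Z1 \<cdot>\<^bsub>C\<^esub> ((t \<cdot>\<^bsub>C\<^esub> m) \<otimes>\<^bsub>T\<^esub> Ident C Y0)"
        using ev_t[of m] f_comm m_ev by simp
      finally show "ev Y0 Z1 \<cdot>\<^bsub>C\<^esub> ((r \<cdot>\<^bsub>C\<^esub> k1 \<cdot>\<^bsub>C\<^esub> x) \<otimes>\<^bsub>T\<^esub> Ident C Y0) =
        ev Y0 Z1 \<cdot>\<^bsub>C\<^esub> ((t \<cdot>\<^bsub>C\<^esub> m) \<otimes>\<^bsub>T\<^esub> Ident C Y0)" .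
    qed (use x in simp_all)
    then obtain k0 where k0: "k0 \<in> Mor C" "Dom C k0 = Dom C x" "Cod C k0 = P" "p \<cdot>\<^bsub>C\<^esub> k0 = k1 \<cdot>\<^bsub>C\<^esub> x" "q \<cdot>\<^bsub>C\<^esub> k0 = m"
      using is_pullbackE[OF P, of "k1 \<cdot>\<^bsub>C\<^esub> x" m] x by auto
    show ?thesis
    proof (rule ex1I[of _ "(x, p, k0, k1)"])
      show "(x, p, k0, k1) \<in> Hom (Arr C) x p \<and>
          e \<cdot>\<^bsub>Arr C\<^esub> ((x, p, k0, k1) \<otimes>\<^bsub>Arr_tensor C T\<^esub> Ident (Arr C) y) = \<alpha>"
        using k0 x k1_ev m_ev by (simp add: Hom_iff e_def \<alpha>_eq)
    next
      fix \<kappa> assume \<kappa>: "\<kappa> \<in> Hom (Arr C) x p \<and> e \<cdot>\<^bsub>Arr C\<^esub> (\<kappa> \<otimes>\<^bsub>Arr_tensor C T\<^esub> Ident (Arr C) y) = \<alpha>"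
      then obtain l0 l1 where \<kappa>_eq: "\<kappa> = (x, p, l0, l1)"
        by (cases \<kappa>) (auto simp: Hom_iff)
      have l [simp]: "l0 \<in> Mor C" "Dom C l0 = Dom C x" "Cod C l0 = P" "l1 \<in> Mor C" "Dom C l1 = Cod C x" "Cod C l1 = R Y1 Z1"
        and l_comm: "l1 \<cdot>\<^bsub>C\<^esub> x = p \<cdot>\<^bsub>C\<^esub> l0"
        using \<kappa> unfolding \<kappa>_eq by (simp_all add: Hom_iff)
      have l0_ev: "ev Y0 Z0 \<cdot>\<^bsub>C\<^esub> ((q \<cdot>\<^bsub>C\<^esub> l0) \<otimes>\<^bsub>T\<^esub> Ident C Y0) = f0"
        and l1_ev: "ev Y1 Z1 \<cdot>\<^bsub>C\<^esub> (l1 \<otimes>\<^bsub>T\<^esub> Ident C Y1) = f1"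
        using \<kappa> x unfolding \<kappa>_eq by (simp_all add: e_def \<alpha>_eq)
      have l1: "l1 = k1"
        by (rule transpose_eqI[of Y1 Z1]) (use x k1_ev l1_ev in simp_all)
      have q_l0: "q \<cdot>\<^bsub>C\<^esub> l0 = m"
        by (rule transpose_eqI[of Y0 Z0]) (use x m_ev l0_ev in simp_all)
      have "l0 = k0"
        by (rule C.is_pullback_eqI[OF P]) (use k0 l_comm q_l0 in \<open>simp_all add: l1\<close>)
      then show "\<kappa> = (x, p, k0, k1)"
        by (simp add: \<kappa>_eq l1)
    qed
  qed
  ultimately show ?thesis
    by (intro exI[of _ p] exI[of _ e]) simp
qed

lemma closed_symmetric_monoidal_Arr:
  assumes pb: "\<And>f g. \<lbrakk>f \<in> Mor C; g \<in> Mor C; Cod C f = Cod C g\<rbrakk> \<Longrightarrow> \<exists>P p q. is_pullback C f g P p q"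
    and "closed_symmetric_monoidal C T"
  shows "closed_symmetric_monoidal (Arr C) (Arr_tensor C T)"
proof -
  obtain R0 ev0 where "exponentials C T R0 ev0"
    using closed_exponentials[OF assms(2)] .
  then interpret exponentials C T R0 ev0 .
  interpret A: symmetric_monoidal "Arr C" "Arr_tensor C T"
    by (rule symmetric_monoidal_Arr)
  define good where "good y z p e \<longleftrightarrow> p \<in> Mor C \<and> e \<in> Hom (Arr C) (p \<odot>\<^bsub>Arr_tensor C T\<^esub> y) z \<and>
    (\<forall>x \<alpha>. x \<in> Mor C \<and> \<alpha> \<in> Hom (Arr C) (x \<odot>\<^bsub>Arr_tensor C T\<^esub> y) z \<longrightarrow>
      (\<exists>!\<kappa>. \<kappa> \<in> Hom (Arr C) x p \<and> e \<cdot>\<^bsub>Arr C\<^esub> (\<kappa> \<otimes>\<^bsub>Arr_tensor C T\<^esub> Ident (Arr C) y) = \<alpha>))" for y z p e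
  have "\<exists>p e. good y z p e" if "y \<in> Mor C" "z \<in> Mor C" for y z
    unfolding good_def by (rule Arr_exponential[OF pb that])
  then obtain R ev where R: "\<And>y z. \<lbrakk>y \<in> Mor C; z \<in> Mor C\<rbrakk> \<Longrightarrow> good y z (R y z) (ev y z)"
    by metis
  interpret A: exponentials "Arr C" "Arr_tensor C T" R ev
  proof (unfold_locales, goal_cases)
    case (1 y z)
    then show ?case using R[of y z] by (simp add: good_def)
  next
    case (2 y z)
    then show ?case using R[of y z] by (simp add: good_def)
  next
    case (3 x y z \<alpha>)
    then show ?case using R[of y z] unfolding good_def Arr_simps(1) by blast
  qed
  show ?thesis
    by (rule A.closed)
qed


section \<open>The monoidal model category of arrows\<close>

lemma left_adjoint_pushout_product:
  assumes F: "left_adjoint C D F" and "symmetric_monoidal C S"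
    and tensor: "\<And>f g. f \<in> Mor C \<Longrightarrow> g \<in> Mor C \<Longrightarrow> FMor F (f \<otimes>\<^bsub>S\<^esub> g) = FMor F f \<otimes>\<^bsub>T\<^esub> FMor F g"
      "\<And>X Y. X \<in> Obj C \<Longrightarrow> Y \<in> Obj C \<Longrightarrow> FObj F (X \<odot>\<^bsub>S\<^esub> Y) = FObj F X \<odot>\<^bsub>T\<^esub> FObj F Y"
    and fg: "f \<in> Mor C" "g \<in> Mor C" and po: "is_pushout_product C S f g h"
  shows "is_pushout_product D T (FMor F f) (FMor F g) (FMor F h)"
proof -
  interpret symmetric_monoidal C S by fact
  interpret F: is_functor C D F
    using F by (simp add: left_adjoint_def)
  obtain P i j where *: "is_pushout C (f \<otimes>\<^bsub>S\<^esub> Ident C (Dom C g)) (Ident C (Dom C f) \<otimes>\<^bsub>S\<^esub> g) P i j"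
    and h: "h \<in> Hom C P (Cod C f \<odot>\<^bsub>S\<^esub> Cod C g)" "h \<cdot>\<^bsub>C\<^esub> i = Ident C (Cod C f) \<otimes>\<^bsub>S\<^esub> g"
      "h \<cdot>\<^bsub>C\<^esub> j = f \<otimes>\<^bsub>S\<^esub> Ident C (Cod C g)"
    using po unfolding is_pushout_product_def by blast
  have ij: "i \<in> Mor C" "j \<in> Mor C" "Cod C i = P" "Cod C j = P"
    using * by (simp_all add: is_pushout_iff Hom_iff)
  show ?thesis
    unfolding is_pushout_product_def
  proof (intro exI conjI)
    show "is_pushout D (FMor F f \<otimes>\<^bsub>T\<^esub> Ident D (Dom D (FMor F g))) (Ident D (Dom D (FMor F f)) \<otimes>\<^bsub>T\<^esub> FMor F g)
        (FObj F P) (FMor F i) (FMor F j)"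
      using left_adjoint_pushout[OF F *] fg by (simp add: tensor)
    show "FMor F h \<in> Hom D (FObj F P) (Cod D (FMor F f) \<odot>\<^bsub>T\<^esub> Cod D (FMor F g))"
      using h fg by (simp add: Hom_iff tensor)
    have "FMor F (h \<cdot>\<^bsub>C\<^esub> i) = Ident D (Cod D (FMor F f)) \<otimes>\<^bsub>T\<^esub> FMor F g"
      "FMor F (h \<cdot>\<^bsub>C\<^esub> j) = FMor F f \<otimes>\<^bsub>T\<^esub> Ident D (Cod D (FMor F g))"
      using h fg by (simp_all add: tensor)
    then show "FMor F h \<cdot>\<^bsub>D\<^esub> FMor F i = Ident D (Cod D (FMor F f)) \<otimes>\<^bsub>T\<^esub> FMor F g"
      "FMor F h \<cdot>\<^bsub>D\<^esub> FMor F j = FMor F f \<otimes>\<^bsub>T\<^esub> Ident D (Cod D (FMor F g))"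
      using h ij F.FMor_Comp_simp[of i h] F.FMor_Comp_simp[of j h] by (simp_all add: Hom_iff)
  qed
qed

lemma left_Quillen_cofibrant:
  assumes F: "left_Quillen C M D N F" and X: "cofibrant C M X"
  shows "cofibrant D N (FObj F X)"
proof -
  have adj: "left_adjoint C D F" and functor_F: "is_functor C D F"
    using F by (simp_all add: left_Quillen_def left_adjoint_def)
  obtain Z f where "initial C Z" "f \<in> Hom C Z X" "f \<in> cof M" "X \<in> Obj C"
    using X by (auto simp: cofibrant_def)
  then have "initial D (FObj F Z)" "FMor F f \<in> Hom D (FObj F Z) (FObj F X)" "FMor F f \<in> cof N" "FObj F X \<in> Obj D"
    using left_adjoint_initial[OF adj] is_functor.FMor_Hom[OF functor_F] is_functor.FObj_Obj[OF functor_F] F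
    by (auto simp: left_Quillen_def)
  then show ?thesis
    by (auto simp: cofibrant_def)
qed

context injective_model_structure
begin

lemma tfib_I_components:
  assumes "(f, g, u, v) \<in> tfib I"
  shows "u \<in> tfib M" "v \<in> tfib M"
  using assms fib_I_components[of f g u v] by (auto simp: tfib_def weq_I)

text \<open>
  The pushout product axiom and the unit axiom can be checked at the domains and at the codomains,
  because both evaluation functors are strict monoidal left Quillen functors.
\<close>

lemma pushout_product_axiom_Arr:
  assumes Z: "terminal C Z" and T: "symmetric_monoidal C T" and axiom: "pushout_product_axiom C M T"
  shows "pushout_product_axiom (Arr C) I (Arr_tensor C T)"
  unfolding pushout_product_axiom_def
proof (intro ballI allI impI)
  interpret symmetric_monoidal C T by fact
  note S = symmetric_monoidal_Arr
  fix \<alpha> \<beta> \<eta> assume \<alpha>: "\<alpha> \<in> cof I" and \<beta>: "\<beta> \<in> cof I"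
    and po: "is_pushout_product (Arr C) (Arr_tensor C T) \<alpha> \<beta> \<eta>"
  have Mor: "\<alpha> \<in> Mor (Arr C)" "\<beta> \<in> Mor (Arr C)"
    using \<alpha> \<beta> by simp_all
  have \<eta>: "\<eta> \<in> Mor (Arr C)"
    using po by (auto simp: is_pushout_product_def Hom_iff)
  have po0: "is_pushout_product C T (FMor (Ev0 C) \<alpha>) (FMor (Ev0 C) \<beta>) (FMor (Ev0 C) \<eta>)"
    by (rule left_adjoint_pushout_product[OF left_adjoint_Ev0[OF Z] S _ _ Mor po]) auto
  have po1: "is_pushout_product C T (FMor (Ev1 C) \<alpha>) (FMor (Ev1 C) \<beta>) (FMor (Ev1 C) \<eta>)"
    by (rule left_adjoint_pushout_product[OF left_adjoint_Ev1 S _ _ Mor po]) auto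
  show "\<eta> \<in> cof I \<and> (\<alpha> \<in> weq I \<or> \<beta> \<in> weq I \<longrightarrow> \<eta> \<in> weq I)"
    using axiom po0 po1 \<alpha> \<beta> \<eta> unfolding pushout_product_axiom_def cof_I weq_I pointwise_def by blast
qed

lemma unit_axiom_Arr:
  assumes Z: "terminal C Z" and T: "symmetric_monoidal C T" and axiom: "unit_axiom C M T"
  shows "unit_axiom (Arr C) I (Arr_tensor C T)"
  unfolding unit_axiom_def
proof (intro allI impI)
  interpret symmetric_monoidal C T by fact
  interpret S: symmetric_monoidal "Arr C" "Arr_tensor C T"
    by (rule symmetric_monoidal_Arr)
  fix Q q A
  assume "cofibrant_replacement (Arr C) I (tunit (Arr_tensor C T)) Q q \<and> cofibrant (Arr C) I A"
  then have Q: "cofibrant (Arr C) I Q" and A: "cofibrant (Arr C) I A"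
    and q: "q \<in> Hom (Arr C) Q (Ident C (tunit T))" "q \<in> tfib I"
    by (simp_all add: cofibrant_replacement_def)
  obtain q0 q1 where q_eq: "q = (Q, Ident C (tunit T), q0, q1)"
    using q(1) by (cases q) (auto simp: Hom_iff)
  note [simp] = tunit_Obj
  have q01: "q0 \<in> Hom C (Dom C Q) (tunit T)" "q1 \<in> Hom C (Cod C Q) (tunit T)"
    using q(1) by (simp_all add: q_eq Hom_iff)
  have "cofibrant_replacement C M (tunit T) (Dom C Q) q0" "cofibrant_replacement C M (tunit T) (Cod C Q) q1"
    using left_Quillen_cofibrant[OF left_Quillen_Ev0[OF Z] Q] left_Quillen_cofibrant[OF left_Quillen_Ev1 Q]
      tfib_I_components[of Q _ q0 q1] q(2) q01
    by (auto simp: cofibrant_replacement_def q_eq)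
  moreover have "cofibrant C M (Dom C A)" "cofibrant C M (Cod C A)"
    using left_Quillen_cofibrant[OF left_Quillen_Ev0[OF Z] A] left_Quillen_cofibrant[OF left_Quillen_Ev1 A]
    by simp_all
  ultimately have weq: "lunit T (Dom C A) \<cdot>\<^bsub>C\<^esub> (q0 \<otimes>\<^bsub>T\<^esub> Ident C (Dom C A)) \<in> weq M"
    "lunit T (Cod C A) \<cdot>\<^bsub>C\<^esub> (q1 \<otimes>\<^bsub>T\<^esub> Ident C (Cod C A)) \<in> weq M"
    using axiom unfolding unit_axiom_def by blast+
  have A_Obj: "A \<in> Obj (Arr C)" and q_Mor: "q \<in> Mor (Arr C)" "Cod (Arr C) q = tunit (Arr_tensor C T)"
    using A q(1) by (simp_all add: cofibrant_def Hom_iff)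
  note A_Ident = I.Ident_simps[OF A_Obj]
  have "lunit (Arr_tensor C T) A \<cdot>\<^bsub>Arr C\<^esub> (q \<otimes>\<^bsub>Arr_tensor C T\<^esub> Ident (Arr C) A) \<in> Mor (Arr C)"
    by (rule I.Comp_simps(1)[OF S.tensor_simps(2)[OF q_Mor(1) A_Ident(1)] S.structure_simps(1)[OF A_Obj]])
      (simp only: S.tensor_simps(4)[OF q_Mor(1) A_Ident(1)] S.structure_simps(2)[OF A_Obj] q_Mor(2) A_Ident(3))
  then show "lunit (Arr_tensor C T) A \<cdot>\<^bsub>Arr C\<^esub> (q \<otimes>\<^bsub>Arr_tensor C T\<^esub> Ident (Arr C) A) \<in> weq I"
    unfolding weq_I pointwise_def mem_Collect_eq using weq by (intro conjI) (assumption | simp add: q_eq)+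
qed

end

theorem theorem2p1:
  fixes C :: "('o, 'a) category" and M :: "'a model_structure"
  assumes "model_category TYPE('u::infinite) C M"
  shows "\<exists>I :: 'a square model_structure.
    model_category TYPE('u) (Arr C) I \<and>
    \<comment> \<open>(1)\<close>
    (\<forall>\<alpha> \<in> Mor (Arr C).
      (\<alpha> \<in> weq I \<longleftrightarrow> FMor (Ev0 C) \<alpha> \<in> weq M \<and> FMor (Ev1 C) \<alpha> \<in> weq M) \<and>
      (\<alpha> \<in> cof I \<longleftrightarrow> FMor (Ev0 C) \<alpha> \<in> cof M \<and> FMor (Ev1 C) \<alpha> \<in> cof M)) \<and>
    \<comment> \<open>(2)\<close>
    (\<forall>f g \<alpha> P p q h.
      \<alpha> \<in> Hom (Arr C) f g \<and>
      is_pullback C (FMor (Ev1 C) \<alpha>) g P p q \<and>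
      h \<in> Hom C (FObj (Ev0 C) f) P \<and> p \<cdot>\<^bsub>C\<^esub> h = f \<and> q \<cdot>\<^bsub>C\<^esub> h = FMor (Ev0 C) \<alpha> \<longrightarrow>
      (\<alpha> \<in> fib I \<longleftrightarrow> FMor (Ev1 C) \<alpha> \<in> fib M \<and> h \<in> fib M) \<and>
      (\<alpha> \<in> tfib I \<longleftrightarrow> FMor (Ev1 C) \<alpha> \<in> tfib M \<and> h \<in> tfib M)) \<and>
    (\<forall>\<alpha> \<in> fib I. FMor (Ev0 C) \<alpha> \<in> fib M \<and> FMor (Ev1 C) \<alpha> \<in> fib M) \<and>
    \<comment> \<open>(3)\<close>
    left_Quillen C M (Arr C) I (L0 C) \<and>
    (\<forall>Z. initial C Z \<longrightarrow> left_Quillen C M (Arr C) I (L1 C Z)) \<and>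
    left_Quillen (Arr C) I C M (Ev0 C) \<and>
    left_Quillen (Arr C) I C M (Ev1 C) \<and>
    \<comment> \<open>(4)\<close>
    (\<forall>T. symmetric_monoidal_model_category TYPE('u) C M T \<longrightarrow>
      symmetric_monoidal_model_category TYPE('u) (Arr C) I (Arr_tensor C T))"
proof -
  have bic: "bicomplete TYPE('u) C" and "model_structure C M"
    using assms by (simp_all add: model_category_def)
  interpret model_structure C M by fact
  interpret injective_setting C M
  proof unfold_locales
    fix f g assume "f \<in> Mor C" "g \<in> Mor C" "Cod C f = Cod C g"
    then show "\<exists>P p q. is_pullback C f g P p q"
      using bicomplete_pullback[OF bic] by metis
  next
    show "\<exists>Z. initial C Z"
      using bicomplete_initial[OF bic] by metis
  qed
  obtain Z where Z: "terminal C Z"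
    using bicomplete_terminal[OF bic] .
  obtain I where I: "model_structure (Arr C) I" and classes: "weq I = pointwise C (weq M)"
    "cof I = pointwise C (cof M)" "fib I = RLP (Arr C) (pointwise C (tcof M))"
    using ex_injective_model_structure .
  interpret I: model_structure "Arr C" I by (rule I)
  interpret injective_model_structure C M I
    by unfold_locales (rule classes)+
  have model: "model_category TYPE('u) (Arr C) I"
    using bicomplete_Arr[OF bic] I by (simp add: model_category_def)
  have weq_cof: "\<forall>\<alpha> \<in> Mor (Arr C).
      (\<alpha> \<in> weq I \<longleftrightarrow> FMor (Ev0 C) \<alpha> \<in> weq M \<and> FMor (Ev1 C) \<alpha> \<in> weq M) \<and>
      (\<alpha> \<in> cof I \<longleftrightarrow> FMor (Ev0 C) \<alpha> \<in> cof M \<and> FMor (Ev1 C) \<alpha> \<in> cof M)"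
    unfolding classes pointwise_def by blast
  have fibrations: "\<forall>f g \<alpha> P p q h. \<alpha> \<in> Hom (Arr C) f g \<and> is_pullback C (FMor (Ev1 C) \<alpha>) g P p q \<and>
      h \<in> Hom C (FObj (Ev0 C) f) P \<and> p \<cdot>\<^bsub>C\<^esub> h = f \<and> q \<cdot>\<^bsub>C\<^esub> h = FMor (Ev0 C) \<alpha> \<longrightarrow>
      (\<alpha> \<in> fib I \<longleftrightarrow> FMor (Ev1 C) \<alpha> \<in> fib M \<and> h \<in> fib M) \<and>
      (\<alpha> \<in> tfib I \<longleftrightarrow> FMor (Ev1 C) \<alpha> \<in> tfib M \<and> h \<in> tfib M)"
  proof (intro allI impI, goal_cases)
    case sq: (1 f g \<alpha> P p q h)
    obtain u v where \<alpha>: "\<alpha> = (f, g, u, v)"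
      using sq by (cases \<alpha>) (auto simp: Hom_iff)
    have "(f, g, u, v) \<in> Mor (Arr C)" "is_corner C (f, g, u, v) P p q h"
      using sq by (simp_all add: \<alpha> Hom_iff is_corner_def)
    from fib_I_iff[OF this] show ?case
      by (simp add: \<alpha>)
  qed
  have components: "\<forall>\<alpha> \<in> fib I. FMor (Ev0 C) \<alpha> \<in> fib M \<and> FMor (Ev1 C) \<alpha> \<in> fib M"
    using fib_I_components by auto
  have L1: "\<forall>Z. initial C Z \<longrightarrow> left_Quillen C M (Arr C) I (L1 C Z)"
    using left_Quillen_L1 by blast
  have monoidal: "\<forall>T. symmetric_monoidal_model_category TYPE('u) C M T \<longrightarrow>
      symmetric_monoidal_model_category TYPE('u) (Arr C) I (Arr_tensor C T)"
  proof (intro allI impI)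
    fix T assume TM: "symmetric_monoidal_model_category TYPE('u) C M T"
    have closed: "closed_symmetric_monoidal C T" and T: "symmetric_monoidal C T"
      and axioms: "pushout_product_axiom C M T" "unit_axiom C M T"
      using TM by (simp_all add: symmetric_monoidal_model_category_def closed_symmetric_monoidal_def)
    show "symmetric_monoidal_model_category TYPE('u) (Arr C) I (Arr_tensor C T)"
      unfolding symmetric_monoidal_model_category_def
      using model closed_symmetric_monoidal_Arr[OF ex_pullback closed]
        pushout_product_axiom_Arr[OF Z T axioms(1)] unit_axiom_Arr[OF Z T axioms(2)] by blast
  qed
  show ?thesis
    using model weq_cof fibrations components left_Quillen_L0 L1 left_Quillen_Ev0[OF Z] left_Quillen_Ev1 monoidal
    by (intro exI[of _ I] conjI)
qed


end
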